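(* Let $(\Lambda,d)$ be a compactly aligned topological $k$-graph. Then the path groupoid $G_\Lambda$ (with the topology described in the context) is a locally compact $r$-discrete topological groupoid admitting a Haar system consisting of counting measures.
   Context: Conventions: $\mathbb{N}=\{0,1,2,\dots\}$; $e_1,\dots,e_k$ are the standard generators of $\mathbb{N}^k$; on $(\mathbb{N}\cup\{\infty\})^k$, $\le$ is the coordinatewise order and $\vee,\wedge$ are coordinatewise max and min. Topological $k$-graph ($k\in\mathbb{N}$): a pair $(\Lambda,d)$ of a small category $\Lambda$ (range = codomain map $r$, source = domain map $s$; the composite $\lambda\mu$ is defined when $s(\lambda)=r(\mu)$) and a functor $d:\Lambda\to\mathbb{N}^k$ such that: (1) the object and morphism sets are second-countable locally compact Hausdorff spaces; (2) $r,s$ are continuous and $s$ is a local homeomorphism; (3) composition, from the set of composable pairs with the relative product topology, is continuous and open; (4) $d$ is continuous, $\mathbb{N}^k$ being discrete; (5) if $d(\lambda)=m+n$ there is a unique composable pair $(\xi,\eta)$ with $\lambda=\xi\eta$, $d(\xi)=m$, $d(\eta)=n$. $\Lambda$ also denotes the morphism set, objects are identified with identity morphisms, $\Lambda^m:=d^{-1}(\{m\})$ (so $\Lambda^0$ is the object set), and $UV:=\{\lambda\mu:\lambda\in U,\mu\in V,s(\lambda)=r(\mu)\}$ for $U,V\subset\Lambda$. Compactly aligned: for all $p,q\in\mathbb{N}^k$ and compact $U\subset\Lambda^p$, $V\subset\Lambda^q$, the set $U\vee V:=U\Lambda^{(p\vee q)-p}\cap V\Lambda^{(p\vee q)-q}$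 is compact. Path space: for $m\in(\mathbb{N}\cup\{\infty\})^k$ let $\Omega_{k,m}$ be the discrete topological $k$-graph with objects $\{p\in\mathbb{N}^k:p\le m\}$, morphisms $\{(p,q)\in\mathbb{N}^k\times\mathbb{N}^k:p\le q\le m\}$, $r(p,q)=p$, $s(p,q)=q$, $(n,p)(p,q)=(n,q)$, $d(p,q)=q-p$. $X_\Lambda$ is the set of all degree-preserving (continuous) functors $x:\Omega_{k,m}\to\Lambda$, $m\in(\mathbb{N}\cup\{\infty\})^k$; put $d(x)=m$, $r(x)=x(0)$. $\Lambda\subset X_\Lambda$ via $\lambda\mapsto x_\lambda$, the unique such functor on $\Omega_{k,d(\lambda)}$ with $x_\lambda(0,d(\lambda))=\lambda$. For $m\in\mathbb{N}^k$, $m\le d(x)$, $\sigma^mx\in X_\Lambda$ has degree $d(x)-m$ and $(\sigma^mx)(0,p)=x(m,m+p)$; for $\lambda\in\Lambda$ with $s(\lambda)=r(x)$, $\lambda x\in X_\Lambda$ has degree $d(\lambda)+d(x)$, $(\lambda x)(0,d(\lambda))=\lambda$ and $\sigma^{d(\lambda)}(\lambda x)=x$. Path groupoid $G_\Lambda$: let $\Lambda*_s\Lambda:=\{(\lambda,\mu)\in\Lambda\times\Lambda:s(\lambda)=s(\mu)\}$ and $U*_sV:=(U\times V)\cap(\Lambda*_s\Lambda)$. $G_\Lambda$ has object set $X_\Lambda$ and morphisms $(\lambda x,d(\lambda)-d(\mu),\mu x)\in X_\Lambda\times\mathbb{Z}^k\times X_\Lambda$ with $(\lambda,\mu)\in\Lambda*_s\Lambda$,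 $x\in X_\Lambda$, $r(x)=s(\lambda)$; $r(x,m,y)=x$, $s(x,m,y)=y$, $(x,m,y)(y,n,z)=(x,m+n,z)$, $(x,m,y)^{-1}=(y,-m,x)$; the unit $x$ is identified with $(x,0,x)$. For $F\subset\Lambda*_s\Lambda$, $m\in\mathbb{Z}^k$, let $Z(F,m):=\{(\lambda x,d(\lambda)-d(\mu),\mu x)\in G_\Lambda:(\lambda,\mu)\in F,\ d(\lambda)-d(\mu)=m\}$. The topology on $G_\Lambda$ has as basis the sets $Z(U*_sV,m)\cap Z(F,m)^c$ with $m\in\mathbb{Z}^k$, $U,V\subset\Lambda$ open, $F\subset\Lambda*_s\Lambda$ compact; $G_\Lambda^{(0)}=X_\Lambda$ has the relative topology. A groupoid is $r$-discrete if its unit space is open in it. *)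

theory Defs
  imports "HOL-Analysis.Analysis" "HOL-Library.Function_Algebras"
begin

text \<open>
  The number \<open>k\<close> is an ordinary natural number (\<open>k = 0\<close> is allowed). Elements of
  \<open>\<nat>\<^sup>k\<close>, \<open>(\<nat> \<union> {\<infinity>})\<^sup>k\<close> and \<open>\<int>\<^sup>k\<close> are the functions on \<^typ>\<open>nat\<close> that vanish outside
  \<open>{..<k}\<close>; order, supremum, sum and difference are the pointwise operations on functions.
\<close>

definition tuples :: "nat \<Rightarrow> (nat \<Rightarrow> 'b::zero) set" where
  "tuples k = {n. \<forall>i\<ge>k. n i = 0}"

abbreviation enat_tuple :: "(nat \<Rightarrow> nat) \<Rightarrow> nat \<Rightarrow> enat" where
  "enat_tuple n \<equiv> (\<lambda>i. enat (n i))"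

text \<open>
  Categories are presented by their morphisms, objects being identified with identity morphisms;
  the morphism set is the \<^const>\<open>topspace\<close> of the topology and the object set has the relative
  topology. The composite \<open>cmp C x y\<close> is meaningful only when \<open>src C x = rng C y\<close>.
\<close>

record 'a top_category =
  topo :: "'a topology"
  rng :: "'a \<Rightarrow> 'a"
  src :: "'a \<Rightarrow> 'a"
  cmp :: "'a \<Rightarrow> 'a \<Rightarrow> 'a"

abbreviation mor :: "('a, 'z) top_category_scheme \<Rightarrow> 'a set" where
  "mor C \<equiv> topspace (topo C)"

definition obj :: "('a, 'z) top_category_scheme \<Rightarrow> 'a set" where
  "obj C = {v \<in> mor C. rng C v = v \<and> src C v = v}"

abbreviation obj_topo :: "('a, 'z) top_category_scheme \<Rightarrow> 'a topology" where
  "obj_topo C \<equiv> subtopology (topo C) (obj C)"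

definition composable :: "('a, 'z) top_category_scheme \<Rightarrow> ('a \<times> 'a) set" where
  "composable C = {(x, y). x \<in> mor C \<and> y \<in> mor C \<and> src C x = rng C y}"

abbreviation composable_topo :: "('a, 'z) top_category_scheme \<Rightarrow> ('a \<times> 'a) topology" where
  "composable_topo C \<equiv> subtopology (prod_topology (topo C) (topo C)) (composable C)"

definition is_category :: "('a, 'z) top_category_scheme \<Rightarrow> bool" where
  "is_category C \<longleftrightarrow>
     (\<forall>x\<in>mor C. rng C x \<in> obj C \<and> src C x \<in> obj C) \<and>
     (\<forall>(x, y)\<in>composable C.
        cmp C x y \<in> mor C \<and> rng C (cmp C x y) = rng C x \<and> src C (cmp C x y) = src C y) \<and>
     (\<forall>x y z. (x, y) \<in> composable C \<and> (y, z) \<in> composable C \<longrightarrow>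
        cmp C (cmp C x y) z = cmp C x (cmp C y z)) \<and>
     (\<forall>x\<in>mor C. cmp C (rng C x) x = x \<and> cmp C x (src C x) = x)"

definition is_functor ::
    "('a, 'y) top_category_scheme \<Rightarrow> ('b, 'z) top_category_scheme \<Rightarrow> ('a \<Rightarrow> 'b) \<Rightarrow> bool" where
  "is_functor C D f \<longleftrightarrow>
     (\<forall>x\<in>mor C. f x \<in> mor D \<and> f (rng C x) = rng D (f x) \<and> f (src C x) = src D (f x)) \<and>
     (\<forall>(x, y)\<in>composable C. f (cmp C x y) = cmp D (f x) (f y))"

definition local_homeomorphism :: "'a topology \<Rightarrow> 'b topology \<Rightarrow> ('a \<Rightarrow> 'b) \<Rightarrow> bool" where
  "local_homeomorphism X Y f \<longleftrightarrow>
     (\<forall>x\<in>topspace X. \<exists>U. openin X U \<and> x \<in> U \<and> openin Y (f ` U) \<and>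
        homeomorphic_map (subtopology X U) (subtopology Y (f ` U)) f)"


section \<open>Topological \<open>k\<close>-graphs\<close>

record 'a kgraph = "'a top_category" +
  deg :: "'a \<Rightarrow> nat \<Rightarrow> nat"

definition topological_kgraph :: "nat \<Rightarrow> 'a kgraph \<Rightarrow> bool" where
  "topological_kgraph k \<Lambda> \<longleftrightarrow>
     is_category \<Lambda> \<and>
     (\<forall>x\<in>mor \<Lambda>. deg \<Lambda> x \<in> tuples k) \<and>
     (\<forall>v\<in>obj \<Lambda>. deg \<Lambda> v = 0) \<and>
     (\<forall>(x, y)\<in>composable \<Lambda>. deg \<Lambda> (cmp \<Lambda> x y) = deg \<Lambda> x + deg \<Lambda> y) \<and>
     second_countable (topo \<Lambda>) \<and> locally_compact_space (topo \<Lambda>) \<and> Hausdorff_space (topo \<Lambda>) \<and>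
     second_countable (obj_topo \<Lambda>) \<and> locally_compact_space (obj_topo \<Lambda>) \<and>
       Hausdorff_space (obj_topo \<Lambda>) \<and>
     continuous_map (topo \<Lambda>) (obj_topo \<Lambda>) (rng \<Lambda>) \<and>
     continuous_map (topo \<Lambda>) (obj_topo \<Lambda>) (src \<Lambda>) \<and>
     local_homeomorphism (topo \<Lambda>) (obj_topo \<Lambda>) (src \<Lambda>) \<and>
     continuous_map (composable_topo \<Lambda>) (topo \<Lambda>) (\<lambda>(x, y). cmp \<Lambda> x y) \<and>
     open_map (composable_topo \<Lambda>) (topo \<Lambda>) (\<lambda>(x, y). cmp \<Lambda> x y) \<and>
     continuous_map (topo \<Lambda>) (discrete_topology (tuples k)) (deg \<Lambda>) \<and>
     (\<forall>x\<in>mor \<Lambda>. \<forall>m\<in>tuples k. \<forall>n\<in>tuples k. deg \<Lambda> x = m + n \<longrightarrow>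
        (\<exists>!(y, z). (y, z) \<in> composable \<Lambda> \<and> x = cmp \<Lambda> y z \<and> deg \<Lambda> y = m \<and> deg \<Lambda> z = n))"

definition of_degree :: "'a kgraph \<Rightarrow> (nat \<Rightarrow> nat) \<Rightarrow> 'a set" where
  "of_degree \<Lambda> n = {x \<in> mor \<Lambda>. deg \<Lambda> x = n}"

definition set_cmp :: "'a kgraph \<Rightarrow> 'a set \<Rightarrow> 'a set \<Rightarrow> 'a set" where
  "set_cmp \<Lambda> U V = {cmp \<Lambda> x y | x y. x \<in> U \<and> y \<in> V \<and> src \<Lambda> x = rng \<Lambda> y}"

definition compactly_aligned :: "nat \<Rightarrow> 'a kgraph \<Rightarrow> bool" where
  "compactly_aligned k \<Lambda> \<longleftrightarrow>
     (\<forall>p\<in>tuples k. \<forall>q\<in>tuples k. \<forall>U V.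
        compactin (topo \<Lambda>) U \<and> U \<subseteq> of_degree \<Lambda> p \<and>
        compactin (topo \<Lambda>) V \<and> V \<subseteq> of_degree \<Lambda> q \<longrightarrow>
        compactin (topo \<Lambda>)
          (set_cmp \<Lambda> U (of_degree \<Lambda> (sup p q - p)) \<inter> set_cmp \<Lambda> V (of_degree \<Lambda> (sup p q - q))))"


section \<open>The path space\<close>

definition Omega :: "nat \<Rightarrow> (nat \<Rightarrow> enat) \<Rightarrow> ((nat \<Rightarrow> nat) \<times> (nat \<Rightarrow> nat)) kgraph" where
  "Omega k m = \<lparr>
     topo = discrete_topology
       {(p, q). p \<in> tuples k \<and> q \<in> tuples k \<and> p \<le> q \<and> enat_tuple q \<le> m},
     rng = (\<lambda>(p, q). (p, p)),
     src = (\<lambda>(p, q). (q, q)),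
     cmp = (\<lambda>(n, p) (p', q). (n, q)),
     deg = (\<lambda>(p, q). q - p)\<rparr>"

text \<open>
  A path is stored together with its degree \<open>m\<close>; the functor on \<open>\<Omega>\<^sub>k\<^sub>,\<^sub>m\<close> is made extensional so
  that paths are equal exactly when they have the same degree and are the same functor. Its
  continuity is automatic because \<open>\<Omega>\<^sub>k\<^sub>,\<^sub>m\<close> is discrete.
\<close>

type_synonym 'a kpath = "(nat \<Rightarrow> enat) \<times> ((nat \<Rightarrow> nat) \<times> (nat \<Rightarrow> nat) \<Rightarrow> 'a)"

definition path_space :: "nat \<Rightarrow> 'a kgraph \<Rightarrow> 'a kpath set" where
  "path_space k \<Lambda> = {(m, x). m \<in> tuples k \<and> x \<in> extensional (mor (Omega k m)) \<and>
     is_functor (Omega k m) \<Lambda> x \<and>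
     (\<forall>a\<in>mor (Omega k m). deg \<Lambda> (x a) = deg (Omega k m) a)}"

definition path_deg :: "'a kpath \<Rightarrow> nat \<Rightarrow> enat" where
  "path_deg x = fst x"

text \<open>The object \<open>0\<close> of \<open>\<Omega>\<^sub>k\<^sub>,\<^sub>m\<close> is its identity morphism \<open>(0, 0)\<close>.\<close>

definition path_rng :: "'a kpath \<Rightarrow> 'a" where
  "path_rng x = snd x (0, 0)"

definition path_shift :: "nat \<Rightarrow> (nat \<Rightarrow> nat) \<Rightarrow> 'a kpath \<Rightarrow> 'a kpath" where
  "path_shift k m x = (let n = path_deg x - enat_tuple m in
     (n, restrict (\<lambda>(p, q). snd x (m + p, m + q)) (mor (Omega k n))))"

text \<open>The path \<open>\<lambda>x\<close>, for \<open>\<lambda> \<in> \<Lambda>\<close> and \<open>x \<in> X\<^sub>\<Lambda>\<close> with \<open>s(\<lambda>) = r(x)\<close>.\<close>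

definition path_prepend :: "nat \<Rightarrow> 'a kgraph \<Rightarrow> 'a \<Rightarrow> 'a kpath \<Rightarrow> 'a kpath" where
  "path_prepend k \<Lambda> l x = (THE y. y \<in> path_space k \<Lambda> \<and>
     path_deg y = enat_tuple (deg \<Lambda> l) + path_deg x \<and>
     snd y (0, deg \<Lambda> l) = l \<and> path_shift k (deg \<Lambda> l) y = x)"


section \<open>Topological groupoids and Haar systems\<close>

record 'a groupoid = "'a top_category" +
  inverse_mor :: "'a \<Rightarrow> 'a"

definition topological_groupoid :: "'a groupoid \<Rightarrow> bool" where
  "topological_groupoid G \<longleftrightarrow>
     is_category G \<and>
     (\<forall>x\<in>mor G. inverse_mor G x \<in> mor G \<and>
        rng G (inverse_mor G x) = src G x \<and> src G (inverse_mor G x) = rng G x \<and>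
        cmp G x (inverse_mor G x) = rng G x \<and> cmp G (inverse_mor G x) x = src G x) \<and>
     continuous_map (topo G) (obj_topo G) (rng G) \<and>
     continuous_map (topo G) (obj_topo G) (src G) \<and>
     continuous_map (composable_topo G) (topo G) (\<lambda>(x, y). cmp G x y) \<and>
     continuous_map (topo G) (topo G) (inverse_mor G)"

definition r_discrete :: "'a groupoid \<Rightarrow> bool" where
  "r_discrete G \<longleftrightarrow> openin (topo G) (obj G)"

definition rng_fibre :: "'a groupoid \<Rightarrow> 'a \<Rightarrow> 'a set" where
  "rng_fibre G u = {x \<in> mor G. rng G x = u}"

definition radon_measure :: "'a topology \<Rightarrow> 'a measure \<Rightarrow> bool" where
  "radon_measure T M \<longleftrightarrow>
     space M = topspace T \<and> sets M = sigma_sets (topspace T) {U. openin T U} \<and>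
     (\<forall>K. compactin T K \<longrightarrow> emeasure M K < \<infinity>) \<and>
     (\<forall>A\<in>sets M. emeasure M A = (INF U\<in>{U. openin T U \<and> A \<subseteq> U}. emeasure M U)) \<and>
     (\<forall>U. openin T U \<longrightarrow>
        emeasure M U = (SUP K\<in>{K. compactin T K \<and> K \<subseteq> U}. emeasure M K))"

definition measure_support :: "'a topology \<Rightarrow> 'a measure \<Rightarrow> 'a set" where
  "measure_support T M = {x \<in> topspace T. \<forall>U. openin T U \<and> x \<in> U \<longrightarrow> emeasure M U > 0}"

definition Cc :: "'a topology \<Rightarrow> ('a \<Rightarrow> complex) set" where
  "Cc T = {f. continuous_map T euclidean f \<and>
     compactin T (T closure_of {x \<in> topspace T. f x \<noteq> 0})}"

text \<open>
  Haar systems in the sense of Renault, on a locally compact Hausdorff topological groupoid.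
  In the invariance condition the integral is restricted to the fibre over \<open>s(x)\<close>, which carries
  the measure, because \<open>cmp G x y\<close> is unspecified for other \<open>y\<close>.
\<close>

definition haar_system :: "'a groupoid \<Rightarrow> ('a \<Rightarrow> 'a measure) \<Rightarrow> bool" where
  "haar_system G \<mu> \<longleftrightarrow>
     topological_groupoid G \<and> locally_compact_space (topo G) \<and> Hausdorff_space (topo G) \<and>
     (\<forall>u\<in>obj G. radon_measure (topo G) (\<mu> u) \<and> measure_support (topo G) (\<mu> u) = rng_fibre G u) \<and>
     (\<forall>f\<in>Cc (topo G). continuous_map (obj_topo G) euclidean (\<lambda>u. \<integral>y. f y \<partial>(\<mu> u))) \<and>
     (\<forall>x\<in>mor G. \<forall>f\<in>Cc (topo G).
        set_lebesgue_integral (\<mu> (src G x)) (rng_fibre G (src G x)) (\<lambda>y. f (cmp G x y)) =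
        (\<integral>y. f y \<partial>(\<mu> (rng G x))))"

definition counting_measures :: "'a groupoid \<Rightarrow> ('a \<Rightarrow> 'a measure) \<Rightarrow> bool" where
  "counting_measures G \<mu> \<longleftrightarrow>
     (\<forall>u\<in>obj G. \<forall>A\<in>sets (\<mu> u).
        emeasure (\<mu> u) A = emeasure (count_space (rng_fibre G u)) (A \<inter> rng_fibre G u))"


section \<open>The path groupoid\<close>

type_synonym 'a gpd_elem = "'a kpath \<times> (nat \<Rightarrow> int) \<times> 'a kpath"

definition deg_diff :: "'a kgraph \<Rightarrow> 'a \<Rightarrow> 'a \<Rightarrow> nat \<Rightarrow> int" where
  "deg_diff \<Lambda> l m = (\<lambda>i. int (deg \<Lambda> l i) - int (deg \<Lambda> m i))"

definition src_pairs :: "'a kgraph \<Rightarrow> 'a set \<Rightarrow> 'a set \<Rightarrow> ('a \<times> 'a) set" where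
  "src_pairs \<Lambda> U V = {(l, m). l \<in> U \<and> m \<in> V \<and> src \<Lambda> l = src \<Lambda> m}"

definition path_gpd_mor :: "nat \<Rightarrow> 'a kgraph \<Rightarrow> 'a gpd_elem set" where
  "path_gpd_mor k \<Lambda> =
     {(path_prepend k \<Lambda> l x, deg_diff \<Lambda> l m, path_prepend k \<Lambda> m x) | l m x.
        (l, m) \<in> src_pairs \<Lambda> (mor \<Lambda>) (mor \<Lambda>) \<and> x \<in> path_space k \<Lambda> \<and> path_rng x = src \<Lambda> l}"

definition cylinder :: "nat \<Rightarrow> 'a kgraph \<Rightarrow> ('a \<times> 'a) set \<Rightarrow> (nat \<Rightarrow> int) \<Rightarrow> 'a gpd_elem set" where
  "cylinder k \<Lambda> F n =
     {(path_prepend k \<Lambda> l x, deg_diff \<Lambda> l m, path_prepend k \<Lambda> m x) | l m x.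
        (l, m) \<in> F \<and> deg_diff \<Lambda> l m = n \<and> x \<in> path_space k \<Lambda> \<and> path_rng x = src \<Lambda> l}"

definition path_gpd_basis :: "nat \<Rightarrow> 'a kgraph \<Rightarrow> 'a gpd_elem set set" where
  "path_gpd_basis k \<Lambda> =
     {cylinder k \<Lambda> (src_pairs \<Lambda> U V) n \<inter> (path_gpd_mor k \<Lambda> - cylinder k \<Lambda> F n) | U V F n.
        n \<in> tuples k \<and> openin (topo \<Lambda>) U \<and> openin (topo \<Lambda>) V \<and>
        F \<subseteq> src_pairs \<Lambda> (mor \<Lambda>) (mor \<Lambda>) \<and> compactin (prod_topology (topo \<Lambda>) (topo \<Lambda>)) F}"

definition path_groupoid :: "nat \<Rightarrow> 'a kgraph \<Rightarrow> 'a gpd_elem groupoid" where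
  "path_groupoid k \<Lambda> = \<lparr>
     topo = topology_generated_by (path_gpd_basis k \<Lambda>),
     rng = (\<lambda>(x, m, y). (x, 0, x)),
     src = (\<lambda>(x, m, y). (y, 0, y)),
     cmp = (\<lambda>(x, m, y) (y', n, z). (x, m + n, z)),
     inverse_mor = (\<lambda>(x, m, y). (y, - m, x))\<rparr>"

text \<open>
  Taking \<open>U = V = \<Lambda>\<close> and \<open>F = {}\<close> shows that the basic sets cover all the morphisms.
\<close>

lemma mor_path_groupoid:
  assumes "topological_kgraph k \<Lambda>"
  shows "mor (path_groupoid k \<Lambda>) = path_gpd_mor k \<Lambda>"
proof -
  have "\<Union> (path_gpd_basis k \<Lambda>) = path_gpd_mor k \<Lambda>"
  proof
    show "\<Union> (path_gpd_basis k \<Lambda>) \<subseteq> path_gpd_mor k \<Lambda>"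
      by (auto simp: path_gpd_basis_def)
    show "path_gpd_mor k \<Lambda> \<subseteq> \<Union> (path_gpd_basis k \<Lambda>)"
    proof
      fix g assume g: "g \<in> path_gpd_mor k \<Lambda>"
      then obtain l m x where lmx: "(l, m) \<in> src_pairs \<Lambda> (mor \<Lambda>) (mor \<Lambda>)"
        "x \<in> path_space k \<Lambda>" "path_rng x = src \<Lambda> l"
        "g = (path_prepend k \<Lambda> l x, deg_diff \<Lambda> l m, path_prepend k \<Lambda> m x)"
        by (auto simp: path_gpd_mor_def)
      let ?n = "deg_diff \<Lambda> l m"
      let ?B = "cylinder k \<Lambda> (src_pairs \<Lambda> (mor \<Lambda>) (mor \<Lambda>)) ?n
        \<inter> (path_gpd_mor k \<Lambda> - cylinder k \<Lambda> {} ?n)"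
      have "?n \<in> tuples k"
        using lmx(1) assms
        by (auto simp: topological_kgraph_def src_pairs_def deg_diff_def tuples_def)
      then have "?B \<in> path_gpd_basis k \<Lambda>"
        unfolding path_gpd_basis_def by blast
      moreover have "g \<in> ?B"
        using g lmx unfolding cylinder_def by blast
      ultimately show "g \<in> \<Union> (path_gpd_basis k \<Lambda>)" by blast
    qed
  qed
  then show ?thesis by (simp add: path_groupoid_def)
qed

end

theory Submission
  imports Defs
begin

text \<open>
  A path \<open>x\<close> is determined by its initial segments \<open>x(0,q)\<close>, so the path space embeds in the
  product over \<open>q \<in> \<nat>\<^sup>k\<close> of the one-point compactification of \<open>\<Lambda>\<close>, the value \<open>\<infinity>\<close>
  recording that \<open>q \<le> d(x)\<close> fails. Compact alignment says that in a limit of paths the set of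
  \<open>q\<close> with finite value stays directed, so that sets of paths with an initial segment in a given
  compact set are closed in the product; hence the path space is locally compact Hausdorff.

  An element \<open>(x,n,y)\<close> of the groupoid is a pair of paths with \<open>\<sigma>\<^sup>p x = \<sigma>\<^sup>q y\<close> for some
  \<open>p - q = n\<close>. Near it, the groupoid topology is the initial one for \<open>x\<close> and the single segment
  \<open>y(0,q)\<close>: since \<open>s\<close> is a local homeomorphism, the tails of \<open>x\<close> and \<open>y\<close> coincide as soon
  as they are close, and since compositions are continuous, all other coordinates follow. Solving
  \<open>s(x(0,p)) = s(y(0,q))\<close> for \<open>y(0,q)\<close> then gives local sections of the range map, which is
  therefore a local homeomorphism, and over an etale groupoid the counting measures form a Haar
  system.
\<close>

section \<open>Factorisation in a topological \<open>k\<close>-graph\<close>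

lemma tuples_add [intro]: "m \<in> tuples k \<Longrightarrow> n \<in> tuples k \<Longrightarrow> m + n \<in> tuples k"
  for m n :: "nat \<Rightarrow> nat"
  by (simp add: tuples_def)

lemma tuples_diff [intro]: "m \<in> tuples k \<Longrightarrow> m - n \<in> tuples k"
  for m n :: "nat \<Rightarrow> nat"
  by (simp add: tuples_def)

lemma tuples_sup [intro]: "m \<in> tuples k \<Longrightarrow> n \<in> tuples k \<Longrightarrow> sup m n \<in> tuples k"
  for m n :: "nat \<Rightarrow> nat"
  by (simp add: tuples_def)

lemma tuples_0 [simp, intro]: "0 \<in> tuples k"
  by (simp add: tuples_def)

lemma tuples_le: "n \<in> tuples k \<Longrightarrow> m \<le> n \<Longrightarrow> m \<in> tuples k"
  for m n :: "nat \<Rightarrow> nat"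
  unfolding tuples_def le_fun_def mem_Collect_eq by (metis le_zero_eq)

lemma fun_le_add_diff: "m \<le> n \<Longrightarrow> m + (n - m) = n"
  for m n :: "'b \<Rightarrow> nat"
  by (auto simp: le_fun_def fun_eq_iff)

text \<open>Subtraction of natural numbers is truncated, so adding it back gives the join. Common
  refinements of two degrees are usually written in this form, a degree plus a surplus, because
  shifting and \<open>same_tail_add\<close> require it.\<close>

lemma fun_add_diff_sup: "m + (n - m) = sup m n"
  for m n :: "'b \<Rightarrow> nat"
  by (auto simp: fun_eq_iff sup_max)

lemma fun_le_add: "m \<le> m + n"
  for m n :: "'b \<Rightarrow> nat"
  by (auto simp: le_fun_def)

lemma fun_zero_le [simp]: "0 \<le> n"
  for n :: "'b \<Rightarrow> nat"
  by (auto simp: le_fun_def)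

lemma fun_diff_simps [simp]: "n - 0 = n" "n - n = 0" "m + n - m = n" "n + m - m = n"
  for m n :: "'b \<Rightarrow> nat"
  by (auto simp: fun_eq_iff)

locale top_kgraph =
  fixes k :: nat and \<Lambda> :: "'a kgraph"
  assumes kgraph: "topological_kgraph k \<Lambda>"
begin

abbreviation M :: "'a set" where "M \<equiv> mor \<Lambda>"
abbreviation comp (infixl "\<cdot>" 70) where "comp \<equiv> cmp \<Lambda>"
abbreviation d :: "'a \<Rightarrow> nat \<Rightarrow> nat" where "d \<equiv> deg \<Lambda>"
abbreviation L :: "(nat \<Rightarrow> nat) \<Rightarrow> 'a set" where "L \<equiv> of_degree \<Lambda>"

lemma kgraphD:
  shows "is_category \<Lambda>"
    and "\<forall>x\<in>M. d x \<in> tuples k"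
    and "\<forall>v\<in>obj \<Lambda>. d v = 0"
    and "\<forall>(x, y)\<in>composable \<Lambda>. d (x \<cdot> y) = d x + d y"
    and "locally_compact_space (topo \<Lambda>)"
    and "Hausdorff_space (topo \<Lambda>)"
    and "continuous_map (topo \<Lambda>) (obj_topo \<Lambda>) (rng \<Lambda>)"
    and "continuous_map (topo \<Lambda>) (obj_topo \<Lambda>) (src \<Lambda>)"
    and "local_homeomorphism (topo \<Lambda>) (obj_topo \<Lambda>) (src \<Lambda>)"
    and "continuous_map (composable_topo \<Lambda>) (topo \<Lambda>) (\<lambda>(x, y). x \<cdot> y)"
    and "open_map (composable_topo \<Lambda>) (topo \<Lambda>) (\<lambda>(x, y). x \<cdot> y)"
    and "continuous_map (topo \<Lambda>) (discrete_topology (tuples k)) d"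
    and "\<forall>x\<in>M. \<forall>m\<in>tuples k. \<forall>n\<in>tuples k. d x = m + n \<longrightarrow>
      (\<exists>!(y, z). (y, z) \<in> composable \<Lambda> \<and> x = y \<cdot> z \<and> d y = m \<and> d z = n)"
  using kgraph unfolding topological_kgraph_def by - (elim conjE, assumption)+

lemma categoryD:
  shows "\<forall>x\<in>M. rng \<Lambda> x \<in> obj \<Lambda> \<and> src \<Lambda> x \<in> obj \<Lambda>"
    and "\<forall>(x, y)\<in>composable \<Lambda>. x \<cdot> y \<in> M \<and> rng \<Lambda> (x \<cdot> y) = rng \<Lambda> x \<and> src \<Lambda> (x \<cdot> y) = src \<Lambda> y"
    and "\<forall>x y z. (x, y) \<in> composable \<Lambda> \<and> (y, z) \<in> composable \<Lambda> \<longrightarrow> x \<cdot> y \<cdot> z = x \<cdot> (y \<cdot> z)"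
    and "\<forall>x\<in>M. rng \<Lambda> x \<cdot> x = x \<and> x \<cdot> src \<Lambda> x = x"
  using kgraphD(1) unfolding is_category_def by - (elim conjE, assumption)+

lemma obj_M: "v \<in> obj \<Lambda> \<Longrightarrow> v \<in> M"
  and rng_obj: "v \<in> obj \<Lambda> \<Longrightarrow> rng \<Lambda> v = v"
  and src_obj: "v \<in> obj \<Lambda> \<Longrightarrow> src \<Lambda> v = v"
  by (auto simp: obj_def)

lemma rng_in [simp, intro]: "l \<in> M \<Longrightarrow> rng \<Lambda> l \<in> obj \<Lambda>"
  and src_in [simp, intro]: "l \<in> M \<Longrightarrow> src \<Lambda> l \<in> obj \<Lambda>"
  and id_cmp: "l \<in> M \<Longrightarrow> rng \<Lambda> l \<cdot> l = l"
  and cmp_id: "l \<in> M \<Longrightarrow> l \<cdot> src \<Lambda> l = l"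
  using categoryD(1,4) by blast+

lemma rng_M [simp, intro]: "l \<in> M \<Longrightarrow> rng \<Lambda> l \<in> M"
  and src_M [simp, intro]: "l \<in> M \<Longrightarrow> src \<Lambda> l \<in> M"
  using obj_M by blast+

lemma cmp_props [simp]:
  assumes "x \<in> M" "y \<in> M" "src \<Lambda> x = rng \<Lambda> y"
  shows "x \<cdot> y \<in> M" "rng \<Lambda> (x \<cdot> y) = rng \<Lambda> x" "src \<Lambda> (x \<cdot> y) = src \<Lambda> y" "d (x \<cdot> y) = d x + d y"
proof -
  have "(x, y) \<in> composable \<Lambda>" using assms by (simp add: composable_def)
  then show "x \<cdot> y \<in> M" "rng \<Lambda> (x \<cdot> y) = rng \<Lambda> x" "src \<Lambda> (x \<cdot> y) = src \<Lambda> y"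
    "d (x \<cdot> y) = d x + d y"
    using categoryD(2) kgraphD(4) by auto
qed

lemma cmp_assoc:
  assumes "x \<in> M" "y \<in> M" "z \<in> M" "src \<Lambda> x = rng \<Lambda> y" "src \<Lambda> y = rng \<Lambda> z"
  shows "(x \<cdot> y) \<cdot> z = x \<cdot> (y \<cdot> z)"
  using categoryD(3) assms by (simp add: composable_def)

lemma d_tuples [simp, intro]: "l \<in> M \<Longrightarrow> d l \<in> tuples k"
  using kgraphD(2) by blast

lemma d_obj [simp]: "v \<in> obj \<Lambda> \<Longrightarrow> d v = 0"
  using kgraphD(3) by blast

lemmas loc_compact = kgraphD(5) and Hausdorff = kgraphD(6)

lemma continuous_rng: "continuous_map (topo \<Lambda>) (topo \<Lambda>) (rng \<Lambda>)"
  and continuous_src: "continuous_map (topo \<Lambda>) (topo \<Lambda>) (src \<Lambda>)"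
  using kgraphD(7,8) continuous_map_into_fulltopology by blast+

lemma openin_d: "openin (topo \<Lambda>) {l \<in> M. P (d l)}"
proof -
  from openin_continuous_map_preimage[OF kgraphD(12), of "{n \<in> tuples k. P n}"]
  have "openin (topo \<Lambda>) {l \<in> M. d l \<in> {n \<in> tuples k. P n}}" by auto
  moreover have "{l \<in> M. d l \<in> {n \<in> tuples k. P n}} = {l \<in> M. P (d l)}" by auto
  ultimately show ?thesis by simp
qed

lemma openin_L: "openin (topo \<Lambda>) (L n)"
  unfolding of_degree_def by (rule openin_d)

lemma closedin_d: "closedin (topo \<Lambda>) {l \<in> M. P (d l)}"
proof -
  have "M - {l \<in> M. P (d l)} = {l \<in> M. \<not> P (d l)}" by auto
  then show ?thesis using openin_d[of "\<lambda>n. \<not> P n"] by (auto simp: closedin_def)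
qed

text \<open>The axiom prescribes the degrees of both factors. The second follows from additivity, so
  prescribing \<open>m\<close> for the first already pins the pair down. A single variable for the
  pair suits the description operator in \<open>factor\<close>.\<close>

lemma factor_ex1:
  assumes "l \<in> M" "m \<le> d l"
  shows "\<exists>!yz. fst yz \<in> M \<and> snd yz \<in> M \<and> src \<Lambda> (fst yz) = rng \<Lambda> (snd yz) \<and>
    fst yz \<cdot> snd yz = l \<and> d (fst yz) = m"
proof -
  have m: "m \<in> tuples k" "d l - m \<in> tuples k" using assms tuples_le by blast+
  have e: "d l = m + (d l - m)" using fun_le_add_diff[OF assms(2)] by simp
  have "\<exists>!(y, z). (y, z) \<in> composable \<Lambda> \<and> l = y \<cdot> z \<and> d y = m \<and> d z = d l - m"
    using kgraphD(13) assms(1) m e by blast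
  moreover have "d z = d l - m"
    if "y \<in> M" "z \<in> M" "src \<Lambda> y = rng \<Lambda> z" "y \<cdot> z = l" "d y = m" for y z
    using cmp_props(4)[OF that(1-3)] that by simp
  then have "(\<lambda>(y, z). (y, z) \<in> composable \<Lambda> \<and> l = y \<cdot> z \<and> d y = m \<and> d z = d l - m) =
     (\<lambda>yz. fst yz \<in> M \<and> snd yz \<in> M \<and> src \<Lambda> (fst yz) = rng \<Lambda> (snd yz) \<and> fst yz \<cdot> snd yz = l \<and> d (fst yz) = m)"
    by (auto simp: composable_def fun_eq_iff)
  ultimately show ?thesis by (simp only:)
qed

definition factor :: "(nat \<Rightarrow> nat) \<Rightarrow> 'a \<Rightarrow> 'a \<times> 'a" where
  "factor m l = (THE yz. fst yz \<in> M \<and> snd yz \<in> M \<and> src \<Lambda> (fst yz) = rng \<Lambda> (snd yz) \<and>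
    fst yz \<cdot> snd yz = l \<and> d (fst yz) = m)"

definition head :: "(nat \<Rightarrow> nat) \<Rightarrow> 'a \<Rightarrow> 'a" where "head m l = fst (factor m l)"
definition tail :: "(nat \<Rightarrow> nat) \<Rightarrow> 'a \<Rightarrow> 'a" where "tail m l = snd (factor m l)"

lemma head_tail:
  assumes "l \<in> M" "m \<le> d l"
  shows "head m l \<in> M" "tail m l \<in> M" "src \<Lambda> (head m l) = rng \<Lambda> (tail m l)"
    "head m l \<cdot> tail m l = l" "d (head m l) = m"
  using theI'[OF factor_ex1[OF assms]] unfolding head_def tail_def factor_def by blast+

lemma head_tail_cmp:
  assumes "x \<in> M" "y \<in> M" "src \<Lambda> x = rng \<Lambda> y"
  shows "head (d x) (x \<cdot> y) = x" "tail (d x) (x \<cdot> y) = y"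
proof -
  have "d x \<le> d (x \<cdot> y)" using assms fun_le_add by simp
  then have "factor (d x) (x \<cdot> y) = (x, y)"
    unfolding factor_def
    by (intro the1_equality[OF factor_ex1]) (use assms in auto)
  then show "head (d x) (x \<cdot> y) = x" "tail (d x) (x \<cdot> y) = y"
    by (auto simp: head_def tail_def)
qed

lemma d_tail:
  assumes "l \<in> M" "m \<le> d l" shows "d (tail m l) = d l - m"
proof -
  have "d l = m + d (tail m l)" using head_tail[OF assms] cmp_props(4) by metis
  then show ?thesis by simp
qed

lemma src_tail: "l \<in> M \<Longrightarrow> m \<le> d l \<Longrightarrow> src \<Lambda> (tail m l) = src \<Lambda> l"
  using head_tail cmp_props by metis

lemma head_0: "l \<in> M \<Longrightarrow> head 0 l = rng \<Lambda> l" and tail_0: "l \<in> M \<Longrightarrow> tail 0 l = l"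
  using head_tail_cmp[of "rng \<Lambda> l" l] id_cmp[of l] rng_obj src_obj by auto

lemma head_d: "l \<in> M \<Longrightarrow> head (d l) l = l" and tail_d: "l \<in> M \<Longrightarrow> tail (d l) l = src \<Lambda> l"
  using head_tail_cmp[of l "src \<Lambda> l"] cmp_id[of l] rng_obj src_obj by auto

text \<open>Both trivial factorisations, \<open>rng \<Lambda> l \<cdot> l\<close> and
  \<open>l \<cdot> src \<Lambda> l\<close>, have a left factor of degree 0. Uniqueness forces
  \<open>l = rng \<Lambda> l\<close>.\<close>

lemma deg_0_obj: assumes "l \<in> M" "d l = 0" shows "l \<in> obj \<Lambda>"
proof -
  have "l = rng \<Lambda> l" using head_d[of l] head_0[of l] assms by simp
  then show ?thesis using rng_in assms by metis
qed

lemma L_0: "L 0 = obj \<Lambda>"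
  using deg_0_obj by (auto simp: of_degree_def obj_M)

text \<open>All three identities are read off one decomposition \<open>l = x \<cdot> (y \<cdot> z)\<close>.\<close>

lemma cut_cut:
  assumes l: "l \<in> M" "m + n \<le> d l"
  shows "head m (head (m + n) l) = head m l"
    "tail m (head (m + n) l) = head n (tail m l)"
    "tail n (tail m l) = tail (m + n) l"
proof -
  let ?h = "head (m + n) l" and ?z = "tail (m + n) l"
  note h = head_tail[OF l]
  have m: "m \<le> d ?h" using h fun_le_add by simp
  let ?x = "head m ?h" and ?y = "tail m ?h"
  note xy = head_tail[OF h(1) m]
  have dy: "d ?y = n" using d_tail[OF h(1) m] h by simp
  have yz: "src \<Lambda> ?y = rng \<Lambda> ?z" using src_tail[OF h(1) m] h by simp
  have e: "l = ?x \<cdot> (?y \<cdot> ?z)"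
    using cmp_assoc[OF xy(1,2) h(2) xy(3) yz] xy(4) h(4) by simp
  have a: "head m l = ?x" "tail m l = ?y \<cdot> ?z"
    using head_tail_cmp[of ?x "?y \<cdot> ?z"] xy h yz unfolding e[symmetric] by auto
  show "head m ?h = head m l" using a by simp
  show "tail m ?h = head n (tail m l)" "tail n (tail m l) = ?z"
    using head_tail_cmp[of ?y ?z] xy h yz dy unfolding a by auto
qed

lemma head_head:
  assumes "l \<in> M" "n \<le> d l" "m \<le> n"
  shows "head m (head n l) = head m l"
  using cut_cut(1)[of l m "n - m"] assms fun_le_add_diff by metis

section \<open>Openness and continuity of factorisation\<close>

lemma openin_cmp_image:
  assumes "openin (topo \<Lambda>) U" "openin (topo \<Lambda>) V"
  shows "openin (topo \<Lambda>) {x \<cdot> y | x y. x \<in> U \<and> y \<in> V \<and> src \<Lambda> x = rng \<Lambda> y}"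
proof -
  have "openin (composable_topo \<Lambda>) (composable \<Lambda> \<inter> (U \<times> V))"
    using assms by (auto simp: openin_prod_Times_iff intro: openin_subtopology_Int2)
  then have "openin (topo \<Lambda>) ((\<lambda>(x, y). x \<cdot> y) ` (composable \<Lambda> \<inter> (U \<times> V)))"
    using kgraphD(11) by (auto simp: open_map_def)
  moreover have "(\<lambda>(x, y). x \<cdot> y) ` (composable \<Lambda> \<inter> (U \<times> V)) =
     {x \<cdot> y | x y. x \<in> U \<and> y \<in> V \<and> src \<Lambda> x = rng \<Lambda> y}"
    using openin_subset[OF assms(1)] openin_subset[OF assms(2)]
    by (auto simp: composable_def image_iff)
  ultimately show ?thesis by simp
qed

text \<open>Openness of composition is what makes factorisation continuous: by uniqueness of
  factorisations the set is exactly the composition image of \<open>U \<inter> L m\<close> and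
  \<open>V\<close>.\<close>

lemma openin_head_tail:
  assumes U: "openin (topo \<Lambda>) U" and V: "openin (topo \<Lambda>) V"
  shows "openin (topo \<Lambda>) {l \<in> M. m \<le> d l \<and> head m l \<in> U \<and> tail m l \<in> V}"
proof -
  have "{l \<in> M. m \<le> d l \<and> head m l \<in> U \<and> tail m l \<in> V} =
    {x \<cdot> y | x y. x \<in> U \<inter> L m \<and> y \<in> V \<and> src \<Lambda> x = rng \<Lambda> y}" (is "?A = ?B")
  proof
    show "?A \<subseteq> ?B"
    proof
      fix l assume "l \<in> ?A"
      then have "l \<in> M" "m \<le> d l" "head m l \<in> U" "tail m l \<in> V" by auto
      with head_tail[OF this(1,2)] show "l \<in> ?B"
        unfolding of_degree_def mem_Collect_eq Int_iff by metis
    qed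
    show "?B \<subseteq> ?A"
      using openin_subset[OF U] openin_subset[OF V] head_tail_cmp fun_le_add
      by (auto simp: of_degree_def subset_iff)
  qed
  then show ?thesis using openin_cmp_image[of "U \<inter> L m" V] openin_L[of m] U V by auto
qed

lemma continuous_head: "continuous_map (subtopology (topo \<Lambda>) {l \<in> M. m \<le> d l}) (topo \<Lambda>) (head m)"
  and continuous_tail: "continuous_map (subtopology (topo \<Lambda>) {l \<in> M. m \<le> d l}) (topo \<Lambda>) (tail m)"
proof -
  have o: "openin (topo \<Lambda>) {l \<in> M. m \<le> d l}" by (rule openin_d)
  show "continuous_map (subtopology (topo \<Lambda>) {l \<in> M. m \<le> d l}) (topo \<Lambda>) (head m)"
    unfolding continuous_map_def
  proof (intro conjI allI impI)
    fix U assume U: "openin (topo \<Lambda>) U"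
    have "{x \<in> topspace (subtopology (topo \<Lambda>) {l \<in> M. m \<le> d l}). head m x \<in> U} =
       {l \<in> M. m \<le> d l \<and> head m l \<in> U \<and> tail m l \<in> M}" using head_tail by auto
    then show "openin (subtopology (topo \<Lambda>) {l \<in> M. m \<le> d l})
       {x \<in> topspace (subtopology (topo \<Lambda>) {l \<in> M. m \<le> d l}). head m x \<in> U}"
      using openin_head_tail[OF U openin_topspace, of m] o
      by (simp add: openin_open_subtopology) auto
  qed (use head_tail in auto)
  show "continuous_map (subtopology (topo \<Lambda>) {l \<in> M. m \<le> d l}) (topo \<Lambda>) (tail m)"
    unfolding continuous_map_def
  proof (intro conjI allI impI)
    fix U assume U: "openin (topo \<Lambda>) U"
    have "{x \<in> topspace (subtopology (topo \<Lambda>) {l \<in> M. m \<le> d l}). tail m x \<in> U} =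
       {l \<in> M. m \<le> d l \<and> head m l \<in> M \<and> tail m l \<in> U}" using head_tail by auto
    then show "openin (subtopology (topo \<Lambda>) {l \<in> M. m \<le> d l})
       {x \<in> topspace (subtopology (topo \<Lambda>) {l \<in> M. m \<le> d l}). tail m x \<in> U}"
      using openin_head_tail[OF openin_topspace U, of m] o
      by (simp add: openin_open_subtopology) auto
  qed (use head_tail in auto)
qed

lemma continuous_head':
  assumes "continuous_map Z (topo \<Lambda>) f" "\<And>z. z \<in> topspace Z \<Longrightarrow> m \<le> d (f z)"
  shows "continuous_map Z (topo \<Lambda>) (\<lambda>z. head m (f z))"
    and "continuous_map Z (topo \<Lambda>) (\<lambda>z. tail m (f z))"
proof -
  have f: "continuous_map Z (subtopology (topo \<Lambda>) {l \<in> M. m \<le> d l}) f"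
    using assms continuous_map_funspace[OF assms(1)] by (auto simp: continuous_map_in_subtopology)
  show "continuous_map Z (topo \<Lambda>) (\<lambda>z. head m (f z))"
    using continuous_map_compose[OF f continuous_head] by (simp add: o_def)
  show "continuous_map Z (topo \<Lambda>) (\<lambda>z. tail m (f z))"
    using continuous_map_compose[OF f continuous_tail] by (simp add: o_def)
qed

lemma continuous_cmp:
  assumes "continuous_map Z (topo \<Lambda>) f" "continuous_map Z (topo \<Lambda>) g"
    "\<And>z. z \<in> topspace Z \<Longrightarrow> src \<Lambda> (f z) = rng \<Lambda> (g z)"
  shows "continuous_map Z (topo \<Lambda>) (\<lambda>z. f z \<cdot> g z)"
proof -
  have "continuous_map Z (composable_topo \<Lambda>) (\<lambda>z. (f z, g z))"
    using assms continuous_map_funspace[OF assms(1)] continuous_map_funspace[OF assms(2)]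
    by (auto simp: continuous_map_in_subtopology continuous_map_paired composable_def)
  from continuous_map_compose[OF this kgraphD(10)] show ?thesis by (simp add: o_def)
qed

text \<open>The axiom speaks about the object space. As the degree is continuous into a discrete
  space, the objects \<open>L 0\<close> are open among the morphisms, so images open among the
  objects are open among the morphisms as well.\<close>

lemma src_locally_injective:
  assumes "l \<in> M"
  obtains U where "openin (topo \<Lambda>) U" "l \<in> U" "inj_on (src \<Lambda>) U"
    "openin (topo \<Lambda>) (src \<Lambda> ` U)"
    "homeomorphic_map (subtopology (topo \<Lambda>) U) (subtopology (topo \<Lambda>) (src \<Lambda> ` U)) (src \<Lambda>)"
proof -
  obtain U where U: "openin (topo \<Lambda>) U" "l \<in> U" "openin (obj_topo \<Lambda>) (src \<Lambda> ` U)"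
    "homeomorphic_map (subtopology (topo \<Lambda>) U) (subtopology (obj_topo \<Lambda>) (src \<Lambda> ` U)) (src \<Lambda>)"
    using assms kgraphD(9) unfolding local_homeomorphism_def by blast
  have sub: "U \<subseteq> M" using U openin_subset by blast
  then have "src \<Lambda> ` U \<subseteq> obj \<Lambda>" by auto
  then have e: "subtopology (obj_topo \<Lambda>) (src \<Lambda> ` U) = subtopology (topo \<Lambda>) (src \<Lambda> ` U)"
    by (simp add: subtopology_subtopology inf_absorb2)
  have "inj_on (src \<Lambda>) U"
    using homeomorphic_imp_injective_map[OF U(4)] sub by (simp add: inf_absorb2)
  moreover have "openin (topo \<Lambda>) (src \<Lambda> ` U)"
    using U(3) openin_L[of 0] L_0 by (simp add: openin_open_subtopology)
  ultimately show ?thesis using that U e by metis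
qed

end

section \<open>Paths\<close>

lemma enat_tuple_le [simp]: "enat_tuple p \<le> enat_tuple q \<longleftrightarrow> p \<le> q"
  by (simp add: le_fun_def)

lemma enat_tuple_sup_le [simp]:
  "enat_tuple (sup p q) \<le> m \<longleftrightarrow> enat_tuple p \<le> m \<and> enat_tuple q \<le> m"
proof -
  have "enat_tuple (sup p q) = sup (enat_tuple p) (enat_tuple q)"
    by (auto simp: fun_eq_iff sup_max)
  then show ?thesis by simp
qed

lemma enat_add_le_iff: "enat p \<le> m \<Longrightarrow> enat q \<le> m - enat p \<longleftrightarrow> enat (p + q) \<le> m"
  by (cases m) auto

lemma enat_tuple_add_le:
  assumes "enat_tuple p \<le> m"
  shows "enat_tuple q \<le> m - enat_tuple p \<longleftrightarrow> enat_tuple (p + q) \<le> m"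
  using assms enat_add_le_iff by (simp add: le_fun_def plus_fun_def)

lemma enat_le_add_iff: "enat q \<le> enat p + m \<longleftrightarrow> enat (q - p) \<le> m"
  by (cases m) auto

lemma enat_tuple_le_add: "enat_tuple q \<le> enat_tuple p + m \<longleftrightarrow> enat_tuple (q - p) \<le> m"
  by (simp add: le_fun_def enat_le_add_iff)

lemma enat_tuple_add_diff: "enat_tuple p \<le> m \<Longrightarrow> enat_tuple p + (m - enat_tuple p) = m"
proof
  fix i
  assume "enat_tuple p \<le> m"
  then have "enat (p i) \<le> m i" by (simp add: le_fun_def)
  then show "(enat_tuple p + (m - enat_tuple p)) i = m i" by (cases "m i") auto
qed

lemma enat_tuple_0 [simp]: "enat_tuple 0 \<le> m"
  by (simp add: le_fun_def zero_fun_def zero_enat_def[symmetric])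

lemma mor_Omega: "mor (Omega k m) = {(p, q). p \<in> tuples k \<and> q \<in> tuples k \<and> p \<le> q \<and> enat_tuple q \<le> m}"
  by (simp add: Omega_def)

text \<open>Stands in for a possibly infinite degree \<open>m\<close>. Membership in such a set
  keeps subtraction of extended naturals out of later arguments, and
  \<open>finite_degs_exists\<close> leads back from the set to \<open>m\<close>.\<close>

definition finite_degs :: "nat \<Rightarrow> (nat \<Rightarrow> enat) \<Rightarrow> (nat \<Rightarrow> nat) set" where
  "finite_degs k m = {q \<in> tuples k. enat_tuple q \<le> m}"

lemma finite_degs_0 [simp]: "0 \<in> finite_degs k m"
  unfolding finite_degs_def mem_Collect_eq using tuples_0 enat_tuple_0 by blast

lemma finite_degs_le: "q \<in> finite_degs k m \<Longrightarrow> p \<le> q \<Longrightarrow> p \<in> finite_degs k m"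
  unfolding finite_degs_def mem_Collect_eq using tuples_le enat_tuple_le order_trans by metis

lemma finite_degs_sup: "p \<in> finite_degs k m \<Longrightarrow> q \<in> finite_degs k m \<Longrightarrow> sup p q \<in> finite_degs k m"
  by (auto simp del: sup_apply sup_fun_def simp: finite_degs_def)

lemma finite_degs_tuples: "q \<in> finite_degs k m \<Longrightarrow> q \<in> tuples k"
  by (simp add: finite_degs_def)

lemma mor_Omega_iff: "(p, q) \<in> mor (Omega k m) \<longleftrightarrow> q \<in> finite_degs k m \<and> p \<le> q"
  using tuples_le by (auto simp: mor_Omega finite_degs_def)

lemma finite_degs_diff:
  assumes "p \<in> finite_degs k m"
  shows "q \<in> finite_degs k (m - enat_tuple p) \<longleftrightarrow> p + q \<in> finite_degs k m"
  using assms enat_tuple_add_le[of p m q] tuples_le[of "p + q" k q] fun_le_add[of q p]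
  by (auto simp: finite_degs_def add.commute)

lemma finite_degs_add:
  assumes "p \<in> tuples k"
  shows "q \<in> finite_degs k (enat_tuple p + m) \<longleftrightarrow> q \<in> tuples k \<and> q - p \<in> finite_degs k m"
  using assms by (auto simp: finite_degs_def enat_tuple_le_add)

lemma enat_eqI:
  assumes "\<And>q. enat q \<le> m \<longleftrightarrow> enat q \<le> n" shows "m = n"
proof (cases m)
  case (enat i)
  have "\<not> enat (Suc i) \<le> n" "enat i \<le> n" using assms[of "Suc i"] assms[of i] enat by auto
  then show ?thesis using enat by (cases n) auto
next
  case infinity
  then have "enat q \<le> n" for q using assms[of q] by simp
  from this[of "Suc (the_enat n)"] show ?thesis using infinity by (cases n) auto
qed

text \<open>Each coordinate is probed with the multiples of one generator: \<open>q\<close> times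
  the \<open>i\<close>-th generator lies below \<open>m\<close> exactly when \<open>q\<close> is at
  most \<open>m i\<close>. Coordinates from \<open>k\<close> on vanish on both sides.\<close>

lemma finite_degs_inject:
  assumes "m \<in> tuples k" "n \<in> tuples k" "finite_degs k m = finite_degs k n"
  shows "m = n"
proof
  fix i
  show "m i = n i"
  proof (cases "i < k")
    case True
    have *: "enat_tuple (\<lambda>j. if j = i then q else 0) \<le> l \<longleftrightarrow> enat q \<le> l i" for q and l :: "nat \<Rightarrow> enat"
      by (auto simp: le_fun_def zero_enat_def[symmetric])
    have "(\<lambda>j. if j = i then q else 0) \<in> tuples k" for q :: nat
      using True by (simp add: tuples_def)
    then have "enat q \<le> l i \<longleftrightarrow> (\<lambda>j. if j = i then q else 0) \<in> finite_degs k l" for q and l :: "nat \<Rightarrow> enat"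
      unfolding finite_degs_def mem_Collect_eq * by blast
    from this[of _ m] this[of _ n] have "enat q \<le> m i \<longleftrightarrow> enat q \<le> n i" for q
      unfolding assms(3) by blast
    then show ?thesis by (rule enat_eqI)
  next
    case False
    then show ?thesis using assms(1,2) by (simp add: tuples_def)
  qed
qed

context top_kgraph
begin

abbreviation X :: "'a kpath set" where "X \<equiv> path_space k \<Lambda>"

section \<open>Initial segments of a path\<close>

definition fdeg :: "'a kpath \<Rightarrow> (nat \<Rightarrow> nat) set" where
  "fdeg x = finite_degs k (path_deg x)"

definition ini :: "'a kpath \<Rightarrow> (nat \<Rightarrow> nat) \<Rightarrow> 'a" where
  "ini x q = snd x (0, q)"

lemma fdeg_0 [simp]: "0 \<in> fdeg x"
  and fdeg_le: "q \<in> fdeg x \<Longrightarrow> p \<le> q \<Longrightarrow> p \<in> fdeg x"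
  and fdeg_sup: "p \<in> fdeg x \<Longrightarrow> q \<in> fdeg x \<Longrightarrow> sup p q \<in> fdeg x"
  and fdeg_tuples: "q \<in> fdeg x \<Longrightarrow> q \<in> tuples k"
  using finite_degs_le finite_degs_sup finite_degs_tuples unfolding fdeg_def by auto

lemma path_deg_tuples: "x \<in> X \<Longrightarrow> path_deg x \<in> tuples k"
  by (auto simp: path_space_def path_deg_def)

lemma path_functor:
  assumes "x \<in> X" "r \<in> fdeg x" "p \<le> q" "q \<le> r"
  shows "snd x (p, q) \<in> M" "d (snd x (p, q)) = q - p"
    "rng \<Lambda> (snd x (p, q)) = snd x (p, p)" "src \<Lambda> (snd x (p, q)) = snd x (q, q)"
    "snd x (p, r) = snd x (p, q) \<cdot> snd x (q, r)"
proof -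
  obtain m f where x: "x = (m, f)" by (cases x)
  have f: "is_functor (Omega k m) \<Lambda> f" "\<forall>a\<in>mor (Omega k m). d (f a) = deg (Omega k m) a"
    using assms(1) x by (auto simp: path_space_def)
  have a: "(p, q) \<in> mor (Omega k m)" "(q, r) \<in> mor (Omega k m)"
    using assms finite_degs_le[of r k m q] by (auto simp: mor_Omega_iff fdeg_def path_deg_def x)
  have "f (rng (Omega k m) (p, q)) = rng \<Lambda> (f (p, q))" "f (src (Omega k m) (p, q)) = src \<Lambda> (f (p, q))"
    "f (p, q) \<in> M"
    using f(1) a unfolding is_functor_def by blast+
  then show "snd x (p, q) \<in> M" "d (snd x (p, q)) = q - p"
    "rng \<Lambda> (snd x (p, q)) = snd x (p, p)" "src \<Lambda> (snd x (p, q)) = snd x (q, q)"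
    using f(2) a by (auto simp: Omega_def x)
  have "((p, q), (q, r)) \<in> composable (Omega k m)"
    using a by (auto simp: composable_def) (auto simp: Omega_def)
  then have "f (cmp (Omega k m) (p, q) (q, r)) = f (p, q) \<cdot> f (q, r)"
    using f(1) unfolding is_functor_def by blast
  then show "snd x (p, r) = snd x (p, q) \<cdot> snd x (q, r)"
    by (simp add: Omega_def x)
qed

lemma ini_props:
  assumes "x \<in> X" "q \<in> fdeg x"
  shows "ini x q \<in> M" "d (ini x q) = q" "rng \<Lambda> (ini x q) = ini x 0"
  using path_functor[OF assms, of 0 q] by (auto simp: ini_def)

lemma path_rng_ini: "path_rng x = ini x 0"
  by (simp add: path_rng_def ini_def)

lemma head_ini:
  assumes "x \<in> X" "q \<in> fdeg x" "p \<le> q"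
  shows "head p (ini x q) = ini x p" "tail p (ini x q) = snd x (p, q)"
proof -
  note 1 = path_functor[OF assms(1,2) _ assms(3), of 0, folded ini_def, simplified]
  note 2 = path_functor[OF assms(1,2) assms(3) order_refl]
  show "head p (ini x q) = ini x p" "tail p (ini x q) = snd x (p, q)"
    using head_tail_cmp[of "ini x p" "snd x (p, q)"] 1 2 by (auto simp: ini_def)
qed

lemma ini_split:
  assumes "x \<in> X" "q \<in> fdeg x" "p \<le> q"
  shows "ini x q = ini x p \<cdot> tail p (ini x q)" "src \<Lambda> (ini x p) = rng \<Lambda> (tail p (ini x q))"
    "tail p (ini x q) \<in> M" "d (tail p (ini x q)) = q - p"
  using head_tail[OF ini_props(1)[OF assms(1,2)], of p] d_tail[OF ini_props(1)[OF assms(1,2)], of p]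
    ini_props[OF assms(1,2)] head_ini[OF assms] assms(3) by auto

lemma path_eqI:
  assumes x: "x \<in> X" and y: "y \<in> X" and fd: "fdeg x = fdeg y"
    and e: "\<And>q. q \<in> fdeg x \<Longrightarrow> ini x q = ini y q"
  shows "x = y"
proof (rule prod_eqI)
  have m: "path_deg x = path_deg y"
    using finite_degs_inject[OF path_deg_tuples[OF x] path_deg_tuples[OF y]] fd by (simp add: fdeg_def)
  then show "fst x = fst y" by (simp add: path_deg_def)
  show "snd x = snd y"
  proof (rule extensionalityI[of _ "mor (Omega k (path_deg x))"])
    show "snd x \<in> extensional (mor (Omega k (path_deg x)))" "snd y \<in> extensional (mor (Omega k (path_deg x)))"
      using x y m by (auto simp: path_space_def path_deg_def)
    fix a assume "a \<in> mor (Omega k (path_deg x))"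
    then obtain p q where a: "a = (p, q)" "q \<in> fdeg x" "p \<le> q"
      by (metis fdeg_def mor_Omega_iff surj_pair)
    then show "snd x a = snd y a"
      using head_ini(2)[OF x, of q p] head_ini(2)[OF y, of q p] e[of q] fd by simp
  qed
qed

section \<open>Paths built from coherent families of segments, shifts and prepending\<close>

definition mk_path :: "(nat \<Rightarrow> enat) \<Rightarrow> ((nat \<Rightarrow> nat) \<Rightarrow> 'a) \<Rightarrow> 'a kpath" where
  "mk_path m h = (m, restrict (\<lambda>(p, q). tail p (h q)) (mor (Omega k m)))"

text \<open>The value at \<open>(p, q)\<close> has to complete \<open>h p\<close> to
  \<open>h q\<close>, hence it is \<open>tail p (h q)\<close>. Coherence of the heads then yields
  functoriality: it identifies the source of \<open>h p\<close> with the range of that tail and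
  makes consecutive tails compose.\<close>

lemma mk_path:
  assumes m: "m \<in> tuples k"
    and h: "\<And>q. q \<in> finite_degs k m \<Longrightarrow> h q \<in> M \<and> d (h q) = q"
    and hh: "\<And>p q. q \<in> finite_degs k m \<Longrightarrow> p \<le> q \<Longrightarrow> head p (h q) = h p"
  shows "mk_path m h \<in> X" "path_deg (mk_path m h) = m" "fdeg (mk_path m h) = finite_degs k m"
    "\<And>q. q \<in> finite_degs k m \<Longrightarrow> ini (mk_path m h) q = h q"
proof -
  have t: "tail p (h q) \<in> M" "d (tail p (h q)) = q - p"
    "rng \<Lambda> (tail p (h q)) = src \<Lambda> (h p)" "src \<Lambda> (tail p (h q)) = src \<Lambda> (h q)"
    if "q \<in> finite_degs k m" "p \<le> q" for p q
    using head_tail[of "h q" p] d_tail[of "h q" p] src_tail[of "h q" p] h[OF that(1)] that hh[OF that]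
    by auto
  have s: "tail p (h p) = src \<Lambda> (h p)" if "p \<in> finite_degs k m" for p
    using tail_d[of "h p"] h[OF that] by simp
  have c: "tail p (h r) = tail p (h q) \<cdot> tail q (h r)"
    if "r \<in> finite_degs k m" "p \<le> q" "q \<le> r" for p q r
  proof -
    have q: "q \<in> finite_degs k m" using that finite_degs_le by blast
    let ?l = "tail p (h r)"
    have l: "?l \<in> M" "d ?l = r - p" using t[of r p] that by auto
    have qp: "q - p \<le> d ?l" "p + (q - p) = q"
      using that fun_le_add_diff[of p q] l by (auto simp: le_fun_def diff_le_mono)
    \<comment> \<open>Cutting \<open>tail p (h r)\<close> at the relative degree
      \<open>q - p\<close> yields both factors.\<close>
    have "head (q - p) ?l = tail p (h q)" "tail (q - p) ?l = tail q (h r)"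
      using cut_cut(2,3)[of "h r" p "q - p"] h[OF that(1)] qp hh[of r q] that by auto
    then show ?thesis using head_tail(4)[OF l(1) qp(1)] by simp
  qed
  have "is_functor (Omega k m) \<Lambda> (snd (mk_path m h))"
    unfolding is_functor_def
  proof (intro conjI ballI)
    fix a assume "a \<in> mor (Omega k m)"
    then obtain p q where a: "a = (p, q)" "q \<in> finite_degs k m" "p \<le> q" "p \<in> finite_degs k m"
      using mor_Omega_iff finite_degs_le by (cases a) blast
    then have b: "(p, q) \<in> mor (Omega k m)" "(p, p) \<in> mor (Omega k m)" "(q, q) \<in> mor (Omega k m)"
      by (auto simp: mor_Omega_iff)
    show "snd (mk_path m h) a \<in> M"
      "snd (mk_path m h) (rng (Omega k m) a) = rng \<Lambda> (snd (mk_path m h) a)"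
      "snd (mk_path m h) (src (Omega k m) a) = src \<Lambda> (snd (mk_path m h) a)"
      using a b t[of q p] s[of p] s[of q] by (simp_all add: mk_path_def) (simp_all add: Omega_def)
  next
    fix ab assume ab: "ab \<in> composable (Omega k m)"
    obtain p q p' r where e: "ab = ((p, q), (p', r))" by (metis surj_pair)
    have "q = p'" using ab unfolding e composable_def by (simp add: Omega_def)
    then have b: "(p, q) \<in> mor (Omega k m)" "(q, r) \<in> mor (Omega k m)"
      using ab unfolding e composable_def by auto
    moreover from this have "(p, r) \<in> mor (Omega k m)" using order_trans by (auto simp: mor_Omega_iff)
    moreover have "cmp (Omega k m) (p, q) (q, r) = (p, r)" by (simp add: Omega_def)
    moreover have "tail p (h r) = tail p (h q) \<cdot> tail q (h r)"
      using b c[of r p q] by (auto simp: mor_Omega_iff)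
    ultimately show "case ab of (x, y) \<Rightarrow> snd (mk_path m h) (cmp (Omega k m) x y) =
        snd (mk_path m h) x \<cdot> snd (mk_path m h) y"
      unfolding e \<open>q = p'\<close>[symmetric] by (simp add: mk_path_def)
  qed
  moreover have "d (snd (mk_path m h) a) = deg (Omega k m) a" if a: "a \<in> mor (Omega k m)" for a
  proof -
    obtain p q where e: "a = (p, q)" by (cases a)
    have "deg (Omega k m) a = q - p" by (simp add: Omega_def e)
    then show ?thesis using a t[of q p] by (simp add: mk_path_def e mor_Omega_iff)
  qed
  ultimately show "mk_path m h \<in> X"
    using m by (auto simp: path_space_def mk_path_def)
  show pd: "path_deg (mk_path m h) = m" by (simp add: mk_path_def path_deg_def)
  then show "fdeg (mk_path m h) = finite_degs k m" by (simp add: fdeg_def)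
  show "ini (mk_path m h) q = h q" if "q \<in> finite_degs k m" for q
    using that h[OF that] tail_0[of "h q"] by (simp add: mk_path_def ini_def mor_Omega_iff)
qed

lemma path_shift:
  assumes x: "x \<in> X" and m: "m \<in> fdeg x"
  shows "path_shift k m x \<in> X" "path_deg (path_shift k m x) = path_deg x - enat_tuple m"
    "q \<in> fdeg (path_shift k m x) \<longleftrightarrow> m + q \<in> fdeg x"
    "m + q \<in> fdeg x \<Longrightarrow> ini (path_shift k m x) q = tail m (ini x (m + q))"
proof -
  let ?n = "path_deg x - enat_tuple m"
  define h where "h q = tail m (ini x (m + q))" for q
  have n: "?n \<in> tuples k" using path_deg_tuples[OF x] by (simp add: tuples_def)
  have fd: "q \<in> finite_degs k ?n \<longleftrightarrow> m + q \<in> fdeg x" for q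
    using finite_degs_diff[of m k "path_deg x" q] m by (simp add: fdeg_def)
  have 1: "h q \<in> M \<and> d (h q) = q" if "m + q \<in> fdeg x" for q
    using ini_split[OF x that, of m] fun_le_add[of m q] by (simp add: h_def)
  have 2: "head p (h q) = h p \<and> tail p (h q) = snd x (m + p, m + q)" if "m + q \<in> fdeg x" "p \<le> q" for p q
  proof -
    have le: "m + p \<le> m + q" using that by (simp add: le_fun_def)
    show ?thesis
      using cut_cut(2,3)[of "ini x (m + q)" m p] ini_props[OF x that(1)] le
        head_ini[OF x that(1) le] by (simp add: h_def)
  qed
  \<comment> \<open>Once the shift is recognised as a path assembled from the segments
    \<open>h\<close>, membership in \<open>X\<close>, the degree and the segments all come from
    \<open>mk_path\<close>.\<close>
  have e: "path_shift k m x = mk_path ?n h"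
    unfolding path_shift_def mk_path_def Let_def
    by (rule arg_cong[where f = "Pair _"], rule restrict_ext)
       (use 2 fd in \<open>auto simp: mor_Omega_iff\<close>)
  note mk = mk_path[OF n, of h, unfolded fd, OF 1 conjunct1[OF 2], folded e]
  show "path_shift k m x \<in> X" "path_deg (path_shift k m x) = ?n" using mk by auto
  show "q \<in> fdeg (path_shift k m x) \<longleftrightarrow> m + q \<in> fdeg x" using mk fd by simp
  show "m + q \<in> fdeg x \<Longrightarrow> ini (path_shift k m x) q = tail m (ini x (m + q))"
    using mk(4) by (simp add: h_def)
qed

lemma path_rng_shift:
  assumes x: "x \<in> X" and m: "m \<in> fdeg x"
  shows "path_rng (path_shift k m x) = src \<Lambda> (ini x m)"
  using path_shift(4)[OF assms, of 0] m tail_d[of "ini x m"] ini_props[OF assms]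
  by (simp add: path_rng_ini)

lemma path_shift_0: assumes "x \<in> X" shows "path_shift k 0 x = x"
proof (rule path_eqI)
  note s = path_shift[OF assms fdeg_0]
  show "path_shift k 0 x \<in> X" "x \<in> X" by (rule s, rule assms)
  show "fdeg (path_shift k 0 x) = fdeg x" using s(3) by auto
  fix q assume "q \<in> fdeg (path_shift k 0 x)"
  then have q: "q \<in> fdeg x" using s(3)[of q] by simp
  then show "ini (path_shift k 0 x) q = ini x q"
    using s(4)[of q] tail_0 ini_props(1)[OF assms q] by simp
qed

lemma path_shift_shift:
  assumes x: "x \<in> X" and m: "m + n \<in> fdeg x"
  shows "path_shift k n (path_shift k m x) = path_shift k (m + n) x"
proof -
  have m1: "m \<in> fdeg x" using fdeg_le[OF m fun_le_add] .
  note 1 = path_shift[OF x m1]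
  have n: "n \<in> fdeg (path_shift k m x)" using 1(3) m by simp
  note 2 = path_shift[OF 1(1) n] and 3 = path_shift[OF x m]
  show ?thesis
  proof (rule path_eqI)
    show fd: "fdeg (path_shift k n (path_shift k m x)) = fdeg (path_shift k (m + n) x)"
      using 1(3) 2(3) 3(3) by (auto simp: add.assoc)
    fix q assume "q \<in> fdeg (path_shift k n (path_shift k m x))"
    then have q: "m + (n + q) \<in> fdeg x" "n + q \<in> fdeg (path_shift k m x)" using 1(3) 2(3) by auto
    have "m + n \<le> d (ini x (m + (n + q)))"
      using ini_props(2)[OF x q(1)] by (simp add: le_fun_def)
    then show "ini (path_shift k n (path_shift k m x)) q = ini (path_shift k (m + n) x) q"
      using 1(4)[OF q(1)] 2(4)[OF q(2)] 3(4)[of q] q(1)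
        cut_cut(3)[OF ini_props(1)[OF x q(1)], of m n] by (simp add: add.assoc)
  qed (use 2 3 in auto)
qed

text \<open>\<open>q\<close> need not be comparable with \<open>d l\<close>. At the join
  \<open>d l + (q - d l)\<close> the segment of \<open>y\<close> is \<open>l\<close> followed by a
  segment of the shifted path, and the segment at \<open>q\<close> is a head of that. So
  \<open>l\<close> and the shift determine the values of \<open>y\<close>.\<close>

lemma prepend_unique:
  assumes y: "y \<in> X" and l: "l \<in> M" "d l \<in> fdeg y" "ini y (d l) = l"
    and q: "q \<in> fdeg y"
  shows "ini y q = head q (l \<cdot> ini (path_shift k (d l) y) (q - d l))"
proof -
  have s: "d l + (q - d l) \<in> fdeg y"
    unfolding fun_add_diff_sup using fdeg_sup l(2) q by blast
  have "l \<cdot> ini (path_shift k (d l) y) (q - d l) = ini y (d l + (q - d l))"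
    using path_shift(4)[OF y l(2) s] ini_split(1)[OF y s fun_le_add] l by simp
  moreover have "q \<le> d l + (q - d l)" by (simp add: fun_add_diff_sup)
  ultimately show ?thesis using head_ini(1)[OF y s, of q] by simp
qed

lemma prepend:
  assumes l: "l \<in> M" and x: "x \<in> X" and lx: "path_rng x = src \<Lambda> l"
  shows "path_prepend k \<Lambda> l x = y \<longleftrightarrow>
    y \<in> X \<and> d l \<in> fdeg y \<and> ini y (d l) = l \<and> path_shift k (d l) y = x"
proof -
  define P where "P y \<longleftrightarrow> y \<in> X \<and> path_deg y = enat_tuple (d l) + path_deg x \<and> snd y (0, d l) = l \<and>
    path_shift k (d l) y = x" for y
  \<comment> \<open>The degree equation of the definition can be exchanged for
    \<open>d l \<in> fdeg y\<close>, because the shift already determines the remaining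
    degree.\<close>
  have P_iff: "P y \<longleftrightarrow> y \<in> X \<and> d l \<in> fdeg y \<and> ini y (d l) = l \<and> path_shift k (d l) y = x" for y
  proof -
    have "d l \<in> finite_degs k (enat_tuple (d l) + path_deg x)"
      using finite_degs_add[of "d l" k "d l" "path_deg x"] l by simp
    moreover have "path_deg y = enat_tuple (d l) + path_deg (path_shift k (d l) y)"
      if "y \<in> X" "d l \<in> fdeg y"
      using path_shift(2)[OF that] enat_tuple_add_diff[of "d l" "path_deg y"] that
      by (simp add: fdeg_def finite_degs_def)
    ultimately show ?thesis unfolding P_def ini_def fdeg_def by metis
  qed
  have uniq: "y = z" if "P y" "P z" for y z
  proof (rule path_eqI)
    show e: "fdeg y = fdeg z" using that by (simp add: P_def fdeg_def)
    show "ini y q = ini z q" if q: "q \<in> fdeg y" for q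
      using prepend_unique[of y l q] prepend_unique[of z l q] q \<open>P y\<close> \<open>P z\<close> l e
      unfolding P_iff by auto
    show "y \<in> X" "z \<in> X" using that unfolding P_def by blast+
  qed
  define m where "m = enat_tuple (d l) + path_deg x"
  \<comment> \<open>The formula that \<open>prepend_unique\<close> forces on any solution is now
    used to construct one.\<close>
  define h where "h q = head q (l \<cdot> ini x (q - d l))" for q
  have m: "m \<in> tuples k"
    using path_deg_tuples[OF x] d_tuples[OF l] by (simp add: m_def tuples_def zero_enat_def[symmetric])
  have fd: "q \<in> finite_degs k m \<longleftrightarrow> q \<in> tuples k \<and> q - d l \<in> fdeg x" for q
    unfolding m_def fdeg_def by (rule finite_degs_add) (use l in auto)
  have c: "src \<Lambda> l = rng \<Lambda> (ini x q)" "l \<cdot> ini x q \<in> M" "d (l \<cdot> ini x q) = d l + q" if "q \<in> fdeg x" for q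
    using ini_props[OF x that] lx l by (auto simp: path_rng_ini)
  have hd: "head (d l + p) (l \<cdot> ini x q) = l \<cdot> ini x p" if "q \<in> fdeg x" "p \<le> q" for p q
  proof -
    have p: "p \<in> fdeg x" using fdeg_le that by blast
    note s = ini_split[OF x that]
    have "l \<cdot> ini x q = (l \<cdot> ini x p) \<cdot> tail p (ini x q)"
      using s c[OF p] ini_props[OF x p] by (simp add: cmp_assoc[OF l ini_props(1)[OF x p] s(3) c(1)[OF p] s(2)])
    then show ?thesis
      using head_tail_cmp(1)[OF c(2)[OF p] s(3)] s(2) c[OF p] ini_props[OF x p] l by simp
  qed
  have le: "q \<le> d l + (q - d l)" for q by (simp add: fun_add_diff_sup)
  have h1: "h q \<in> M \<and> d (h q) = q" if "q \<in> finite_degs k m" for q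
    using that head_tail[OF c(2)[of "q - d l"], of q] c(3)[of "q - d l"] le
    unfolding h_def fd by simp
  have h2: "head p (h q) = h p" if "q \<in> finite_degs k m" "p \<le> q" for p q
  proof -
    have q: "q - d l \<in> fdeg x" and pq: "p - d l \<le> q - d l"
      using that fd by (auto simp: le_fun_def diff_le_mono)
    have "head p (h q) = head p (l \<cdot> ini x (q - d l))"
      unfolding h_def by (rule head_head) (use c[OF q] le that in auto)
    moreover have "h p = head p (l \<cdot> ini x (q - d l))"
      unfolding h_def hd[OF q pq, symmetric]
      by (rule head_head) (use c[OF q] le pq in \<open>auto simp: le_fun_def\<close>)
    ultimately show ?thesis by simp
  qed
  let ?y = "mk_path m h"
  note mk = mk_path[of m h, OF m h1 h2]
  have "P ?y"
    unfolding P_iff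
  proof (intro conjI)
    show y: "?y \<in> X" by (rule mk)
    show dl: "d l \<in> fdeg ?y" using mk(3) fd l by simp
    have x0: "l \<cdot> ini x 0 = l" using cmp_id[OF l] lx by (simp add: path_rng_ini)
    show "ini ?y (d l) = l"
      using mk(4)[of "d l"] x0 l head_d[OF l] fd[of "d l"] by (simp add: h_def[of "d l"])
    note s = path_shift[OF y dl]
    show "path_shift k (d l) ?y = x"
    proof (rule path_eqI)
      show fde: "fdeg (path_shift k (d l) ?y) = fdeg x"
      proof (rule set_eqI)
        fix q
        show "q \<in> fdeg (path_shift k (d l) ?y) \<longleftrightarrow> q \<in> fdeg x"
          using s(3)[of q] mk(3) fd[of "d l + q"] fdeg_tuples[of q x] l tuples_add[of "d l" k q] by auto
      qed
      fix q assume q: "q \<in> fdeg (path_shift k (d l) ?y)"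
      then have q': "q \<in> fdeg x" "d l + q \<in> fdeg ?y" using fde s(3) by auto
      have "ini ?y (d l + q) = l \<cdot> ini x q"
        using mk(4)[of "d l + q"] q' head_d[OF c(2)[of q]] c(3)[of q] fd[of "d l + q"] fdeg_tuples[OF q'(2)]
        by (simp add: h_def[of "d l + q"])
      then show "ini (path_shift k (d l) ?y) q = ini x q"
        using s(4) q' head_tail_cmp(2)[OF l ini_props(1)[OF x] c(1)] by simp
    qed (use s x in auto)
  qed
  then have "path_prepend k \<Lambda> l x = y \<longleftrightarrow> P y"
    unfolding path_prepend_def P_def[symmetric] using uniq by (metis the_equality)
  then show ?thesis by (simp add: P_iff)
qed

end

section \<open>The algebra of the path groupoid\<close>

definition int_diff :: "(nat \<Rightarrow> nat) \<Rightarrow> (nat \<Rightarrow> nat) \<Rightarrow> nat \<Rightarrow> int" where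
  "int_diff p q = (\<lambda>i. int (p i) - int (q i))"

lemma int_diff_add [simp]: "int_diff (p + r) (q + r) = int_diff p q"
  by (simp add: int_diff_def)

lemma int_diff_self [simp]: "int_diff p p = 0"
  by (simp add: int_diff_def zero_fun_def)

lemma int_diff_plus: "int_diff p q + int_diff q r = int_diff p r"
  by (simp add: int_diff_def plus_fun_def)

lemma int_diff_minus: "- int_diff p q = int_diff q p"
  by (simp add: int_diff_def fun_eq_iff)

lemma int_diff_tuples: "p \<in> tuples k \<Longrightarrow> q \<in> tuples k \<Longrightarrow> int_diff p q \<in> tuples k"
  by (simp add: int_diff_def tuples_def)

text \<open>Two pairs of degrees with one difference have a common refinement: raising
  \<open>p\<close> and \<open>s\<close> to their join raises \<open>q\<close> and \<open>t\<close>
  to the same degree. This is what allows two representations of a groupoid element to be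
  compared.\<close>

lemma int_diff_eq_common:
  assumes "int_diff p q = int_diff s t"
  shows "q + (s - p) = t + (p - s)"
proof
  fix i
  have "int (p i) - int (q i) = int (s i) - int (t i)"
    using fun_cong[OF assms, of i] by (simp add: int_diff_def)
  then show "(q + (s - p)) i = (t + (p - s)) i" by auto
qed

context top_kgraph
begin

section \<open>Pairs of paths with a common tail\<close>

definition same_tail :: "'a kpath \<Rightarrow> (nat \<Rightarrow> nat) \<Rightarrow> 'a kpath \<Rightarrow> (nat \<Rightarrow> nat) \<Rightarrow> bool" where
  "same_tail x p y q \<longleftrightarrow> x \<in> X \<and> y \<in> X \<and> p \<in> fdeg x \<and> q \<in> fdeg y \<and>
     path_shift k p x = path_shift k q y"

lemma same_tail_sym: "same_tail x p y q \<longleftrightarrow> same_tail y q x p"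
  by (auto simp: same_tail_def)

lemma same_tail_refl: "x \<in> X \<Longrightarrow> p \<in> fdeg x \<Longrightarrow> same_tail x p x p"
  by (simp add: same_tail_def)

lemma same_tail_fdeg:
  assumes "same_tail x p y q" shows "p + r \<in> fdeg x \<longleftrightarrow> q + r \<in> fdeg y"
  using assms path_shift(3) unfolding same_tail_def by metis

lemma same_tail_add:
  assumes "same_tail x p y q" "p + r \<in> fdeg x" shows "same_tail x (p + r) y (q + r)"
proof -
  have "q + r \<in> fdeg y" using same_tail_fdeg assms by blast
  then show ?thesis
    using assms path_shift_shift[of x p r] path_shift_shift[of y q r] unfolding same_tail_def by metis
qed

lemma same_tail_tail:
  assumes "same_tail x p y q" "p + r \<in> fdeg x"
  shows "tail p (ini x (p + r)) = tail q (ini y (q + r))"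
proof -
  have "q + r \<in> fdeg y" using same_tail_fdeg assms by blast
  then show ?thesis
    using assms path_shift(4)[of x p r] path_shift(4)[of y q r] unfolding same_tail_def by metis
qed

lemma same_tail_src:
  assumes "same_tail x p y q" shows "src \<Lambda> (ini x p) = src \<Lambda> (ini y q)"
  using assms path_rng_shift unfolding same_tail_def by metis

lemma same_tail_trans:
  assumes "same_tail x p y q" "same_tail y q z r" shows "same_tail x p z r"
  using assms by (auto simp: same_tail_def)

text \<open>Converse of refining a representation: both shifted paths arise by prepending the same
  segment of degree \<open>r\<close> to the same tail, and a prepended path is unique.\<close>

lemma same_tail_cancel:
  assumes s: "same_tail x (p + r) y (q + r)"
    and t: "tail p (ini x (p + r)) = tail q (ini y (q + r))"
  shows "same_tail x p y q"
proof -
  have x: "x \<in> X" "p + r \<in> fdeg x" and y: "y \<in> X" "q + r \<in> fdeg y"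
    using s by (auto simp: same_tail_def)
  have p: "p \<in> fdeg x" "q \<in> fdeg y" using x y fdeg_le fun_le_add by blast+
  let ?a = "path_shift k p x" and ?b = "path_shift k q y"
  note a = path_shift[OF x(1) p(1)] and b = path_shift[OF y(1) p(2)]
  have r: "r \<in> fdeg ?a" "r \<in> fdeg ?b" using a(3) b(3) x y by auto
  have ini: "ini ?a r = ini ?b r" using a(4) b(4) x y t by simp
  have sh: "path_shift k r ?a = path_shift k r ?b"
    using path_shift_shift[OF x] path_shift_shift[OF y] s by (simp add: same_tail_def)
  note l = ini_props[OF a(1) r(1)]
  note pr = prepend[OF l(1) path_shift(1)[OF a(1) r(1)] path_rng_shift[OF a(1) r(1)]]
  have "path_prepend k \<Lambda> (ini ?a r) (path_shift k r ?a) = ?a"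
    unfolding pr using l a(1) r(1) by simp
  moreover have "path_prepend k \<Lambda> (ini ?a r) (path_shift k r ?a) = ?b"
    unfolding pr using l b(1) r(2) ini sh by simp
  ultimately have "?a = ?b" by simp
  then show ?thesis using x y p by (simp add: same_tail_def)
qed

text \<open>Translates between prefixes attached to a common path and cut degrees of two given
  paths: the prefixes are \<open>ini x p\<close> and \<open>ini y q\<close>, the common path is the
  shift of either. The set is written out so that the result applies to the groupoid and to every
  cylinder alike.\<close>

lemma prepend_eqs:
  assumes F: "F \<subseteq> src_pairs \<Lambda> M M"
  shows "(x, n, y) \<in> {(path_prepend k \<Lambda> l z, deg_diff \<Lambda> l m, path_prepend k \<Lambda> m z) | l m z.
        (l, m) \<in> F \<and> z \<in> X \<and> path_rng z = src \<Lambda> l} \<longleftrightarrow>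
    (\<exists>p q. same_tail x p y q \<and> n = int_diff p q \<and> (ini x p, ini y q) \<in> F)" (is "?L \<longleftrightarrow> ?R")
proof
  assume ?L
  then obtain l m z where e: "x = path_prepend k \<Lambda> l z" "n = deg_diff \<Lambda> l m" "y = path_prepend k \<Lambda> m z"
    and z: "(l, m) \<in> F" "z \<in> X" "path_rng z = src \<Lambda> l" by blast
  have lm: "l \<in> M" "m \<in> M" "path_rng z = src \<Lambda> m"
    using F z by (auto simp: src_pairs_def)
  note 1 = prepend[OF lm(1) z(2,3), of x] and 2 = prepend[OF lm(2) z(2) lm(3), of y]
  have "same_tail x (d l) y (d m)" "n = int_diff (d l) (d m)" "(ini x (d l), ini y (d m)) \<in> F"
    using 1 2 e z(1) by (simp_all add: same_tail_def deg_diff_def int_diff_def)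
  then show ?R by blast
next
  assume ?R
  then obtain p q where pq: "same_tail x p y q" "n = int_diff p q" "(ini x p, ini y q) \<in> F" by blast
  then have x: "x \<in> X" "p \<in> fdeg x" and y: "y \<in> X" "q \<in> fdeg y"
    and s: "path_shift k p x = path_shift k q y"
    by (auto simp: same_tail_def)
  note ix = ini_props[OF x] and iy = ini_props[OF y]
  have "x = path_prepend k \<Lambda> (ini x p) (path_shift k p x)"
    using prepend[OF ix(1) path_shift(1)[OF x] path_rng_shift[OF x], of x] x ix by simp
  moreover have "y = path_prepend k \<Lambda> (ini y q) (path_shift k p x)"
    unfolding s using prepend[OF iy(1) path_shift(1)[OF y] path_rng_shift[OF y], of y] y iy by simp
  moreover have "n = deg_diff \<Lambda> (ini x p) (ini y q)"
    using ix iy pq by (simp add: deg_diff_def int_diff_def)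
  ultimately show ?L
    using pq(3) path_shift(1)[OF x] path_rng_shift[OF x] by blast
qed

lemma path_gpd_mor_iff:
  "(x, n, y) \<in> path_gpd_mor k \<Lambda> \<longleftrightarrow> (\<exists>p q. same_tail x p y q \<and> n = int_diff p q)"
proof -
  have "(ini x p, ini y q) \<in> src_pairs \<Lambda> M M" if "same_tail x p y q" for p q
    using that ini_props(1) same_tail_src[OF that] by (auto simp: src_pairs_def same_tail_def)
  then show ?thesis
    unfolding path_gpd_mor_def prepend_eqs[OF order_refl] by blast
qed

lemma cylinder_iff:
  assumes F: "F \<subseteq> src_pairs \<Lambda> M M"
  shows "(x, n', y) \<in> cylinder k \<Lambda> F n \<longleftrightarrow>
    n' = n \<and> (\<exists>p q. same_tail x p y q \<and> n = int_diff p q \<and> (ini x p, ini y q) \<in> F)"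
proof -
  have "(x, n', y) \<in> cylinder k \<Lambda> F n \<longleftrightarrow> n' = n \<and>
    (x, n', y) \<in> {(path_prepend k \<Lambda> l z, deg_diff \<Lambda> l m, path_prepend k \<Lambda> m z) | l m z.
        (l, m) \<in> F \<and> z \<in> X \<and> path_rng z = src \<Lambda> l}"
    unfolding cylinder_def by blast
  also have "\<dots> \<longleftrightarrow> n' = n \<and> (\<exists>p q. same_tail x p y q \<and> n = int_diff p q \<and> (ini x p, ini y q) \<in> F)"
    unfolding prepend_eqs[OF F] by blast
  finally show ?thesis .
qed

lemma src_pairs_sub: "U \<subseteq> M \<Longrightarrow> V \<subseteq> M \<Longrightarrow> src_pairs \<Lambda> U V \<subseteq> src_pairs \<Lambda> M M"
  by (auto simp: src_pairs_def)

text \<open>The source condition inside \<open>src_pairs\<close> comes for free, since both prefixes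
  end where the common tail begins.\<close>

lemma cylinder_src_pairs_iff:
  assumes "U \<subseteq> M" "V \<subseteq> M"
  shows "(x, n', y) \<in> cylinder k \<Lambda> (src_pairs \<Lambda> U V) n \<longleftrightarrow>
    n' = n \<and> (\<exists>p q. same_tail x p y q \<and> n = int_diff p q \<and> ini x p \<in> U \<and> ini y q \<in> V)"
  unfolding cylinder_iff[OF src_pairs_sub[OF assms]] using same_tail_src by (fastforce simp: src_pairs_def)

section \<open>Groupoid laws and the generating open sets\<close>

abbreviation G :: "'a gpd_elem groupoid" where "G \<equiv> path_groupoid k \<Lambda>"

lemma mor_G: "mor G = path_gpd_mor k \<Lambda>"
  using mor_path_groupoid[OF kgraph] .

lemma G_iff: "(x, n, y) \<in> mor G \<longleftrightarrow> (\<exists>p q. same_tail x p y q \<and> n = int_diff p q)"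
  unfolding mor_G path_gpd_mor_iff ..

lemma G_simps [simp]:
  "rng G (x, n, y) = (x, 0, x)" "src G (x, n, y) = (y, 0, y)"
  "cmp G (x, n, y) (y', m, z) = (x, n + m, z)" "inverse_mor G (x, n, y) = (y, - n, x)"
  by (simp_all add: path_groupoid_def)

lemma G_X: "(x, n, y) \<in> mor G \<Longrightarrow> x \<in> X \<and> y \<in> X"
  by (auto simp: G_iff same_tail_def)

lemma unit_G: "x \<in> X \<Longrightarrow> (x, 0, x) \<in> mor G"
  unfolding G_iff using same_tail_refl[of x 0] by force

lemma obj_G: "obj G = (\<lambda>x. (x, 0, x)) ` X"
  unfolding obj_def using unit_G G_X by (auto simp: image_iff)

lemma composable_G:
  "(g, h) \<in> composable G \<longleftrightarrow> (\<exists>x n y m z. g = (x, n, y) \<and> h = (y, m, z) \<and> g \<in> mor G \<and> h \<in> mor G)"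
  by (cases g; cases h) (auto simp: composable_def)

text \<open>The middle path \<open>y\<close> is cut at \<open>q\<close> in one factor and at
  \<open>s\<close> in the other. Refining both representations to the join of \<open>q\<close> and
  \<open>s\<close> makes the cuts meet, and then equality of tails is transitive.\<close>

lemma same_tail_compose:
  assumes "same_tail x p y q" "same_tail y s z t"
  shows "same_tail x (p + (s - q)) z (t + (q - s))" "same_tail x (p + (s - q)) y (q + (s - q))"
    "same_tail y (q + (s - q)) z (t + (q - s))"
proof -
  have e: "q + (s - q) = s + (q - s)" unfolding fun_add_diff_sup by (rule sup_commute)
  have "q + (s - q) \<in> fdeg y"
    using assms fdeg_sup unfolding fun_add_diff_sup same_tail_def by blast
  then show 1: "same_tail x (p + (s - q)) y (q + (s - q))"
    and 2: "same_tail y (q + (s - q)) z (t + (q - s))"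
    using same_tail_add[OF assms(1)] same_tail_add[OF assms(2)] same_tail_fdeg[OF assms(1)] e by metis+
  show "same_tail x (p + (s - q)) z (t + (q - s))" using same_tail_trans[OF 1 2] .
qed

lemma G_cmp: assumes "(x, n, y) \<in> mor G" "(y, m, z) \<in> mor G" shows "(x, n + m, z) \<in> mor G"
proof -
  obtain p q s t where 1: "same_tail x p y q" "n = int_diff p q" "same_tail y s z t" "m = int_diff s t"
    using assms unfolding G_iff by blast
  have "n + m = int_diff (p + (s - q)) (t + (q - s))"
    unfolding 1 int_diff_def by (auto simp: fun_eq_iff)
  then show ?thesis using same_tail_compose(1)[OF 1(1,3)] unfolding G_iff by blast
qed

lemma G_inverse: assumes "(x, n, y) \<in> mor G" shows "(y, - n, x) \<in> mor G"
  using assms same_tail_sym int_diff_minus unfolding G_iff by metis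

lemma category_G: "is_category G"
  unfolding is_category_def
proof (intro conjI ballI allI impI)
  fix g assume g: "g \<in> mor G"
  obtain x n y where e: "g = (x, n, y)" by (cases g)
  show "rng G g \<in> obj G" "src G g \<in> obj G" "cmp G (rng G g) g = g" "cmp G g (src G g) = g"
    using g G_X by (auto simp: e obj_G)
next
  fix a assume "a \<in> composable G"
  then show "case a of (g, h) \<Rightarrow>
      cmp G g h \<in> mor G \<and> rng G (cmp G g h) = rng G g \<and> src G (cmp G g h) = src G h"
    using G_cmp by (cases a) (auto simp: composable_G)
next
  fix a b c assume "(a, b) \<in> composable G \<and> (b, c) \<in> composable G"
  then show "cmp G (cmp G a b) c = cmp G a (cmp G b c)"
    by (auto simp: composable_G add.assoc)
qed

lemma inverse_G:
  assumes "g \<in> mor G"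
  shows "inverse_mor G g \<in> mor G" "rng G (inverse_mor G g) = src G g"
    "src G (inverse_mor G g) = rng G g" "cmp G g (inverse_mor G g) = rng G g"
    "cmp G (inverse_mor G g) g = src G g"
  using assms G_inverse by (cases g, auto)+

lemma topo_G: "topo G = topology_generated_by (path_gpd_basis k \<Lambda>)"
  by (simp add: path_groupoid_def)

lemma openin_cylinder:
  assumes "openin (topo \<Lambda>) U" "openin (topo \<Lambda>) V"
    and "F \<subseteq> src_pairs \<Lambda> M M" "compactin (prod_topology (topo \<Lambda>) (topo \<Lambda>)) F"
  shows "openin (topo G) (cylinder k \<Lambda> (src_pairs \<Lambda> U V) n - cylinder k \<Lambda> F n)"
proof (cases "n \<in> tuples k")
  case True
  have "cylinder k \<Lambda> (src_pairs \<Lambda> U V) n \<subseteq> path_gpd_mor k \<Lambda>"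
  proof
    fix g assume "g \<in> cylinder k \<Lambda> (src_pairs \<Lambda> U V) n"
    then show "g \<in> path_gpd_mor k \<Lambda>"
      using cylinder_src_pairs_iff[OF openin_subset[OF assms(1)] openin_subset[OF assms(2)]] path_gpd_mor_iff
      by (cases g) metis
  qed
  then have "cylinder k \<Lambda> (src_pairs \<Lambda> U V) n - cylinder k \<Lambda> F n =
    cylinder k \<Lambda> (src_pairs \<Lambda> U V) n \<inter> (path_gpd_mor k \<Lambda> - cylinder k \<Lambda> F n)" by blast
  also have "\<dots> \<in> path_gpd_basis k \<Lambda>"
    unfolding path_gpd_basis_def using assms True by blast
  finally show ?thesis unfolding topo_G by (rule topology_generated_by_Basis)
next
  case False
  \<comment> \<open>For such \<open>n\<close> the set is not among the generators, but no element of
    the groupoid has this degree, so the cylinder is empty.\<close>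
  have "int_diff p q \<in> tuples k" if "same_tail x p y q" for x p y q
    using that fdeg_tuples int_diff_tuples unfolding same_tail_def by blast
  then have "cylinder k \<Lambda> (src_pairs \<Lambda> U V) n = {}"
    using cylinder_src_pairs_iff[OF openin_subset[OF assms(1)] openin_subset[OF assms(2)]] False by fastforce
  then show ?thesis by simp
qed

lemma openin_cylinder':
  assumes "openin (topo \<Lambda>) U" "openin (topo \<Lambda>) V"
  shows "openin (topo G) (cylinder k \<Lambda> (src_pairs \<Lambda> U V) n)"
  using openin_cylinder[OF assms, of "{}" n] by (simp add: cylinder_def)

lemma cylinder_full: "cylinder k \<Lambda> (src_pairs \<Lambda> M M) n = {g \<in> mor G. fst (snd g) = n}"
proof (rule set_eqI)
  fix g :: "'a gpd_elem"
  obtain x m y where g: "g = (x, m, y)" by (cases g)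
  have "ini x p \<in> M \<and> ini y q \<in> M" if "same_tail x p y q" for p q
    using that ini_props(1) by (auto simp: same_tail_def)
  then show "g \<in> cylinder k \<Lambda> (src_pairs \<Lambda> M M) n \<longleftrightarrow> g \<in> {g \<in> mor G. fst (snd g) = n}"
    unfolding g cylinder_src_pairs_iff[OF order_refl order_refl] mem_Collect_eq G_iff fst_conv snd_conv
    by blast
qed

lemma openin_G_part: "openin (topo G) {g \<in> mor G. fst (snd g) = n}"
  using openin_cylinder'[OF openin_topspace openin_topspace] unfolding cylinder_full .

text \<open>The two constituents of a generating set call for opposite arguments, so they are tested
  separately: membership in an open cylinder may use a different representation at every point,
  while avoiding a compact one constrains all representations at once.\<close>

lemma continuous_into_G:
  assumes f: "f \<in> topspace Z \<rightarrow> mor G"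
    and cyl: "\<And>U V n. openin (topo \<Lambda>) U \<Longrightarrow> openin (topo \<Lambda>) V \<Longrightarrow>
      openin Z {z \<in> topspace Z. f z \<in> cylinder k \<Lambda> (src_pairs \<Lambda> U V) n}"
    and compl: "\<And>F n. F \<subseteq> src_pairs \<Lambda> M M \<Longrightarrow> compactin (prod_topology (topo \<Lambda>) (topo \<Lambda>)) F \<Longrightarrow>
      openin Z {z \<in> topspace Z. f z \<notin> cylinder k \<Lambda> F n}"
  shows "continuous_map Z (topo G) f"
  unfolding topo_G
proof (rule continuous_on_generated_topo)
  show "f ` topspace Z \<subseteq> \<Union> (path_gpd_basis k \<Lambda>)"
    using f mor_path_groupoid[OF kgraph] by (auto simp: path_groupoid_def)
  fix B assume "B \<in> path_gpd_basis k \<Lambda>"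
  then obtain U V F n where B: "B = cylinder k \<Lambda> (src_pairs \<Lambda> U V) n \<inter> (path_gpd_mor k \<Lambda> - cylinder k \<Lambda> F n)"
    "openin (topo \<Lambda>) U" "openin (topo \<Lambda>) V" "F \<subseteq> src_pairs \<Lambda> M M"
    "compactin (prod_topology (topo \<Lambda>) (topo \<Lambda>)) F"
    unfolding path_gpd_basis_def by blast
  have "f -` B \<inter> topspace Z = {z \<in> topspace Z. f z \<in> cylinder k \<Lambda> (src_pairs \<Lambda> U V) n} \<inter>
    {z \<in> topspace Z. f z \<notin> cylinder k \<Lambda> F n}"
    using f unfolding B mor_G by auto
  then show "openin Z (f -` B \<inter> topspace Z)" using cyl compl B by auto
qed

end

section \<open>The topology of the path space\<close>

text \<open>Cutting down to a clopen \<open>W\<close> keeps compactness. The use is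
  \<open>W = L n\<close>: compact alignment speaks of sets inside one degree, and a neighbourhood
  inside one degree fixes where a path is cut.\<close>

lemma locally_compact_open_nbhd:
  assumes "locally_compact_space T" "openin T W" "closedin T W" "x \<in> W"
  obtains V K where "openin T V" "compactin T K" "x \<in> V" "V \<subseteq> K" "K \<subseteq> W"
proof -
  obtain U K where UK: "openin T U" "compactin T K" "x \<in> U" "U \<subseteq> K"
    using assms(1)[unfolded locally_compact_space_def, rule_format, of x] assms(4) openin_subset[OF assms(2)]
    by fast
  have "openin T (U \<inter> W)" "x \<in> U \<inter> W" "U \<inter> W \<subseteq> K \<inter> W" "K \<inter> W \<subseteq> W"
    using UK assms(2,4) by blast+
  moreover have "compactin T (K \<inter> W)" by (rule compact_Int_closedin[OF UK(2) assms(3)])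
  ultimately show ?thesis using that by metis
qed

text \<open>Recovers the degree of a limit path from the set of degrees of its initial segments.\<close>

lemma finite_degs_exists:
  assumes D: "D \<subseteq> tuples k" "0 \<in> D"
    and down: "\<And>p q. q \<in> D \<Longrightarrow> p \<le> q \<Longrightarrow> p \<in> D"
    and dir: "\<And>p q. p \<in> D \<Longrightarrow> q \<in> D \<Longrightarrow> sup p q \<in> D"
  obtains m where "m \<in> tuples k" "finite_degs k m = D"
proof -
  define m where "m i = (SUP q\<in>D. enat (q i))" for i
  have "m i = 0" if "k \<le> i" for i
  proof -
    have "q i = 0" if "q \<in> D" for q using D(1) that \<open>k \<le> i\<close> by (auto simp: tuples_def)
    then have "m i \<le> 0" unfolding m_def by (intro SUP_least) (simp add: zero_enat_def)
    then show ?thesis by simp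
  qed
  then have 1: "m \<in> tuples k" by (simp add: tuples_def)
  have 2: "finite_degs k m = D"
  proof
    show "D \<subseteq> finite_degs k m"
    proof
      fix q assume q: "q \<in> D"
      then have "enat_tuple q \<le> m" unfolding m_def le_fun_def by (auto intro: SUP_upper)
      then show "q \<in> finite_degs k m" using q D unfolding finite_degs_def by blast
    qed
    show "finite_degs k m \<subseteq> D"
    proof
      fix q assume "q \<in> finite_degs k m"
      then have q: "q \<in> tuples k" "\<And>i. enat (q i) \<le> m i" by (auto simp: finite_degs_def le_fun_def)
      have ex: "\<exists>p\<in>D. q i \<le> p i" for i
      proof (cases "q i")
        case 0
        then show ?thesis using D by auto
      next
        case (Suc j)
        then have "enat j < m i" using q(2)[of i] Suc_ile_eq by auto
        then show ?thesis unfolding m_def less_SUP_iff using Suc by (auto simp: Suc_le_eq)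
      qed
      have "\<exists>p\<in>D. \<forall>i<j. q i \<le> p i" for j
      proof (induction j)
        case 0
        then show ?case using D by auto
      next
        case (Suc j)
        obtain p p' where p: "p \<in> D" "\<forall>i<j. q i \<le> p i" "p' \<in> D" "q j \<le> p' j" using Suc ex by blast
        have "q i \<le> sup p p' i" if "i < Suc j" for i
          using p that by (cases "i = j") (auto simp: sup_fun_def le_supI1 le_supI2)
        then show ?case using dir p by blast
      qed
      then obtain p where p: "p \<in> D" "\<forall>i<k. q i \<le> p i" by blast
      have "q \<le> p"
      proof (rule le_funI)
        fix i show "q i \<le> p i" using p q by (cases "i < k") (auto simp: tuples_def)
      qed
      then show "q \<in> D" using down p by blast
    qed
  qed
  show ?thesis using that 1 2 .
qed

context top_kgraph
begin

section \<open>The embedding into a product of compactifications\<close>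

abbreviation A :: "'a option topology" where "A \<equiv> Alexandroff_compactification (topo \<Lambda>)"

definition segments :: "'a kpath \<Rightarrow> (nat \<Rightarrow> nat) \<Rightarrow> 'a option" where
  "segments x = (\<lambda>q\<in>tuples k. if q \<in> fdeg x then Some (ini x q) else None)"

abbreviation PA :: "((nat \<Rightarrow> nat) \<Rightarrow> 'a option) topology" where
  "PA \<equiv> product_topology (\<lambda>_. A) (tuples k)"

text \<open>Defined without the groupoid. That it matches the relative topology of the units comes
  out of \<open>continuous_unit\<close> and \<open>continuous_fst\<close>, which give continuity in
  the two directions.\<close>

definition TX :: "'a kpath topology" where
  "TX = pullback_topology X segments PA"

definition ZX :: "(nat \<Rightarrow> nat) \<Rightarrow> 'a set \<Rightarrow> 'a kpath set" where
  "ZX q U = {x \<in> X. q \<in> fdeg x \<and> ini x q \<in> U}"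

lemma segments_in: "x \<in> X \<Longrightarrow> segments x \<in> topspace PA"
  using ini_props(1) by (auto simp: segments_def)

lemma segments_Some: "q \<in> tuples k \<Longrightarrow> segments x q = Some l \<longleftrightarrow> q \<in> fdeg x \<and> ini x q = l"
  and segments_None: "q \<in> tuples k \<Longrightarrow> segments x q = None \<longleftrightarrow> q \<notin> fdeg x"
  by (auto simp: segments_def)

lemma topspace_TX [simp]: "topspace TX = X"
  using segments_in unfolding TX_def topspace_pullback_topology by blast

lemma continuous_segments: "continuous_map TX PA segments"
  unfolding TX_def using continuous_map_pullback[OF continuous_map_id] by simp

lemma continuous_segment: "q \<in> tuples k \<Longrightarrow> continuous_map TX A (\<lambda>x. segments x q)"
  using continuous_map_compose[OF continuous_segments continuous_map_product_projection[of q "tuples k" "\<lambda>_. A"]]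
  by (simp add: o_def)

lemma inj_segments: "inj_on segments X"
proof (rule inj_onI)
  fix x y assume xy: "x \<in> X" "y \<in> X" "segments x = segments y"
  show "x = y"
  proof (rule path_eqI)
    show fd: "fdeg x = fdeg y"
      using segments_None[of _ x] segments_None[of _ y] fdeg_tuples xy by (metis subsetI subset_antisym)
    show "ini x q = ini y q" if "q \<in> fdeg x" for q
      using that segments_Some[of q x "ini x q"] segments_Some[of q y "ini x q"] xy fdeg_tuples by auto
  qed (use xy in auto)
qed

lemma ZX_eq: "q \<in> tuples k \<Longrightarrow> ZX q U = {x \<in> X. segments x q \<in> Some ` U}"
  by (auto simp: ZX_def segments_def)

lemma ZX_empty: "q \<notin> tuples k \<Longrightarrow> ZX q U = {}"
  using fdeg_tuples by (auto simp: ZX_def)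

lemma openin_ZX: assumes "openin (topo \<Lambda>) U" shows "openin TX (ZX q U)"
proof (cases "q \<in> tuples k")
  case True
  show ?thesis
    using openin_continuous_map_preimage[OF continuous_segment[OF True], of "Some ` U"] assms
    by (simp add: ZX_eq[OF True])
qed (simp add: ZX_empty)

text \<open>Compactness of \<open>C\<close> is what counts here: it gives the point at infinity a
  neighbourhood that misses \<open>C\<close>, so that \<open>C\<close> stays closed in the
  compactification.\<close>

lemma closedin_ZX: assumes "compactin (topo \<Lambda>) C" shows "closedin TX (ZX q C)"
proof (cases "q \<in> tuples k")
  case True
  have "closedin (topo \<Lambda>) C" using assms compactin_imp_closedin Hausdorff by blast
  then show ?thesis
    using closedin_continuous_map_preimage[OF continuous_segment[OF True], of "Some ` C"] assms
    by (simp add: ZX_eq[OF True])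
qed (simp add: ZX_empty)

text \<open>An open neighbourhood of infinity is the complement of a compact set. Since a segment at
  \<open>q\<close> always has degree \<open>q\<close>, that compact set may be cut down to
  \<open>L q\<close>, which leaves the closedness test in the form to which compact alignment
  applies.\<close>

lemma continuous_into_TX:
  assumes f: "f \<in> topspace Z \<rightarrow> X"
    and op: "\<And>q U. q \<in> tuples k \<Longrightarrow> openin (topo \<Lambda>) U \<Longrightarrow> openin Z {z \<in> topspace Z. f z \<in> ZX q U}"
    and cl: "\<And>q C. q \<in> tuples k \<Longrightarrow> compactin (topo \<Lambda>) C \<Longrightarrow> C \<subseteq> L q \<Longrightarrow>
      closedin Z {z \<in> topspace Z. f z \<in> ZX q C}"
  shows "continuous_map Z TX f"
  unfolding TX_def
proof (rule continuous_map_pullback')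
  show "topspace Z \<subseteq> f -` X" using f by auto
  have "continuous_map Z A (\<lambda>z. segments (f z) q)" if q: "q \<in> tuples k" for q
    unfolding continuous_map_def
  proof (intro conjI allI impI)
    have "segments (f z) q \<in> topspace A" if "z \<in> topspace Z" for z
      using segments_in[of "f z"] f q that by (auto simp: PiE_iff)
    then show "(\<lambda>z. segments (f z) q) \<in> topspace Z \<rightarrow> topspace A" by blast
    fix V assume "openin A V"
    then consider U where "openin (topo \<Lambda>) U" "V = Some ` U"
      | C where "compactin (topo \<Lambda>) C" "V = insert None (Some ` (M - C))"
      unfolding openin_Alexandroff_compactification by blast
    then show "openin Z {z \<in> topspace Z. segments (f z) q \<in> V}"
    proof cases
      case 1
      have "{z \<in> topspace Z. segments (f z) q \<in> V} = {z \<in> topspace Z. f z \<in> ZX q U}"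
        using f unfolding ZX_eq[OF q] 1 by blast
      then show ?thesis using op q 1 by simp
    next
      case 2
      have C: "compactin (topo \<Lambda>) (C \<inter> L q)"
        using compact_Int_closedin[OF 2(1) closedin_d] by (simp add: of_degree_def)
      have "{z \<in> topspace Z. segments (f z) q \<in> V} = topspace Z - {z \<in> topspace Z. f z \<in> ZX q (C \<inter> L q)}"
        (is "?A = ?B")
      proof (rule set_eqI)
        fix z
        show "z \<in> ?A \<longleftrightarrow> z \<in> ?B"
        proof (cases "z \<in> topspace Z")
          case True
          then have "f z \<in> X" using f by auto
          then show ?thesis
            using True ini_props(1,2)[of "f z" q] q
            by (cases "q \<in> fdeg (f z)") (auto simp: ZX_def 2 segments_def of_degree_def image_iff)
        qed auto
      qed
      then show ?thesis using cl[OF q C] by auto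
    qed
  qed
  then show "continuous_map Z PA (segments \<circ> f)"
    by (auto simp: continuous_map_componentwise segments_def)
qed

lemma Hausdorff_A: "Hausdorff_space A"
  using Hausdorff_space_Alexandroff_compactification loc_compact Hausdorff by blast

lemma Hausdorff_TX: "Hausdorff_space TX"
proof (rule Hausdorff_space_injective_preimage[OF _ continuous_segments])
  show "Hausdorff_space PA" using Hausdorff_A by (simp add: Hausdorff_space_product_topology)
  show "inj_on segments (topspace TX)" using inj_segments by simp
qed

lemma continuous_the: "continuous_map (subtopology A (Some ` M)) (topo \<Lambda>) the"
  unfolding continuous_map_def
proof (intro conjI allI impI)
  fix U assume U: "openin (topo \<Lambda>) U"
  have "{v \<in> topspace (subtopology A (Some ` M)). the v \<in> U} = Some ` U"
    using openin_subset[OF U] by auto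
  then show "openin (subtopology A (Some ` M)) {v \<in> topspace (subtopology A (Some ` M)). the v \<in> U}"
    using U openin_subset[OF U] by (auto simp: openin_open_subtopology)
qed auto

end

section \<open>Compactness consequences of alignment\<close>

locale aligned_kgraph = top_kgraph +
  assumes aligned: "compactly_aligned k \<Lambda>"
begin

text \<open>For \<open>U\<close> inside \<open>L p\<close>, the set product with
  \<open>L (n - p)\<close> consists of the elements of degree \<open>n\<close> whose head of degree
  \<open>p\<close> lies in \<open>U\<close>. So this is compact alignment expressed through
  heads.\<close>

lemma compact_common_extensions:
  assumes "compactin (topo \<Lambda>) U" "U \<subseteq> L p" "compactin (topo \<Lambda>) V" "V \<subseteq> L q"
    "p \<in> tuples k" "q \<in> tuples k"
  shows "compactin (topo \<Lambda>) {l \<in> L (sup p q). head p l \<in> U \<and> head q l \<in> V}"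
proof -
  have "set_cmp \<Lambda> U (L (n - p)) = {l \<in> L n. head p l \<in> U}" if U: "U \<subseteq> L p" and le: "p \<le> n" for U p n
  proof
    show "set_cmp \<Lambda> U (L (n - p)) \<subseteq> {l \<in> L n. head p l \<in> U}"
      using U head_tail_cmp(1) fun_le_add_diff[OF le] by (auto simp: set_cmp_def of_degree_def subset_iff)
    show "{l \<in> L n. head p l \<in> U} \<subseteq> set_cmp \<Lambda> U (L (n - p))"
    proof
      fix l assume "l \<in> {l \<in> L n. head p l \<in> U}"
      then have l: "l \<in> M" "p \<le> d l" "d l = n" "head p l \<in> U" using le by (auto simp: of_degree_def)
      have "tail p l \<in> L (n - p)" using head_tail[OF l(1,2)] d_tail[OF l(1,2)] l by (simp add: of_degree_def)
      then show "l \<in> set_cmp \<Lambda> U (L (n - p))"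
        unfolding set_cmp_def using head_tail[OF l(1,2)] l by force
    qed
  qed
  note this[OF assms(2) sup_ge1[of p q]] this[OF assms(4) sup_ge2[of q p]]
  then have "{l \<in> L (sup p q). head p l \<in> U \<and> head q l \<in> V} =
      set_cmp \<Lambda> U (L (sup p q - p)) \<inter> set_cmp \<Lambda> V (L (sup p q - q))"
    by blast
  moreover have "compactin (topo \<Lambda>) (set_cmp \<Lambda> U (L (sup p q - p)) \<inter> set_cmp \<Lambda> V (L (sup p q - q)))"
    using aligned[unfolded compactly_aligned_def, rule_format, OF assms(5,6), of U V] assms(1-4) by blast
  ultimately show ?thesis by (simp only:)
qed

text \<open>A limit point \<open>h\<close> inherits the closed relations among segments: finite
  values have the right degrees and determine the earlier values as their heads. What remains is to
  find a path with these values, which needs the set \<open>D\<close> of finite degrees to be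
  down-closed, sup-closed and to contain 0.\<close>

lemma closure_segments:
  assumes p: "p \<in> tuples k" and K: "compactin (topo \<Lambda>) K"
    and h: "h \<in> PA closure_of (segments ` ZX p K)"
  shows "h \<in> segments ` ZX p K"
proof -
  let ?S = "segments ` ZX p K"
  have hP: "h \<in> topspace PA" using h closure_of_subset_topspace[of PA ?S] by blast
  have meet: "\<exists>x\<in>ZX p K. segments x \<in> V" if "openin PA V" "h \<in> V" for V
    using h that unfolding in_closure_of by blast
  have proj: "continuous_map PA A (\<lambda>h. h q)" if "q \<in> tuples k" for q
    using that by (rule continuous_map_product_projection)
  have op: "openin PA {h \<in> topspace PA. h q \<in> V}" if "q \<in> tuples k" "openin A V" for q V
    using openin_continuous_map_preimage[OF proj] that by blast
  define D where "D = {q \<in> tuples k. h q \<noteq> None}"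
  \<comment> \<open>Compactness of \<open>K\<close> keeps the limit from running off to infinity at
    \<open>p\<close>. Taking heads, it is finite at 0 too, so \<open>D\<close> is not empty.\<close>
  have hK: "h p \<in> Some ` K"
  proof -
    have "closedin (topo \<Lambda>) K" using K compactin_imp_closedin Hausdorff by blast
    then have "closedin PA {h \<in> topspace PA. h p \<in> Some ` K}"
      using closedin_continuous_map_preimage[OF proj[OF p]] K by auto
    moreover have "?S \<subseteq> {h \<in> topspace PA. h p \<in> Some ` K}"
      using segments_in ZX_eq[OF p] by blast
    ultimately show ?thesis using closure_of_minimal h by blast
  qed
  have hM: "l \<in> M" if "q \<in> tuples k" "h q = Some l" for q l
    using hP that by (auto simp: PiE_iff)
  have compat: "d l = q \<and> (\<forall>r\<le>q. h r = Some (head r l))" if q: "q \<in> tuples k" "h q = Some l" for q l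
  proof
    have l: "l \<in> M" using hM q .
    show dl: "d l = q"
    proof (rule ccontr)
      assume "d l \<noteq> q"
      have "openin A (Some ` {l \<in> M. d l \<noteq> q})" using openin_d by simp
      from meet[OF op[OF q(1) this]] obtain x where "x \<in> ZX p K" "segments x q \<in> Some ` {l \<in> M. d l \<noteq> q}"
        using q l \<open>d l \<noteq> q\<close> hP by auto
      then obtain l' where "x \<in> X" "segments x q = Some l'" "d l' \<noteq> q" by (auto simp: ZX_def)
      then show False using ini_props(2)[of x q] segments_Some[OF q(1), of x l'] by blast
    qed
    show "\<forall>r\<le>q. h r = Some (head r l)"
    proof (intro allI impI, rule ccontr)
      fix r assume r: "r \<le> q" and neq: "h r \<noteq> Some (head r l)"
      have rk: "r \<in> tuples k" using tuples_le q r by blast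
      \<comment> \<open>On this open set the coordinate at \<open>q\<close> is an element of
        \<open>L q\<close>, so its head is continuous and the relation with the coordinate at
        \<open>r\<close> is a closed condition.\<close>
      let ?O = "{h \<in> topspace PA. h q \<in> Some ` L q}"
      have O: "openin PA ?O" using op[OF q(1), of "Some ` L q"] openin_L by simp
      have c1: "continuous_map (subtopology PA ?O) A (\<lambda>h. h r)"
        using proj[OF rk] continuous_map_from_subtopology by blast
      have "continuous_map (subtopology PA ?O) (subtopology A (Some ` M)) (\<lambda>h. h q)"
        using proj[OF q(1)] by (auto simp: continuous_map_in_subtopology continuous_map_from_subtopology of_degree_def)
      from continuous_map_compose[OF this continuous_the]
      have "continuous_map (subtopology PA ?O) (topo \<Lambda>) (\<lambda>h. the (h q))" by (simp add: o_def)
      then have "continuous_map (subtopology PA ?O) (topo \<Lambda>) (\<lambda>h. head r (the (h q)))"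
        by (rule continuous_head') (use r in \<open>auto simp: of_degree_def\<close>)
      from continuous_map_compose[OF this continuous_map_Some]
      have c2: "continuous_map (subtopology PA ?O) A (\<lambda>h. Some (head r (the (h q))))" by (simp add: o_def)
      let ?E = "{h \<in> topspace (subtopology PA ?O). h r = Some (head r (the (h q)))}"
      have "closedin (subtopology PA ?O) ?E"
        by (rule closedin_continuous_maps_eq[OF Hausdorff_A c1 c2])
      then have "openin (subtopology PA ?O) (topspace (subtopology PA ?O) - ?E)" by blast
      then have "openin PA (?O - ?E)"
        using openin_trans_full[OF _ O] openin_subset[OF O] by (simp add: Int_absorb1)
      moreover have "h \<in> ?O - ?E" using hP q l dl neq by (auto simp: of_degree_def)
      ultimately obtain x where x: "x \<in> ZX p K" "segments x \<in> ?O - ?E" using meet by blast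
      then have "x \<in> X" "\<exists>l'. segments x q = Some l'" by (auto simp: ZX_def)
      then have "x \<in> X" "q \<in> fdeg x" using segments_Some[OF q(1), of x] by blast+
      then have "segments x r = Some (head r (the (segments x q)))"
        using head_ini(1)[of x q r] r fdeg_le[of q x r] rk q by (simp add: segments_def)
      then show False using x by auto
    qed
  qed
  have Dsup: "sup q r \<in> D" if q: "q \<in> D" and r: "r \<in> D" for q r
  proof (rule ccontr)
    assume s: "sup q r \<notin> D"
    have qk: "q \<in> tuples k" "r \<in> tuples k" "sup q r \<in> tuples k"
      using q r tuples_sup unfolding D_def by blast+
    obtain l l' where l: "h q = Some l" "h r = Some l'" using q r by (auto simp: D_def)
    have lL: "l \<in> L q" "l' \<in> L r"
      using compat[OF qk(1) l(1)] compat[OF qk(2) l(2)] hM[OF qk(1) l(1)] hM[OF qk(2) l(2)]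
      by (simp_all add: of_degree_def)
    have clL: "closedin (topo \<Lambda>) (L n)" for n unfolding of_degree_def by (rule closedin_d)
    obtain V C where V: "openin (topo \<Lambda>) V" "compactin (topo \<Lambda>) C" "l \<in> V" "V \<subseteq> C" "C \<subseteq> L q"
      using locally_compact_open_nbhd[OF loc_compact openin_L clL lL(1)] .
    obtain V' C' where V': "openin (topo \<Lambda>) V'" "compactin (topo \<Lambda>) C'" "l' \<in> V'" "V' \<subseteq> C'" "C' \<subseteq> L r"
      using locally_compact_open_nbhd[OF loc_compact openin_L clL lL(2)] .
    \<comment> \<open>Paths close to \<open>h\<close> at \<open>q\<close> and \<open>r\<close> have
      a segment at the join, and it lies in \<open>J\<close>. As \<open>J\<close> is compact, its
      complement together with infinity is an open set that contains the coordinate of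
      \<open>h\<close>; no path can satisfy both.\<close>
    define J where "J = {l \<in> L (sup q r). head q l \<in> C \<and> head r l \<in> C'}"
    have J: "compactin (topo \<Lambda>) J"
      unfolding J_def using compact_common_extensions V V' qk by blast
    then have "closedin (topo \<Lambda>) J" using compactin_imp_closedin Hausdorff by blast
    then have "openin A (insert None (Some ` (M - J)))"
      using J unfolding openin_Alexandroff_compactification by blast
    from op[OF qk(3) this] op[OF qk(1), of "Some ` V"] op[OF qk(2), of "Some ` V'"] V V'
    have "openin PA ({h \<in> topspace PA. h (sup q r) \<in> insert None (Some ` (M - J))} \<inter>
      {h \<in> topspace PA. h q \<in> Some ` V} \<inter> {h \<in> topspace PA. h r \<in> Some ` V'})" (is "openin PA ?W")
      by auto
    moreover have "h \<in> ?W" using s qk hP l V(3) V'(3) unfolding D_def by auto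
    ultimately obtain x where x: "x \<in> X" "segments x \<in> ?W" using meet unfolding ZX_def by blast
    then have qx: "q \<in> fdeg x" "ini x q \<in> C" "r \<in> fdeg x" "ini x r \<in> C'"
      using V V' qk by (auto simp: segments_def split: if_splits)
    have sx: "sup q r \<in> fdeg x" using fdeg_sup qx by blast
    have "head q (ini x (sup q r)) = ini x q" "head r (ini x (sup q r)) = ini x r"
      using head_ini(1)[OF x(1) sx] sup_ge1 sup_ge2 by blast+
    then have "ini x (sup q r) \<in> J"
      using ini_props[OF x(1) sx] qx by (simp add: J_def of_degree_def)
    moreover have "segments x (sup q r) = Some (ini x (sup q r))"
      using segments_Some[OF qk(3)] sx by blast
    ultimately show False using x(2) by auto
  qed
  have Ddown: "r \<in> D" if "q \<in> D" "r \<le> q" for q r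
    using that compat tuples_le unfolding D_def by blast
  have D0: "0 \<in> D" using Ddown[of p 0] hK p unfolding D_def by auto
  obtain m where m: "m \<in> tuples k" "finite_degs k m = D"
    using finite_degs_exists[of D k] D0 Dsup Ddown unfolding D_def by blast
  define y where "y = mk_path m (\<lambda>q. the (h q))"
  have 1: "the (h q) \<in> M \<and> d (the (h q)) = q" if q: "q \<in> finite_degs k m" for q
  proof -
    obtain l where "q \<in> tuples k" "h q = Some l" using q unfolding m D_def by auto
    then show ?thesis using compat hM by simp
  qed
  have 2: "head r (the (h q)) = the (h r)" if q: "q \<in> finite_degs k m" "r \<le> q" for q r
  proof -
    obtain l where "q \<in> tuples k" "h q = Some l" using q unfolding m D_def by auto
    then show ?thesis using compat[of q l] \<open>r \<le> q\<close> by simp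
  qed
  note y = mk_path[of m "\<lambda>q. the (h q)", OF m(1) 1 2, folded y_def]
  have fy: "fdeg y = D" using y(3) m by simp
  have yh: "segments y = h"
  proof
    fix q
    show "segments y q = h q"
    proof (cases "q \<in> tuples k")
      case True
      then show ?thesis using y(4)[of q] unfolding segments_def fy m D_def by auto
    next
      case False
      then show ?thesis using hP by (auto simp: segments_def PiE_iff extensional_def)
    qed
  qed
  then have "y \<in> ZX p K" using y(1) hK p unfolding ZX_eq[OF p] by simp
  then show ?thesis using yh by blast
qed

text \<open>The image in the product is closed by \<open>closure_segments\<close>, and the product
  is compact by Tychonoff. Compactness returns to \<open>TX\<close> along the inverse of
  \<open>segments\<close>, which is continuous because \<open>TX\<close> is a pullback
  topology.\<close>

lemma compact_ZX:
  assumes p: "p \<in> tuples k" and K: "compactin (topo \<Lambda>) K"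
  shows "compactin TX (ZX p K)"
proof -
  let ?S = "segments ` ZX p K"
  have sub: "ZX p K \<subseteq> X" by (auto simp: ZX_def)
  have SP: "?S \<subseteq> topspace PA" using segments_in sub by blast
  have "PA closure_of ?S \<subseteq> ?S" using closure_segments[OF p K] by blast
  then have "closedin PA ?S" using closure_of_eq closure_of_subset[OF SP] by blast
  moreover have "compact_space PA" by (simp add: compact_space_product_topology)
  ultimately have c: "compactin PA ?S" by (rule closedin_compact_space[rotated])
  define g where "g = inv_into X segments"
  have g: "g (segments x) = x" if "x \<in> X" for x
    unfolding g_def using inv_into_f_f[OF inj_segments that] .
  have "continuous_map (subtopology PA ?S) TX g"
    unfolding TX_def
  proof (rule continuous_map_pullback')
    show "topspace (subtopology PA ?S) \<subseteq> g -` X" using g sub by auto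
    have "continuous_map (subtopology PA ?S) PA (\<lambda>h. h)" by simp
    then show "continuous_map (subtopology PA ?S) PA (segments \<circ> g)"
      by (rule continuous_map_eq) (use g sub in auto)
  qed
  moreover have "compactin (subtopology PA ?S) ?S" using c by (simp add: compactin_subtopology)
  ultimately have "compactin TX (g ` ?S)" using image_compactin by blast
  moreover have "g ` ?S = ZX p K" using g sub by (force simp: image_iff)
  ultimately show ?thesis by simp
qed

lemma locally_compact_TX: "locally_compact_space TX"
  unfolding locally_compact_space_def
proof
  fix x assume "x \<in> topspace TX"
  then have x: "x \<in> X" by simp
  obtain U K where "openin (topo \<Lambda>) U" "compactin (topo \<Lambda>) K" "ini x 0 \<in> U" "U \<subseteq> K"
    using loc_compact ini_props(1)[OF x fdeg_0] unfolding locally_compact_space_def by blast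
  then have "openin TX (ZX 0 U)" "compactin TX (ZX 0 K)" "x \<in> ZX 0 U" "ZX 0 U \<subseteq> ZX 0 K"
    using openin_ZX[of U 0] compact_ZX[OF tuples_0, of K] x by (auto simp: ZX_def)
  then show "\<exists>U K. openin TX U \<and> compactin TX K \<and> x \<in> U \<and> U \<subseteq> K" by blast
qed

end

section \<open>The topology of the path groupoid\<close>

lemma continuous_map_locally:
  assumes "\<And>z. z \<in> topspace Z \<Longrightarrow> \<exists>N. openin Z N \<and> z \<in> N \<and> continuous_map (subtopology Z N) Y f"
  shows "continuous_map Z Y f"
  unfolding continuous_map_def
proof (intro conjI allI impI)
  show "f \<in> topspace Z \<rightarrow> topspace Y"
  proof
    fix z assume z: "z \<in> topspace Z"
    from assms[OF z] obtain N where "openin Z N" "z \<in> N" "continuous_map (subtopology Z N) Y f" by blast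
    then show "f z \<in> topspace Y" using continuous_map_funspace z by fastforce
  qed
  fix U assume U: "openin Y U"
  show "openin Z {z \<in> topspace Z. f z \<in> U}"
  proof (subst openin_subopen, rule ballI)
    fix z assume z: "z \<in> {z \<in> topspace Z. f z \<in> U}"
    then obtain N where N: "openin Z N" "z \<in> N" "continuous_map (subtopology Z N) Y f"
      using assms by blast
    have "openin (subtopology Z N) {z \<in> topspace (subtopology Z N). f z \<in> U}"
      using openin_continuous_map_preimage[OF N(3) U] .
    then have "openin Z {z \<in> topspace (subtopology Z N). f z \<in> U}"
      using openin_trans_full N by blast
    then show "\<exists>T. openin Z T \<and> z \<in> T \<and> T \<subseteq> {z \<in> topspace Z. f z \<in> U}"
      using z N(1,2) openin_subset[OF N(1)] by (intro exI[of _ "{z \<in> topspace (subtopology Z N). f z \<in> U}"]) auto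
  qed
qed

context top_kgraph
begin

lemma continuous_ini:
  assumes "continuous_map Z TX x" "\<And>z. z \<in> topspace Z \<Longrightarrow> q \<in> fdeg (x z)"
  shows "continuous_map Z (topo \<Lambda>) (\<lambda>z. ini (x z) q)"
  unfolding continuous_map_def
proof (intro conjI allI impI)
  have X: "x z \<in> X" if "z \<in> topspace Z" for z
    using continuous_map_funspace[OF assms(1)] that by auto
  then show "(\<lambda>z. ini (x z) q) \<in> topspace Z \<rightarrow> M" using ini_props(1) assms(2) by blast
  fix U assume U: "openin (topo \<Lambda>) U"
  have "{z \<in> topspace Z. ini (x z) q \<in> U} = {z \<in> topspace Z. x z \<in> ZX q U}"
    using X assms(2) unfolding ZX_def by blast
  then show "openin Z {z \<in> topspace Z. ini (x z) q \<in> U}"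
    using openin_continuous_map_preimage[OF assms(1) openin_ZX[OF U]] by simp
qed

lemma src_local_section:
  assumes "l \<in> M"
  obtains U v where "openin (topo \<Lambda>) U" "l \<in> U" "openin (topo \<Lambda>) (src \<Lambda> ` U)"
    "continuous_map (subtopology (topo \<Lambda>) (src \<Lambda> ` U)) (topo \<Lambda>) v"
    "\<And>m. m \<in> U \<Longrightarrow> v (src \<Lambda> m) = m"
proof -
  obtain U where U: "openin (topo \<Lambda>) U" "l \<in> U" "openin (topo \<Lambda>) (src \<Lambda> ` U)"
    "homeomorphic_map (subtopology (topo \<Lambda>) U) (subtopology (topo \<Lambda>) (src \<Lambda> ` U)) (src \<Lambda>)"
    using src_locally_injective[OF assms] by metis
  then obtain v where v: "homeomorphic_maps (subtopology (topo \<Lambda>) U) (subtopology (topo \<Lambda>) (src \<Lambda> ` U)) (src \<Lambda>) v"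
    using homeomorphic_map_maps by blast
  have "topspace (subtopology (topo \<Lambda>) U) = U" using openin_subset[OF U(1)] by auto
  then have "v (src \<Lambda> m) = m" if "m \<in> U" for m
    using v that unfolding homeomorphic_maps_def by auto
  moreover have "continuous_map (subtopology (topo \<Lambda>) (src \<Lambda> ` U)) (topo \<Lambda>) v"
    using v unfolding homeomorphic_maps_def using continuous_map_into_fulltopology by blast
  ultimately show ?thesis using that U by blast
qed

lemma openin_neq:
  assumes "continuous_map Z (topo \<Lambda>) f" "continuous_map Z (topo \<Lambda>) g"
  shows "openin Z {z \<in> topspace Z. f z \<noteq> g z}"
proof -
  have "{z \<in> topspace Z. f z \<noteq> g z} = topspace Z - {z \<in> topspace Z. f z = g z}" by blast
  then show ?thesis using closedin_continuous_maps_eq[OF Hausdorff assms] by auto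
qed

lemma same_tail_M:
  assumes "same_tail x p y q" shows "ini x p \<in> M" "ini y q \<in> M" "d (ini x p) = p" "d (ini y q) = q"
  using assms ini_props unfolding same_tail_def by blast+

section \<open>Families of groupoid elements over a parameter space\<close>

context
  fixes Z :: "'z topology" and x y :: "'z \<Rightarrow> 'a kpath" and t t' :: "nat \<Rightarrow> nat"
  assumes tl: "\<And>z. z \<in> topspace Z \<Longrightarrow> same_tail (x z) t (y z) t'"
    and cx: "continuous_map Z TX x"
    and cy: "continuous_map Z (topo \<Lambda>) (\<lambda>z. ini (y z) t')"
begin

lemma tail_pair_X: "z \<in> topspace Z \<Longrightarrow> x z \<in> X" "z \<in> topspace Z \<Longrightarrow> y z \<in> X"
  using tl by (auto simp: same_tail_def)

lemma openin_fdeg: "openin Z {z \<in> topspace Z. w \<in> fdeg (x z)}"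
proof -
  have "{z \<in> topspace Z. w \<in> fdeg (x z)} = {z \<in> topspace Z. x z \<in> ZX w M}"
    using tail_pair_X ini_props(1) unfolding ZX_def by blast
  then show ?thesis using openin_continuous_map_preimage[OF cx openin_ZX[OF openin_topspace]] by simp
qed

lemma openin_fdeg_sub:
  assumes "openin (subtopology Z {z \<in> topspace Z. w \<in> fdeg (x z)}) N" shows "openin Z N"
  using openin_trans_full[OF assms openin_fdeg] .

text \<open>Beyond the cut the two paths agree, so \<open>ini (y z) (t' + r)\<close> is
  \<open>ini (y z) t'\<close> followed by the tail of a segment of \<open>x z\<close>. The one
  assumed segment of \<open>y\<close> thus carries continuity to all later ones.\<close>

lemma continuous_pair:
  shows "continuous_map (subtopology Z {z \<in> topspace Z. t + r \<in> fdeg (x z)}) (topo \<Lambda>) (\<lambda>z. ini (x z) (t + r))"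
    and "continuous_map (subtopology Z {z \<in> topspace Z. t + r \<in> fdeg (x z)}) (topo \<Lambda>) (\<lambda>z. ini (y z) (t' + r))"
proof -
  let ?Z = "subtopology Z {z \<in> topspace Z. t + r \<in> fdeg (x z)}"
  show cw: "continuous_map ?Z (topo \<Lambda>) (\<lambda>z. ini (x z) (t + r))"
    by (rule continuous_ini[OF continuous_map_from_subtopology[OF cx]]) auto
  have le: "t \<le> t + r" "t' \<le> t' + r" by (auto simp: le_fun_def)
  have *: "ini (y z) (t' + r) = ini (y z) t' \<cdot> tail t (ini (x z) (t + r))"
    "src \<Lambda> (ini (y z) t') = rng \<Lambda> (tail t (ini (x z) (t + r)))" "t \<le> d (ini (x z) (t + r))"
    if z: "z \<in> topspace ?Z" for z
  proof -
    have z: "z \<in> topspace Z" "t + r \<in> fdeg (x z)" using z by auto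
    have y: "t' + r \<in> fdeg (y z)" using same_tail_fdeg[OF tl[OF z(1)]] z(2) by blast
    note e = same_tail_tail[OF tl[OF z(1)] z(2)]
    show "ini (y z) (t' + r) = ini (y z) t' \<cdot> tail t (ini (x z) (t + r))"
      "src \<Lambda> (ini (y z) t') = rng \<Lambda> (tail t (ini (x z) (t + r)))"
      unfolding e using ini_split[OF tail_pair_X(2)[OF z(1)] y le(2)] by blast+
    show "t \<le> d (ini (x z) (t + r))" using ini_props(2)[OF tail_pair_X(1)[OF z(1)] z(2)] le by simp
  qed
  have "continuous_map ?Z (topo \<Lambda>) (\<lambda>z. ini (y z) t' \<cdot> tail t (ini (x z) (t + r)))"
    by (rule continuous_cmp[OF continuous_map_from_subtopology[OF cy] continuous_head'(2)[OF cw]])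
      (use * in auto)
  then show "continuous_map ?Z (topo \<Lambda>) (\<lambda>z. ini (y z) (t' + r))"
    by (rule continuous_map_eq) (use * in auto)
qed

text \<open>A second representation with degrees \<open>p\<close>, \<open>q\<close> is compared with the given one by
  passing to \<open>w = p \<or> t\<close>: it exists at \<open>z\<close> exactly when the two tails from \<open>(p, q)\<close>
  to \<open>(w, w')\<close> agree.\<close>

lemma compare_tails:
  assumes pq: "int_diff p q = int_diff t t'"
  defines "w \<equiv> t + (p - t)" and "w' \<equiv> t' + (p - t)"
  defines "Zw \<equiv> subtopology Z {z \<in> topspace Z. w \<in> fdeg (x z)}"
  shows "continuous_map Zw (topo \<Lambda>) (\<lambda>z. tail p (ini (x z) w))"
    "continuous_map Zw (topo \<Lambda>) (\<lambda>z. tail q (ini (y z) w'))"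
    "continuous_map Zw (topo \<Lambda>) (\<lambda>z. head p (ini (x z) w))"
    "continuous_map Zw (topo \<Lambda>) (\<lambda>z. head q (ini (y z) w'))"
    "\<And>z. z \<in> topspace Zw \<Longrightarrow> same_tail (x z) p (y z) q \<longleftrightarrow> tail p (ini (x z) w) = tail q (ini (y z) w')"
    "\<And>z. z \<in> topspace Zw \<Longrightarrow> src \<Lambda> (tail p (ini (x z) w)) = src \<Lambda> (tail q (ini (y z) w'))"
    "\<And>z. z \<in> topspace Zw \<Longrightarrow> head p (ini (x z) w) = ini (x z) p \<and> head q (ini (y z) w') = ini (y z) q"
proof -
  have w: "w = p + (t - p)" unfolding w_def fun_add_diff_sup by (rule sup_commute)
  have w': "w' = q + (t - p)" unfolding w'_def using int_diff_eq_common[OF pq] by simp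
  have le: "p \<le> w" "q \<le> w'" unfolding w w' by (auto simp: le_fun_def)
  have z: "z \<in> topspace Z" "w \<in> fdeg (x z)" "x z \<in> X" "y z \<in> X" "w' \<in> fdeg (y z)"
    "same_tail (x z) w (y z) w'" if "z \<in> topspace Zw" for z
  proof -
    show z: "z \<in> topspace Z" "w \<in> fdeg (x z)" using that by (auto simp: Zw_def)
    show "same_tail (x z) w (y z) w'"
      unfolding w_def w'_def by (rule same_tail_add[OF tl[OF z(1)] z(2)[unfolded w_def]])
    then show "x z \<in> X" "y z \<in> X" "w' \<in> fdeg (y z)" unfolding same_tail_def by blast+
  qed
  note cx = continuous_pair(1)[of "p - t", folded w_def, folded Zw_def]
    and cy = continuous_pair(2)[of "p - t", folded w_def w'_def, folded Zw_def]
  have d: "p \<le> d (ini (x z) w)" "q \<le> d (ini (y z) w')" if "z \<in> topspace Zw" for z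
    using le ini_props(2)[OF z(3)[OF that] z(2)[OF that]] ini_props(2)[OF z(4)[OF that] z(5)[OF that]]
    by simp_all
  show "continuous_map Zw (topo \<Lambda>) (\<lambda>z. tail p (ini (x z) w))"
    "continuous_map Zw (topo \<Lambda>) (\<lambda>z. head p (ini (x z) w))"
    using continuous_head'[OF cx] d(1) by blast+
  show "continuous_map Zw (topo \<Lambda>) (\<lambda>z. tail q (ini (y z) w'))"
    "continuous_map Zw (topo \<Lambda>) (\<lambda>z. head q (ini (y z) w'))"
    using continuous_head'[OF cy] d(2) by blast+
  fix z assume zw: "z \<in> topspace Zw"
  note z = z[OF zw]
  show "same_tail (x z) p (y z) q \<longleftrightarrow> tail p (ini (x z) w) = tail q (ini (y z) w')"
    using same_tail_tail[of "x z" p "y z" q "t - p"] same_tail_cancel[of "x z" p "t - p" "y z" q] z(2,6)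
    unfolding w w' by blast
  show "src \<Lambda> (tail p (ini (x z) w)) = src \<Lambda> (tail q (ini (y z) w'))"
    using src_tail[OF ini_props(1)[OF z(3,2)] d(1)[OF zw]] src_tail[OF ini_props(1)[OF z(4,5)] d(2)[OF zw]]
      same_tail_src[OF z(6)] by simp
  show "head p (ini (x z) w) = ini (x z) p \<and> head q (ini (y z) w') = ini (y z) q"
    using head_ini(1)[OF z(3,2) le(1)] head_ini(1)[OF z(4,5) le(2)] by blast
qed

lemma openin_same_tail_in:
  assumes U: "openin (topo \<Lambda>) U" and V: "openin (topo \<Lambda>) V" and pq: "int_diff p q = int_diff t t'"
  shows "openin Z {z \<in> topspace Z. same_tail (x z) p (y z) q \<and> ini (x z) p \<in> U \<and> ini (y z) q \<in> V}"
    (is "openin Z ?A")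
proof (subst openin_subopen, rule ballI)
  fix z0 assume z0: "z0 \<in> ?A"
  define w where "w = t + (p - t)"
  define w' where "w' = t' + (p - t)"
  define Zw where "Zw = subtopology Z {z \<in> topspace Z. w \<in> fdeg (x z)}"
  note c = compare_tails[OF pq, folded w_def w'_def, folded Zw_def]
  have "w \<in> fdeg (x z0)"
    unfolding w_def fun_add_diff_sup using z0 tl[of z0] fdeg_sup unfolding same_tail_def by blast
  then have z0w: "z0 \<in> topspace Zw" using z0 by (auto simp: Zw_def)
  \<comment> \<open>\<open>W\<close> surrounds the common tail at \<open>z0\<close>. The two tails
    have equal sources at every point, so as soon as both lie in \<open>W\<close> injectivity of the
    source map makes them equal, and the second representation persists near
    \<open>z0\<close>.\<close>
  obtain W where W: "openin (topo \<Lambda>) W" "tail p (ini (x z0) w) \<in> W" "inj_on (src \<Lambda>) W"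
    using src_locally_injective[of "tail p (ini (x z0) w)"] continuous_map_funspace[OF c(1)] z0w by blast
  let ?N = "{z \<in> topspace Zw. tail p (ini (x z) w) \<in> W} \<inter> {z \<in> topspace Zw. tail q (ini (y z) w') \<in> W} \<inter>
    ({z \<in> topspace Zw. head p (ini (x z) w) \<in> U} \<inter> {z \<in> topspace Zw. head q (ini (y z) w') \<in> V})"
  have "openin Zw ?N"
    using openin_continuous_map_preimage[OF c(1) W(1)] openin_continuous_map_preimage[OF c(2) W(1)]
      openin_continuous_map_preimage[OF c(3) U] openin_continuous_map_preimage[OF c(4) V] by blast
  then have "openin Z ?N" using openin_fdeg_sub[of w] unfolding Zw_def by blast
  moreover have "z0 \<in> ?N" using z0 z0w W(2) c(5,7)[OF z0w] by auto
  moreover have "?N \<subseteq> ?A"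
  proof
    fix z assume z: "z \<in> ?N"
    then have zw: "z \<in> topspace Zw" by blast
    have "tail p (ini (x z) w) = tail q (ini (y z) w')"
      by (rule inj_onD[OF W(3) c(6)[OF zw]]) (use z in blast)+
    then show "z \<in> ?A" using z zw c(5,7)[OF zw] by (auto simp: Zw_def)
  qed
  ultimately show "\<exists>N. openin Z N \<and> z0 \<in> N \<and> N \<subseteq> ?A" by blast
qed

text \<open>At a point of the set the condition fails for one of three reasons, each of them stable:
  the tails agree but the pair of heads lies outside the closed set \<open>F\<close>; the tails
  differ, which is an open condition in a Hausdorff space; or the refinement degree is not reached.
  In the last case already \<open>p\<close> is not reached, and the closed cylinder over the first
  projection of \<open>F\<close> is avoided.\<close>

lemma openin_not_same_tail:
  assumes F: "F \<subseteq> src_pairs \<Lambda> M M" "compactin (prod_topology (topo \<Lambda>) (topo \<Lambda>)) F"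
    and pq: "int_diff p q = int_diff t t'"
  shows "openin Z {z \<in> topspace Z. \<not> (same_tail (x z) p (y z) q \<and> (ini (x z) p, ini (y z) q) \<in> F)}"
    (is "openin Z ?A")
proof (subst openin_subopen, rule ballI)
  fix z0 assume z0: "z0 \<in> ?A"
  define w where "w = t + (p - t)"
  define w' where "w' = t' + (p - t)"
  define Zw where "Zw = subtopology Z {z \<in> topspace Z. w \<in> fdeg (x z)}"
  note c = compare_tails[OF pq, folded w_def w'_def, folded Zw_def]
  note sub = openin_fdeg_sub[of w, folded Zw_def]
  show "\<exists>N. openin Z N \<and> z0 \<in> N \<and> N \<subseteq> ?A"
  proof (cases "w \<in> fdeg (x z0)")
    case True
    then have z0w: "z0 \<in> topspace Zw" using z0 by (auto simp: Zw_def)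
    show ?thesis
    proof (cases "same_tail (x z0) p (y z0) q")
      case True
      have "closedin (prod_topology (topo \<Lambda>) (topo \<Lambda>)) F"
        using F(2) compactin_imp_closedin Hausdorff by (simp add: compactin_imp_closedin Hausdorff_space_prod_topology)
      then have oF: "openin (prod_topology (topo \<Lambda>) (topo \<Lambda>)) (M \<times> M - F)" by (auto simp: closedin_def)
      have "continuous_map Zw (prod_topology (topo \<Lambda>) (topo \<Lambda>)) (\<lambda>z. (head p (ini (x z) w), head q (ini (y z) w')))"
        using c(3,4) by (simp add: continuous_map_paired)
      from openin_continuous_map_preimage[OF this oF]
      have "openin Zw {z \<in> topspace Zw. (head p (ini (x z) w), head q (ini (y z) w')) \<in> M \<times> M - F}" (is "openin Zw ?N") .
      then have "openin Z ?N" by (rule sub)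
      moreover have "z0 \<in> ?N"
        using z0 z0w True c(7)[OF z0w] same_tail_M(1,2)[OF True] by auto
      moreover have "?N \<subseteq> ?A"
      proof
        fix z assume z: "z \<in> ?N"
        then show "z \<in> ?A" using c(7)[of z] by (auto simp: Zw_def)
      qed
      ultimately show ?thesis by blast
    next
      case False
      have "openin Zw {z \<in> topspace Zw. tail p (ini (x z) w) \<noteq> tail q (ini (y z) w')}" (is "openin Zw ?N")
        by (rule openin_neq[OF c(1,2)])
      then have "openin Z ?N" by (rule sub)
      moreover have "z0 \<in> ?N" using z0w False c(5)[OF z0w] by blast
      moreover have "?N \<subseteq> ?A"
      proof
        fix z assume "z \<in> ?N"
        then have "z \<in> topspace Zw" "tail p (ini (x z) w) \<noteq> tail q (ini (y z) w')" by auto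
        moreover from this(1) have "z \<in> topspace Z" by (auto simp: Zw_def)
        ultimately show "z \<in> ?A" using c(5)[of z] by blast
      qed
      ultimately show ?thesis by blast
    qed
  next
    case False
    have z0Z: "z0 \<in> topspace Z" using z0 by blast
    have "t \<in> fdeg (x z0)" using tl[OF z0Z] by (simp add: same_tail_def)
    then have p: "p \<notin> fdeg (x z0)" using False fdeg_sup unfolding w_def fun_add_diff_sup by blast
    have "compactin (topo \<Lambda>) (fst ` F)" using image_compactin[OF F(2) continuous_map_fst] .
    then have "closedin Z {z \<in> topspace Z. x z \<in> ZX p (fst ` F)}"
      by (intro closedin_continuous_map_preimage[OF cx] closedin_ZX)
    then have "openin Z (topspace Z - {z \<in> topspace Z. x z \<in> ZX p (fst ` F)})" (is "openin Z ?N") by blast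
    moreover have "z0 \<in> ?N" using z0Z p by (auto simp: ZX_def)
    moreover have "?N \<subseteq> ?A"
      unfolding ZX_def same_tail_def by force
    ultimately show ?thesis by blast
  qed
qed

text \<open>Formulated for families so that units, products and sections of the range map are all
  instances. The asymmetry is deliberate: for a section the path \<open>y z\<close> is constructed,
  and only its segment at \<open>t'\<close> is directly under control.\<close>

lemma continuous_into_G_same_tail: "continuous_map Z (topo G) (\<lambda>z. (x z, int_diff t t', y z))"
proof (rule continuous_into_G)
  show "(\<lambda>z. (x z, int_diff t t', y z)) \<in> topspace Z \<rightarrow> mor G"
  proof
    fix z assume "z \<in> topspace Z"
    from tl[OF this] show "(x z, int_diff t t', y z) \<in> mor G" unfolding G_iff by blast
  qed
next
  fix U V n assume UV: "openin (topo \<Lambda>) U" "openin (topo \<Lambda>) V"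
  have "{z \<in> topspace Z. (x z, int_diff t t', y z) \<in> cylinder k \<Lambda> (src_pairs \<Lambda> U V) n} =
    (\<Union>(p, q)\<in>{(p, q). n = int_diff t t' \<and> int_diff p q = int_diff t t'}.
      {z \<in> topspace Z. same_tail (x z) p (y z) q \<and> ini (x z) p \<in> U \<and> ini (y z) q \<in> V})" (is "_ = \<Union> ?S")
    unfolding cylinder_src_pairs_iff[OF openin_subset[OF UV(1)] openin_subset[OF UV(2)]] by (auto; metis)
  moreover have "openin Z (\<Union> ?S)"
    using openin_same_tail_in[OF UV] by (intro openin_Union) auto
  ultimately show "openin Z {z \<in> topspace Z. (x z, int_diff t t', y z) \<in> cylinder k \<Lambda> (src_pairs \<Lambda> U V) n}"
    by simp
next
  fix F n assume F: "F \<subseteq> src_pairs \<Lambda> M M" "compactin (prod_topology (topo \<Lambda>) (topo \<Lambda>)) F"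
  \<comment> \<open>The degree map is continuous into a discrete space, so a compact set has only
    finitely many degrees. The complement of the compact cylinder becomes a finite intersection of
    open sets.\<close>
  have fin: "finite (d ` C)" if "compactin (topo \<Lambda>) C" for C
    using image_compactin[OF that kgraphD(12)] by (simp add: compactin_discrete_topology)
  let ?P = "{(p, q) \<in> d ` fst ` F \<times> d ` snd ` F. n = int_diff t t' \<and> int_diff p q = int_diff t t'}"
  have "finite (d ` fst ` F \<times> d ` snd ` F)"
    using fin image_compactin[OF F(2) continuous_map_fst] image_compactin[OF F(2) continuous_map_snd] by blast
  then have fP: "finite ?P" by (rule rev_finite_subset) blast
  have e: "{z \<in> topspace Z. (x z, int_diff t t', y z) \<notin> cylinder k \<Lambda> F n} = topspace Z \<inter>
    (\<Inter>(p, q)\<in>?P. {z \<in> topspace Z. \<not> (same_tail (x z) p (y z) q \<and> (ini (x z) p, ini (y z) q) \<in> F)})"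
    (is "?A = ?B")
  proof (rule set_eqI)
    fix z
    have *: "(p, q) \<in> d ` fst ` F \<times> d ` snd ` F"
      if "same_tail (x z) p (y z) q" "(ini (x z) p, ini (y z) q) \<in> F" for p q
    proof -
      have "ini (x z) p \<in> fst ` F" "ini (y z) q \<in> snd ` F"
        using that(2) by force+
      then have "d (ini (x z) p) \<in> d ` fst ` F" "d (ini (y z) q) \<in> d ` snd ` F"
        by blast+
      then show ?thesis using same_tail_M(3,4)[OF that(1)] by simp
    qed
    show "z \<in> ?A \<longleftrightarrow> z \<in> ?B"
    proof
      assume zA: "z \<in> ?A"
      have "\<not> (same_tail (x z) p (y z) q \<and> (ini (x z) p, ini (y z) q) \<in> F)" if "(p, q) \<in> ?P" for p q
      proof
        assume "same_tail (x z) p (y z) q \<and> (ini (x z) p, ini (y z) q) \<in> F"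
        moreover have "n = int_diff t t'" "n = int_diff p q" using that by auto
        ultimately have "(x z, int_diff t t', y z) \<in> cylinder k \<Lambda> F n"
          unfolding cylinder_iff[OF F(1)] by metis
        then show False using zA by blast
      qed
      then show "z \<in> ?B" using zA by fast
    next
      assume zB: "z \<in> ?B"
      have "(x z, int_diff t t', y z) \<notin> cylinder k \<Lambda> F n"
      proof
        assume "(x z, int_diff t t', y z) \<in> cylinder k \<Lambda> F n"
        then obtain p q where pq: "int_diff t t' = n" "same_tail (x z) p (y z) q" "n = int_diff p q"
          "(ini (x z) p, ini (y z) q) \<in> F"
          unfolding cylinder_iff[OF F(1)] by blast
        have "(p, q) \<in> ?P" using *[OF pq(2,4)] pq(1,3) by simp
        then show False using zB pq(2,4) by blast
      qed
      then show "z \<in> ?A" using zB by blast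
    qed
  qed
  show "openin Z ?A"
  proof -
    have "openin Z {z \<in> topspace Z. \<not> (same_tail (x z) p (y z) q \<and> (ini (x z) p, ini (y z) q) \<in> F)}"
      if "(p, q) \<in> ?P" for p q
      using that openin_not_same_tail[OF F] by blast
    then have "openin Z ((\<Inter>(p, q)\<in>?P. {z \<in> topspace Z. \<not> (same_tail (x z) p (y z) q \<and> (ini (x z) p, ini (y z) q) \<in> F)}) \<inter> topspace Z)"
      by (intro openin_INT[OF fP]) (simp only: split_beta prod.collapse)
    then show ?thesis unfolding e by (simp add: Int_commute)
  qed
qed

end

section \<open>Inversion, units and r-discreteness\<close>

lemma openin_G_minus_cylinder:
  assumes F: "F \<subseteq> src_pairs \<Lambda> M M" "compactin (prod_topology (topo \<Lambda>) (topo \<Lambda>)) F"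
  shows "openin (topo G) (mor G - cylinder k \<Lambda> F n)"
proof -
  have "mor G - cylinder k \<Lambda> F n = (cylinder k \<Lambda> (src_pairs \<Lambda> M M) n - cylinder k \<Lambda> F n) \<union>
    (\<Union>m\<in>-{n}. {g \<in> mor G. fst (snd g) = m})"
    unfolding cylinder_full by (auto simp: cylinder_def)
  moreover have "openin (topo G) (\<Union>m\<in>-{n}. {g \<in> mor G. fst (snd g) = m})"
    using openin_G_part by (intro openin_Union) auto
  ultimately show ?thesis
    using openin_cylinder[OF openin_topspace openin_topspace F] by (simp add: openin_Un)
qed

lemma cylinder_inverse:
  assumes "F \<subseteq> src_pairs \<Lambda> M M"
  shows "inverse_mor G g \<in> cylinder k \<Lambda> F n \<longleftrightarrow> g \<in> cylinder k \<Lambda> (prod.swap ` F) (- n)"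
proof -
  obtain x m y where g: "g = (x, m, y)" by (cases g)
  have F': "prod.swap ` F \<subseteq> src_pairs \<Lambda> M M" using assms by (auto simp: src_pairs_def)
  have "inverse_mor G g \<in> cylinder k \<Lambda> F n \<longleftrightarrow>
    - m = n \<and> (\<exists>p q. same_tail y p x q \<and> n = int_diff p q \<and> (ini y p, ini x q) \<in> F)"
    by (simp add: g cylinder_iff[OF assms])
  also have "\<dots> \<longleftrightarrow> m = - n \<and> (\<exists>q p. same_tail x q y p \<and> - n = int_diff q p \<and> (ini x q, ini y p) \<in> prod.swap ` F)"
  proof -
    have 1: "- m = n \<longleftrightarrow> m = - n" by auto
    have 2: "n = int_diff p q \<longleftrightarrow> - n = int_diff q p" for p q
      using int_diff_minus[of p q] minus_equation_iff by metis
    have 3: "(a, b) \<in> F \<longleftrightarrow> (b, a) \<in> prod.swap ` F" for a b by force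
    show ?thesis unfolding 1 2 same_tail_sym[of y] 3[of "ini y _"] by blast
  qed
  also have "\<dots> \<longleftrightarrow> g \<in> cylinder k \<Lambda> (prod.swap ` F) (- n)"
    unfolding g cylinder_iff[OF F'] ..
  finally show ?thesis .
qed

lemma continuous_inverse: "continuous_map (topo G) (topo G) (inverse_mor G)"
proof (rule continuous_into_G)
  show "inverse_mor G \<in> mor G \<rightarrow> mor G" using inverse_G(1) by blast
next
  fix U V n assume UV: "openin (topo \<Lambda>) U" "openin (topo \<Lambda>) V"
  have "src_pairs \<Lambda> U V \<subseteq> src_pairs \<Lambda> M M"
    using src_pairs_sub openin_subset[OF UV(1)] openin_subset[OF UV(2)] by blast
  from cylinder_inverse[OF this]
  have "{g \<in> mor G. inverse_mor G g \<in> cylinder k \<Lambda> (src_pairs \<Lambda> U V) n} =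
    mor G \<inter> cylinder k \<Lambda> (prod.swap ` src_pairs \<Lambda> U V) (- n)" by blast
  moreover have "prod.swap ` src_pairs \<Lambda> U V = src_pairs \<Lambda> V U"
    by (auto simp: src_pairs_def image_iff)
  ultimately show "openin (topo G) {g \<in> mor G. inverse_mor G g \<in> cylinder k \<Lambda> (src_pairs \<Lambda> U V) n}"
    using openin_cylinder'[OF UV(2,1)] by auto
next
  fix F n assume F: "F \<subseteq> src_pairs \<Lambda> M M" "compactin (prod_topology (topo \<Lambda>) (topo \<Lambda>)) F"
  have F': "prod.swap ` F \<subseteq> src_pairs \<Lambda> M M" using F by (auto simp: src_pairs_def)
  have "continuous_map (prod_topology (topo \<Lambda>) (topo \<Lambda>)) (prod_topology (topo \<Lambda>) (topo \<Lambda>)) (\<lambda>z. (snd z, fst z))"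
    by (simp add: continuous_map_paired continuous_map_fst continuous_map_snd)
  from image_compactin[OF F(2) this]
  have "compactin (prod_topology (topo \<Lambda>) (topo \<Lambda>)) (prod.swap ` F)"
    by (simp add: prod.swap_def[abs_def])
  from openin_G_minus_cylinder[OF F' this]
  have "openin (topo G) (mor G - cylinder k \<Lambda> (prod.swap ` F) (- n))" .
  moreover have "{g \<in> mor G. inverse_mor G g \<notin> cylinder k \<Lambda> F n} = mor G - cylinder k \<Lambda> (prod.swap ` F) (- n)"
    using cylinder_inverse[OF F(1)] by blast
  ultimately show "openin (topo G) {g \<in> mor G. inverse_mor G g \<notin> cylinder k \<Lambda> F n}" by simp
qed

lemma continuous_unit: "continuous_map TX (topo G) (\<lambda>x. (x, 0, x))"
proof -
  have "continuous_map TX (topo G) (\<lambda>x. (x, int_diff 0 0, x))"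
  proof (rule continuous_into_G_same_tail)
    show "same_tail x 0 x 0" if "x \<in> topspace TX" for x
      using same_tail_refl that by simp
    show "continuous_map TX TX (\<lambda>x. x)" by simp
    show "continuous_map TX (topo \<Lambda>) (\<lambda>x. ini x 0)" by (rule continuous_ini) auto
  qed
  then show ?thesis by simp
qed

text \<open>With \<open>U\<close> and \<open>V\<close> each inside a single degree, the cylinder can
  only be entered through the cut degrees \<open>p\<close> and \<open>q\<close>, so the existential
  over representations disappears.\<close>

lemma openin_same_tail_pair:
  assumes "openin (topo \<Lambda>) U" "openin (topo \<Lambda>) V" "U \<subseteq> L p" "V \<subseteq> L q"
  shows "openin (topo G) {(x, n, y). n = int_diff p q \<and> same_tail x p y q \<and> ini x p \<in> U \<and> ini y q \<in> V}"
proof -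
  note sub = openin_subset[OF assms(1)] openin_subset[OF assms(2)]
  have "s = p \<and> t = q" if "same_tail x s y t" "ini x s \<in> U" "ini y t \<in> V" for x s y t
    using same_tail_M(3,4)[OF that(1)] that(2,3) assms(3,4) by (auto simp: of_degree_def)
  then have "(x, n, y) \<in> cylinder k \<Lambda> (src_pairs \<Lambda> U V) (int_diff p q) \<longleftrightarrow>
    n = int_diff p q \<and> same_tail x p y q \<and> ini x p \<in> U \<and> ini y q \<in> V" for x n y
    unfolding cylinder_src_pairs_iff[OF sub] by metis
  then have "{(x, n, y). n = int_diff p q \<and> same_tail x p y q \<and> ini x p \<in> U \<and> ini y q \<in> V} =
    cylinder k \<Lambda> (src_pairs \<Lambda> U V) (int_diff p q)" by auto
  then show ?thesis using openin_cylinder'[OF assms(1,2)] by simp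
qed

lemma openin_same_tail: "openin (topo G) {(x, n, y). n = int_diff p q \<and> same_tail x p y q}"
proof -
  have "{(x, n, y). n = int_diff p q \<and> same_tail x p y q} =
    {(x, n, y). n = int_diff p q \<and> same_tail x p y q \<and> ini x p \<in> L p \<and> ini y q \<in> L q}"
    using same_tail_M unfolding of_degree_def by blast
  then show ?thesis using openin_same_tail_pair[OF openin_L openin_L order_refl order_refl, of p q] by (simp only:)
qed

text \<open>Cutting at degree 0 leaves a path unchanged, so the units are the elements represented
  with both cut degrees 0, and these form one open cylinder.\<close>

lemma r_discrete_G: "r_discrete G"
proof -
  have "obj G = {(x, n, y). n = int_diff 0 0 \<and> same_tail x 0 y 0}"
  proof (rule set_eqI)
    fix g :: "'a gpd_elem"
    obtain x n y where g: "g = (x, n, y)" by (cases g)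
    have "same_tail x 0 y 0 \<longleftrightarrow> x \<in> X \<and> x = y"
      unfolding same_tail_def using path_shift_0[of x] path_shift_0[of y] fdeg_0 by metis
    moreover have "g \<in> obj G \<longleftrightarrow> n = 0 \<and> x \<in> X \<and> x = y" unfolding g obj_G by blast
    ultimately show "g \<in> obj G \<longleftrightarrow> g \<in> {(x, n, y). n = int_diff 0 0 \<and> same_tail x 0 y 0}"
      unfolding g by simp
  qed
  then show ?thesis unfolding r_discrete_def using openin_same_tail[of 0 0] by (simp only:)
qed

end

section \<open>Continuity of the range map and of the product\<close>

context aligned_kgraph
begin

text \<open>The pairs are a continuous image of the closed, hence compact, part of
  \<open>J \<times> B\<close> on which the composite exists. Such a set serves in
  \<open>closedin_fst_ZX\<close> as the compact set whose cylinder is removed.\<close>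

lemma compact_extended_pairs:
  assumes J: "compactin (topo \<Lambda>) J" "\<And>l. l \<in> J \<Longrightarrow> p \<le> d l" and B: "compactin (topo \<Lambda>) B"
  shows "compactin (prod_topology (topo \<Lambda>) (topo \<Lambda>))
    {(l, b \<cdot> tail p l) | l b. l \<in> J \<and> b \<in> B \<and> src \<Lambda> b = rng \<Lambda> (tail p l)}"
proof -
  let ?P = "prod_topology (topo \<Lambda>) (topo \<Lambda>)"
  let ?Z = "subtopology ?P (J \<times> B)"
  have sub: "J \<subseteq> M" "B \<subseteq> M" using J B compactin_subset_topspace by blast+
  then have tZ: "topspace ?Z = J \<times> B" by auto
  have cf: "continuous_map ?Z (topo \<Lambda>) fst" "continuous_map ?Z (topo \<Lambda>) snd"
    using continuous_map_fst continuous_map_snd continuous_map_from_subtopology by blast+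
  have ct: "continuous_map ?Z (topo \<Lambda>) (\<lambda>z. tail p (fst z))"
    by (rule continuous_head'(2)[OF cf(1)]) (use J(2) tZ in auto)
  let ?S = "{z \<in> topspace ?Z. src \<Lambda> (snd z) = rng \<Lambda> (tail p (fst z))}"
  have "closedin ?Z ?S"
    by (rule closedin_continuous_maps_eq[OF Hausdorff])
      (use continuous_map_compose[OF cf(2) continuous_src] continuous_map_compose[OF ct continuous_rng]
        in \<open>simp_all add: o_def\<close>)
  moreover have "compact_space ?Z"
    using J(1) B by (simp add: compact_space_subtopology compactin_Times)
  ultimately have S: "compactin ?Z ?S" by (rule closedin_compact_space[rotated])
  then have S': "compactin (subtopology ?Z ?S) ?S" by (simp add: compactin_subtopology)
  have "continuous_map (subtopology ?Z ?S) (topo \<Lambda>) (\<lambda>z. snd z \<cdot> tail p (fst z))"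
    by (rule continuous_cmp[OF continuous_map_from_subtopology[OF cf(2)] continuous_map_from_subtopology[OF ct]]) auto
  then have "continuous_map (subtopology ?Z ?S) ?P (\<lambda>z. (fst z, snd z \<cdot> tail p (fst z)))"
    using continuous_map_from_subtopology[OF cf(1)] by (simp add: continuous_map_paired)
  from image_compactin[OF S' this]
  have "compactin ?P ((\<lambda>z. (fst z, snd z \<cdot> tail p (fst z))) ` ?S)" .
  moreover have "(\<lambda>z. (fst z, snd z \<cdot> tail p (fst z))) ` ?S =
    {(l, b \<cdot> tail p l) | l b. l \<in> J \<and> b \<in> B \<and> src \<Lambda> b = rng \<Lambda> (tail p l)}"
    unfolding tZ by force
  ultimately show ?thesis by simp
qed

text \<open>Compact alignment is what makes the range map continuous: if an initial segment of degree
  \<open>q\<close> in the compact set \<open>C\<close> is attached to elements near \<open>(x, n, y)\<close>, then their common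
  refinements lie in a compact set \<open>E\<close>, so this persists at \<open>(x, n, y)\<close>.\<close>

lemma closedin_fst_ZX:
  assumes C: "compactin (topo \<Lambda>) C" "C \<subseteq> L q" and q: "q \<in> tuples k"
  shows "closedin (topo G) {g \<in> mor G. fst g \<in> ZX q C}"
proof -
  have "openin (topo G) (mor G - {g \<in> mor G. fst g \<in> ZX q C})" (is "openin _ ?A")
  proof (subst openin_subopen, rule ballI)
    fix g assume g: "g \<in> ?A"
    obtain x n y where e: "g = (x, n, y)" by (cases g)
    have "(x, n, y) \<in> mor G" using g e by blast
    then obtain p p' where p: "same_tail x p y p'" "n = int_diff p p'" unfolding G_iff by blast
    have pk: "p \<in> tuples k" "x \<in> X" using p fdeg_tuples unfolding same_tail_def by blast+
    have clL: "closedin (topo \<Lambda>) (L n)" for n unfolding of_degree_def by (rule closedin_d)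
    have iL: "ini x p \<in> L p" "ini y p' \<in> L p'" using same_tail_M[OF p(1)] by (simp_all add: of_degree_def)
    obtain V B where V: "openin (topo \<Lambda>) V" "compactin (topo \<Lambda>) B" "ini x p \<in> V" "V \<subseteq> B" "B \<subseteq> L p"
      using locally_compact_open_nbhd[OF loc_compact openin_L clL iL(1)] .
    obtain V' B' where V': "openin (topo \<Lambda>) V'" "compactin (topo \<Lambda>) B'" "ini y p' \<in> V'" "V' \<subseteq> B'" "B' \<subseteq> L p'"
      using locally_compact_open_nbhd[OF loc_compact openin_L clL iL(2)] .
    define w where "w = sup p q"
    have le: "p \<le> w" "q \<le> w" by (simp_all add: w_def)
    have w: "w = p + (q - p)" by (simp add: w_def fun_add_diff_sup)
    define J where "J = {l \<in> L w. head p l \<in> B \<and> head q l \<in> C}"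
    have J: "compactin (topo \<Lambda>) J"
      unfolding J_def w_def by (rule compact_common_extensions) (use V C pk q in auto)
    \<comment> \<open>Among the elements of the cylinder over \<open>V\<close> and
      \<open>V'\<close>, those whose first path lies in \<open>ZX q C\<close> are exactly the ones
      in the cylinder over \<open>E\<close>: refine to the join in one direction, take the head at
      \<open>q\<close> in the other.\<close>
    define E where "E = {(l, b \<cdot> tail p l) | l b. l \<in> J \<and> b \<in> B' \<and> src \<Lambda> b = rng \<Lambda> (tail p l)}"
    have Jd: "p \<le> d l" "d l = w" "l \<in> M" if "l \<in> J" for l
      using that le by (auto simp: J_def of_degree_def)
    have E: "compactin (prod_topology (topo \<Lambda>) (topo \<Lambda>)) E"
      unfolding E_def by (rule compact_extended_pairs[OF J Jd(1) V'(2)])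
    have E': "E \<subseteq> src_pairs \<Lambda> M M"
    proof
      fix lm assume "lm \<in> E"
      then obtain l b where lb: "lm = (l, b \<cdot> tail p l)" "l \<in> J" "b \<in> B'" "src \<Lambda> b = rng \<Lambda> (tail p l)"
        unfolding E_def by blast
      have "b \<in> M" using compactin_subset_topspace[OF V'(2)] lb by blast
      then show "lm \<in> src_pairs \<Lambda> M M"
        using lb Jd[OF lb(2)] head_tail(2)[of l p] src_tail[of l p] by (simp add: src_pairs_def)
    qed
    let ?N = "cylinder k \<Lambda> (src_pairs \<Lambda> V V') n - cylinder k \<Lambda> E n"
    note cV = cylinder_src_pairs_iff[OF openin_subset[OF V(1)] openin_subset[OF V'(1)]]
    have "openin (topo G) ?N" by (rule openin_cylinder[OF V(1) V'(1) E' E])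
    moreover have "g \<in> ?N"
    proof -
      have "g \<in> cylinder k \<Lambda> (src_pairs \<Lambda> V V') n"
        unfolding e cV using p V(3) V'(3) by blast
      moreover have "g \<notin> cylinder k \<Lambda> E n"
      proof
        assume "g \<in> cylinder k \<Lambda> E n"
        then obtain s t where st: "same_tail x s y t" "(ini x s, ini y t) \<in> E"
          unfolding e cylinder_iff[OF E'] by blast
        then have sJ: "ini x s \<in> J" by (auto simp: E_def)
        then have sw: "s = w" using Jd(2) same_tail_M(3)[OF st(1)] by simp
        then have wx: "w \<in> fdeg x" using st(1) by (simp add: same_tail_def)
        then have "q \<in> fdeg x" "ini x q \<in> C"
          using fdeg_le[OF wx le(2)] head_ini(1)[OF pk(2) wx le(2)] sJ sw by (auto simp: J_def)
        then show False using g pk by (auto simp: e ZX_def)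
      qed
      ultimately show ?thesis by blast
    qed
    moreover have "?N \<subseteq> ?A"
    proof
      fix h assume h: "h \<in> ?N"
      obtain x' n' y' where eh: "h = (x', n', y')" by (cases h)
      obtain s t where st: "same_tail x' s y' t" "n = int_diff s t" "ini x' s \<in> V" "ini y' t \<in> V'" "n' = n"
        using h unfolding eh cV Diff_iff by blast
      \<comment> \<open>Neighbourhoods inside one degree leave no choice of cut degrees, so
        \<open>h\<close> is cut at \<open>p\<close> and \<open>p'\<close> just like
        \<open>g\<close>.\<close>
      have sp: "s = p" "t = p'"
        using st(3,4) V(4,5) V'(4,5) same_tail_M(3,4)[OF st(1)] by (auto simp: of_degree_def)
      have x': "x' \<in> X" "p \<in> fdeg x'" "y' \<in> X" using st(1) sp by (auto simp: same_tail_def)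
      have "h \<in> mor G" unfolding eh G_iff using st by blast
      moreover have "x' \<notin> ZX q C"
      proof
        assume "x' \<in> ZX q C"
        then have qx: "q \<in> fdeg x'" "ini x' q \<in> C" by (auto simp: ZX_def)
        have wx: "w \<in> fdeg x'" unfolding w_def using fdeg_sup qx x' by blast
        have st': "same_tail x' w y' (p' + (q - p))"
          unfolding w using same_tail_add[OF st(1)] wx sp w by simp
        then have wy: "p' + (q - p) \<in> fdeg y'" by (simp add: same_tail_def)
        have tl: "tail p (ini x' w) = tail p' (ini y' (p' + (q - p)))"
          using same_tail_tail[of x' p y' p' "q - p"] st(1) sp wx w by simp
        note sy = ini_split[OF x'(3) wy fun_le_add]
        have "ini x' w \<in> J"
          using head_ini(1)[OF x'(1) wx le(1)] head_ini(1)[OF x'(1) wx le(2)] qx st(3) V(4) sp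
            ini_props[OF x'(1) wx] by (auto simp: J_def of_degree_def)
        moreover have "ini y' p' \<in> B'" using st(4) V'(4) sp by blast
        moreover have "src \<Lambda> (ini y' p') = rng \<Lambda> (tail p (ini x' w))" using sy(2) tl by simp
        moreover have "ini y' (p' + (q - p)) = ini y' p' \<cdot> tail p (ini x' w)" using sy(1) tl by simp
        ultimately have "(ini x' w, ini y' (p' + (q - p))) \<in> E" unfolding E_def by blast
        moreover have "n = int_diff w (p' + (q - p))" unfolding w using p(2) by simp
        ultimately have "h \<in> cylinder k \<Lambda> E n"
          unfolding eh cylinder_iff[OF E'] using st' st(5) by blast
        then show False using h by blast
      qed
      ultimately show "h \<in> ?A" by (simp add: eh)
    qed
    ultimately show "\<exists>T. openin (topo G) T \<and> g \<in> T \<and> T \<subseteq> ?A" by blast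
  qed
  then show ?thesis by (auto simp: closedin_def)
qed

lemma continuous_fst: "continuous_map (topo G) TX fst"
proof (rule continuous_into_TX)
  show "fst \<in> mor G \<rightarrow> X" using G_X by force
next
  fix q :: "nat \<Rightarrow> nat" and U assume q: "q \<in> tuples k" and U: "openin (topo \<Lambda>) U"
  \<comment> \<open>These elements extend a segment of degree \<open>q\<close> in \<open>U\<close>.
    Any representation can be refined past \<open>q\<close> when \<open>q\<close> is a degree of
    \<open>x\<close>, so the condition on \<open>ini x q\<close> can be read off a prefix and the
    preimage is a union of open cylinders.\<close>
  let ?U = "{l \<in> M. q \<le> d l \<and> head q l \<in> U \<and> tail q l \<in> M}"
  have oU: "openin (topo \<Lambda>) ?U" using openin_head_tail[OF U openin_topspace] .
  have "{g \<in> mor G. fst g \<in> ZX q U} = (\<Union>n. cylinder k \<Lambda> (src_pairs \<Lambda> ?U M) n)"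
  proof (rule set_eqI)
    fix g :: "'a gpd_elem"
    obtain x n y where e: "g = (x, n, y)" by (cases g)
    have "g \<in> mor G \<and> x \<in> ZX q U \<longleftrightarrow>
      (\<exists>p p'. same_tail x p y p' \<and> n = int_diff p p' \<and> ini x p \<in> ?U \<and> ini y p' \<in> M)" (is "?l \<longleftrightarrow> ?r")
    proof
      assume l: ?l
      then obtain p p' where p: "same_tail x p y p'" "n = int_diff p p'" unfolding e G_iff by blast
      have x: "x \<in> X" "q \<in> fdeg x" "ini x q \<in> U" "p \<in> fdeg x" using l p by (auto simp: ZX_def same_tail_def)
      have w: "p + (q - p) \<in> fdeg x" unfolding fun_add_diff_sup using fdeg_sup x by blast
      have le: "q \<le> p + (q - p)" unfolding fun_add_diff_sup by simp
      have st: "same_tail x (p + (q - p)) y (p' + (q - p))" using same_tail_add[OF p(1) w] .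
      have "ini x (p + (q - p)) \<in> ?U"
        using ini_props[OF x(1) w] head_ini(1)[OF x(1) w le] x le head_tail(2)[of "ini x (p + (q - p))" q] by simp
      moreover have "n = int_diff (p + (q - p)) (p' + (q - p))" using p by simp
      ultimately show ?r using st same_tail_M(2)[OF st] by blast
    next
      assume ?r
      then obtain p p' where p: "same_tail x p y p'" "n = int_diff p p'" "ini x p \<in> ?U" by blast
      have x: "x \<in> X" "p \<in> fdeg x" using p(1) by (auto simp: same_tail_def)
      have le: "q \<le> p" using p(3) ini_props(2)[OF x] by simp
      have "x \<in> ZX q U" using x fdeg_le[OF x(2) le] head_ini(1)[OF x le] p(3) by (simp add: ZX_def)
      then show ?l using p unfolding e G_iff by blast
    qed
    then show "g \<in> {g \<in> mor G. fst g \<in> ZX q U} \<longleftrightarrow> g \<in> (\<Union>n. cylinder k \<Lambda> (src_pairs \<Lambda> ?U M) n)"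
      using cylinder_src_pairs_iff[OF openin_subset[OF oU] order_refl, of x n y] unfolding e by auto
  qed
  moreover have "openin (topo G) (\<Union>n. cylinder k \<Lambda> (src_pairs \<Lambda> ?U M) n)"
    using openin_cylinder'[OF oU openin_topspace] by (intro openin_Union) auto
  ultimately show "openin (topo G) {g \<in> mor G. fst g \<in> ZX q U}" by simp
qed (rule closedin_fst_ZX)

lemma continuous_third: "continuous_map (topo G) TX (\<lambda>g. snd (snd g))"
proof -
  have "continuous_map (topo G) TX (fst \<circ> inverse_mor G)"
    using continuous_map_compose[OF continuous_inverse continuous_fst] .
  then show ?thesis
    by (rule continuous_map_eq) (auto simp: path_groupoid_def)
qed

lemma continuous_rng_src_G:
  "continuous_map (topo G) (obj_topo G) (rng G)" "continuous_map (topo G) (obj_topo G) (src G)"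
proof -
  have "continuous_map (topo G) (topo G) (rng G)"
    using continuous_map_compose[OF continuous_fst continuous_unit]
    by (rule continuous_map_eq) (auto simp: path_groupoid_def)
  moreover have "continuous_map (topo G) (topo G) (src G)"
    using continuous_map_compose[OF continuous_third continuous_unit]
    by (rule continuous_map_eq) (auto simp: path_groupoid_def)
  ultimately show "continuous_map (topo G) (obj_topo G) (rng G)" "continuous_map (topo G) (obj_topo G) (src G)"
    using category_G unfolding is_category_def by (auto simp: continuous_map_in_subtopology)
qed

lemma continuous_cmp_G: "continuous_map (composable_topo G) (topo G) (\<lambda>(g, h). cmp G g h)"
proof (rule continuous_map_locally)
  fix gh assume gh: "gh \<in> topspace (composable_topo G)"
  then have "gh \<in> composable G" by auto
  then obtain x n y m z where e: "gh = ((x, n, y), (y, m, z))" and g: "(x, n, y) \<in> mor G" "(y, m, z) \<in> mor G"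
    by (cases gh) (auto simp: composable_G)
  obtain a b b' c' where abc: "same_tail x a y b" "n = int_diff a b" "same_tail y b' z c'" "m = int_diff b' c'"
    using g unfolding G_iff by metis
  \<comment> \<open>The representations are refined so that both cut the middle path at the same
    \<open>q\<close>. On the neighbourhood chosen below these degrees stay valid, and the product is
    represented by \<open>p\<close> and \<open>s\<close> without further refinement.\<close>
  define p q s where "p = a + (b' - b)" and "q = b + (b' - b)" and "s = c' + (b - b')"
  have "q = b' + (b - b')" unfolding q_def fun_add_diff_sup by (rule sup_commute)
  then have st: "same_tail x p y q" "n = int_diff p q" "same_tail y q z s" "m = int_diff q s"
    using same_tail_compose(2,3)[OF abc(1,3)] abc(2,4) unfolding p_def s_def
    by (metis q_def, metis q_def int_diff_add, metis q_def, metis int_diff_add)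
  let ?U = "{(x, n, y). n = int_diff p q \<and> same_tail x p y q}"
  let ?V = "{(y, m, z). m = int_diff q s \<and> same_tail y q z s}"
  let ?N = "composable G \<inter> (?U \<times> ?V)"
  have "openin (composable_topo G) ?N"
    by (intro openin_subtopology_Int2) (simp add: openin_prod_Times_iff openin_same_tail)
  moreover have "gh \<in> ?N" using \<open>gh \<in> composable G\<close> st by (simp add: e)
  moreover have "continuous_map (subtopology (composable_topo G) ?N) (topo G) (\<lambda>(g, h). cmp G g h)"
  proof -
    let ?Z = "subtopology (composable_topo G) ?N"
    have N: "\<exists>x y z. gh = ((x, int_diff p q, y), (y, int_diff q s, z)) \<and> same_tail x p y q \<and> same_tail y q z s"
      if "gh \<in> topspace ?Z" for gh
      using that by (auto simp: composable_G)
    have c: "continuous_map ?Z (topo G) fst" "continuous_map ?Z (topo G) snd"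
      by (intro continuous_map_from_subtopology continuous_map_fst continuous_map_snd)+
    have "continuous_map ?Z (topo G) (\<lambda>gh. (fst (fst gh), int_diff p s, snd (snd (snd gh))))"
    proof (rule continuous_into_G_same_tail)
      show "same_tail (fst (fst gh)) p (snd (snd (snd gh))) s" if "gh \<in> topspace ?Z" for gh
        using N[OF that] same_tail_trans by auto
      show "continuous_map ?Z TX (\<lambda>gh. fst (fst gh))"
        using continuous_map_compose[OF c(1) continuous_fst] by (simp add: o_def)
      have "continuous_map ?Z TX (\<lambda>gh. snd (snd (snd gh)))"
        using continuous_map_compose[OF c(2) continuous_third] by (simp add: o_def)
      then show "continuous_map ?Z (topo \<Lambda>) (\<lambda>gh. ini (snd (snd (snd gh))) s)"
        by (rule continuous_ini) (use N in \<open>fastforce simp: same_tail_def\<close>)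
    qed
    then show ?thesis
    proof (rule continuous_map_eq)
      fix gh assume "gh \<in> topspace ?Z"
      from N[OF this] show "(fst (fst gh), int_diff p s, snd (snd (snd gh))) = (\<lambda>(g, h). cmp G g h) gh"
        using int_diff_plus by auto
    qed
  qed
  ultimately show "\<exists>N. openin (composable_topo G) N \<and> gh \<in> N \<and>
    continuous_map (subtopology (composable_topo G) N) (topo G) (\<lambda>(g, h). cmp G g h)" by blast
qed

lemma topological_groupoid_G: "topological_groupoid G"
  unfolding topological_groupoid_def
  using category_G inverse_G continuous_rng_src_G continuous_cmp_G continuous_inverse by blast

text \<open>The identity is a continuous injection into the product of two copies of
  \<open>TX\<close> with a discrete degree, and Hausdorffness pulls back along it.\<close>

lemma Hausdorff_G: "Hausdorff_space (topo G)"
proof (rule Hausdorff_space_injective_preimage)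
  let ?Y = "prod_topology TX (prod_topology (discrete_topology (UNIV :: (nat \<Rightarrow> int) set)) TX)"
  show "Hausdorff_space ?Y"
    by (simp add: Hausdorff_space_prod_topology Hausdorff_TX Hausdorff_space_discrete_topology)
  have "continuous_map (topo G) (discrete_topology UNIV) (\<lambda>g. fst (snd g))"
    unfolding continuous_map_def
  proof (intro conjI allI impI)
    fix U :: "(nat \<Rightarrow> int) set"
    have "{g \<in> mor G. fst (snd g) \<in> U} = (\<Union>n\<in>U. {g \<in> mor G. fst (snd g) = n})" by blast
    then show "openin (topo G) {g \<in> mor G. fst (snd g) \<in> U}"
      using openin_G_part by (auto intro!: openin_Union)
  qed simp
  then have "continuous_map (topo G) ?Y (\<lambda>g. (fst g, (fst (snd g), snd (snd g))))"
    using continuous_third continuous_fst unfolding continuous_map_paired by blast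
  then show "continuous_map (topo G) ?Y (\<lambda>g. g)" by simp
qed simp

section \<open>Local sections of the range map\<close>

lemma local_section:
  assumes g: "g \<in> mor G"
  obtains W N \<sigma> where "openin (topo G) W" "g \<in> W" "openin TX N"
    "continuous_map (subtopology TX N) (topo G) \<sigma>"
    "\<And>x. x \<in> N \<Longrightarrow> \<sigma> x \<in> W \<and> fst (\<sigma> x) = x"
    "\<And>h. h \<in> W \<Longrightarrow> fst h \<in> N \<and> \<sigma> (fst h) = h"
proof -
  obtain x n y where e: "g = (x, n, y)" by (cases g)
  obtain p q where pq: "same_tail x p y q" "n = int_diff p q" using g unfolding e G_iff by blast
  obtain V0 v where V0: "openin (topo \<Lambda>) V0" "ini y q \<in> V0" "openin (topo \<Lambda>) (src \<Lambda> ` V0)"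
    and v0: "continuous_map (subtopology (topo \<Lambda>) (src \<Lambda> ` V0)) (topo \<Lambda>) v" "\<And>m. m \<in> V0 \<Longrightarrow> v (src \<Lambda> m) = m"
    using src_local_section[OF same_tail_M(2)[OF pq(1)]] by metis
  let ?S = "subtopology (topo \<Lambda>) (src \<Lambda> ` V0)"
  have V0M: "V0 \<subseteq> M" using openin_subset[OF V0(1)] .
  \<comment> \<open>The prefixes of degree \<open>p\<close> whose source lifts along
    \<open>v\<close> to an element of degree \<open>q\<close>; the lift will be the prefix of the
    second path. The degree of the lift is an open condition, so \<open>U\<close> is open.\<close>
  define U where "U = {l \<in> M. src \<Lambda> l \<in> {a \<in> topspace ?S. v a \<in> L q}} \<inter> L p"
  have S': "openin (topo \<Lambda>) {a \<in> topspace ?S. v a \<in> L q}"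
    using openin_trans_full[OF openin_continuous_map_preimage[OF v0(1) openin_L] V0(3)] .
  have U: "openin (topo \<Lambda>) U"
    unfolding U_def using openin_continuous_map_preimage[OF continuous_src S'] openin_L by blast
  define N where "N = ZX p U"
  define W where "W = {(x, n, y). n = int_diff p q \<and> same_tail x p y q \<and> ini x p \<in> L p \<and> ini y q \<in> V0 \<inter> L q}"
  define l where "l x = v (src \<Lambda> (ini x p))" for x
  define \<sigma> where "\<sigma> x = (x, int_diff p q, path_prepend k \<Lambda> (l x) (path_shift k p x))" for x
  have l: "l x \<in> M" "d (l x) = q" "src \<Lambda> (l x) = src \<Lambda> (ini x p)" "l x \<in> V0" if "x \<in> N" for x
  proof -
    have a: "src \<Lambda> (ini x p) \<in> src \<Lambda> ` V0" "l x \<in> L q"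
      using that by (auto simp: N_def ZX_def U_def l_def)
    then obtain m where m: "m \<in> V0" "src \<Lambda> (ini x p) = src \<Lambda> m" by blast
    then have "l x = m" using v0(2) by (simp add: l_def)
    then show "l x \<in> M" "d (l x) = q" "src \<Lambda> (l x) = src \<Lambda> (ini x p)" "l x \<in> V0"
      using m a by (auto simp: of_degree_def)
  qed
  have N: "x \<in> X" "p \<in> fdeg x" "ini x p \<in> L p" if "x \<in> N" for x
    using that by (auto simp: N_def ZX_def U_def)
  have sig: "same_tail x p (snd (snd (\<sigma> x))) q" "ini (snd (snd (\<sigma> x))) q = l x" if x: "x \<in> N" for x
  proof -
    let ?y = "path_prepend k \<Lambda> (l x) (path_shift k p x)"
    have "?y \<in> X \<and> q \<in> fdeg ?y \<and> ini ?y q = l x \<and> path_shift k q ?y = path_shift k p x"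
      using prepend[OF l(1)[OF x] path_shift(1)[OF N(1,2)[OF x]], of ?y]
        path_rng_shift[OF N(1,2)[OF x]] l[OF x] by simp
    then show "same_tail x p (snd (snd (\<sigma> x))) q" "ini (snd (snd (\<sigma> x))) q = l x"
      using N[OF x] by (auto simp: same_tail_def \<sigma>_def)
  qed
  show ?thesis
  proof
    show "openin (topo G) W"
      unfolding W_def by (rule openin_same_tail_pair) (use openin_L V0 in auto)
    show "g \<in> W"
      using pq V0(2) same_tail_M[OF pq(1)] by (auto simp: e W_def of_degree_def)
    show oN: "openin TX N" unfolding N_def by (rule openin_ZX[OF U])
    show "\<sigma> x \<in> W \<and> fst (\<sigma> x) = x" if "x \<in> N" for x
      using sig[OF that] N[OF that] l[OF that] by (auto simp: W_def \<sigma>_def of_degree_def)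
    show "fst h \<in> N \<and> \<sigma> (fst h) = h" if "h \<in> W" for h
    proof -
      obtain x' n' y' where "h = (x', n', y')" by (cases h)
      then have h: "h = (x', int_diff p q, y')" "same_tail x' p y' q" "ini y' q \<in> V0" "ini y' q \<in> L q"
        "ini x' p \<in> L p"
        using that by (simp_all add: W_def)
      have s: "src \<Lambda> (ini x' p) = src \<Lambda> (ini y' q)" using same_tail_src[OF h(2)] .
      have lx: "l x' = ini y' q" using v0(2)[OF h(3)] s by (simp add: l_def)
      have "x' \<in> N"
        using h s lx V0M same_tail_M(1)[OF h(2)] by (auto simp: N_def ZX_def U_def same_tail_def l_def)
      moreover have y': "y' \<in> X" "q \<in> fdeg y'" "path_shift k p x' = path_shift k q y'"
        using h(2) by (auto simp: same_tail_def)
      moreover have "path_prepend k \<Lambda> (ini y' q) (path_shift k q y') = y'"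
        unfolding prepend[OF ini_props(1)[OF y'(1,2)] path_shift(1)[OF y'(1,2)] path_rng_shift[OF y'(1,2)]]
        using y' ini_props(2)[OF y'(1,2)] by simp
      ultimately show ?thesis using lx by (simp add: h(1) \<sigma>_def)
    qed
    have tN: "topspace (subtopology TX N) = N" using openin_subset[OF oN] by auto
    show "continuous_map (subtopology TX N) (topo G) \<sigma>"
      unfolding \<sigma>_def
    proof (rule continuous_into_G_same_tail)
      show "same_tail x p (path_prepend k \<Lambda> (l x) (path_shift k p x)) q" if "x \<in> topspace (subtopology TX N)" for x
        using sig(1)[of x] that by (simp add: tN \<sigma>_def)
      show "continuous_map (subtopology TX N) TX (\<lambda>x. x)"
        using continuous_map_from_subtopology[OF continuous_map_id] by (simp add: id_def)
      then have "continuous_map (subtopology TX N) (topo \<Lambda>) (\<lambda>x. ini x p)"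
        by (rule continuous_ini) (use N tN in auto)
      from continuous_map_compose[OF this continuous_src]
      have "continuous_map (subtopology TX N) ?S (\<lambda>x. src \<Lambda> (ini x p))"
        by (auto simp: continuous_map_in_subtopology o_def N_def ZX_def U_def)
      from continuous_map_compose[OF this v0(1)]
      have "continuous_map (subtopology TX N) (topo \<Lambda>) l" by (simp add: o_def l_def[abs_def])
      \<comment> \<open>The segment at \<open>q\<close> of the constructed path is
        \<open>l x\<close> itself, so its continuity is that of \<open>v\<close> applied to the
        source of \<open>ini x p\<close>.\<close>
      then show "continuous_map (subtopology TX N) (topo \<Lambda>) (\<lambda>x. ini (path_prepend k \<Lambda> (l x) (path_shift k p x)) q)"
        by (rule continuous_map_eq) (use sig(2) tN in \<open>auto simp: \<sigma>_def\<close>)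
    qed
  qed
qed

text \<open>\<open>\<sigma>\<close> carries a compact neighbourhood of \<open>fst g\<close> in
  \<open>N\<close> onto a compact set containing the whole part of \<open>W\<close> over that
  neighbourhood.\<close>

lemma locally_compact_G: "locally_compact_space (topo G)"
  unfolding locally_compact_space_def
proof
  fix g assume "g \<in> mor G"
  then obtain W N \<sigma> where W: "openin (topo G) W" "g \<in> W" "openin TX N"
    "continuous_map (subtopology TX N) (topo G) \<sigma>"
    and s: "\<And>x. x \<in> N \<Longrightarrow> \<sigma> x \<in> W \<and> fst (\<sigma> x) = x" "\<And>h. h \<in> W \<Longrightarrow> fst h \<in> N \<and> \<sigma> (fst h) = h"
    using local_section by metis
  have "locally_compact_space (subtopology TX N)"
    using locally_compact_space_open_subset locally_compact_TX Hausdorff_TX W(3) by blast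
  moreover have "fst g \<in> topspace (subtopology TX N)" using s(2)[OF W(2)] openin_subset[OF W(3)] by auto
  ultimately obtain V K where V: "openin (subtopology TX N) V" "compactin (subtopology TX N) K" "fst g \<in> V" "V \<subseteq> K"
    unfolding locally_compact_space_def by blast
  have V': "openin TX V" using openin_trans_full[OF V(1) W(3)] .
  have "openin (topo G) (W \<inter> {h \<in> mor G. fst h \<in> V})"
    using W(1) openin_continuous_map_preimage[OF continuous_fst V'] by blast
  moreover have "compactin (topo G) (\<sigma> ` K)" using image_compactin[OF V(2) W(4)] .
  moreover have "g \<in> W \<inter> {h \<in> mor G. fst h \<in> V}" using W V \<open>g \<in> mor G\<close> by blast
  moreover have "W \<inter> {h \<in> mor G. fst h \<in> V} \<subseteq> \<sigma> ` K" using s(2) V(4) by force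
  ultimately show "\<exists>U K. openin (topo G) U \<and> compactin (topo G) K \<and> g \<in> U \<and> U \<subseteq> K" by blast
qed

lemma local_homeomorphism_rng_G: "local_homeomorphism (topo G) (obj_topo G) (rng G)"
  unfolding local_homeomorphism_def
proof
  fix g assume "g \<in> mor G"
  then obtain W N \<sigma> where W: "openin (topo G) W" "g \<in> W" "openin TX N"
    "continuous_map (subtopology TX N) (topo G) \<sigma>"
    and s: "\<And>x. x \<in> N \<Longrightarrow> \<sigma> x \<in> W \<and> fst (\<sigma> x) = x" "\<And>h. h \<in> W \<Longrightarrow> fst h \<in> N \<and> \<sigma> (fst h) = h"
    using local_section by metis
  have rng: "rng G h = (fst h, 0, fst h)" for h by (cases h) simp
  have cf: "continuous_map (obj_topo G) TX fst" using continuous_map_from_subtopology[OF continuous_fst] .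
  have NX: "N \<subseteq> X" using openin_subset[OF W(3)] by simp
  have WG: "W \<subseteq> mor G" using openin_subset[OF W(1)] .
  have img: "rng G ` W = {u \<in> topspace (obj_topo G). fst u \<in> N}"
  proof
    show "rng G ` W \<subseteq> {u \<in> topspace (obj_topo G). fst u \<in> N}"
      using s(2) unit_G NX by (force simp: rng obj_G)
    show "{u \<in> topspace (obj_topo G). fst u \<in> N} \<subseteq> rng G ` W"
    proof
      fix u assume "u \<in> {u \<in> topspace (obj_topo G). fst u \<in> N}"
      then obtain x where "u = (x, 0, x)" "x \<in> N" by (auto simp: obj_G)
      then show "u \<in> rng G ` W" using s(1) rng[of "\<sigma> x"] by (metis imageI)
    qed
  qed
  then have oW: "openin (obj_topo G) (rng G ` W)"
    using openin_continuous_map_preimage[OF cf W(3)] by simp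
  have tW: "topspace (subtopology (obj_topo G) (rng G ` W)) = rng G ` W" using openin_subset[OF oW] by auto
  have "homeomorphic_maps (subtopology (topo G) W) (subtopology (obj_topo G) (rng G ` W)) (rng G) (\<lambda>u. \<sigma> (fst u))"
    unfolding homeomorphic_maps_def
  proof (intro conjI ballI)
    show "continuous_map (subtopology (topo G) W) (subtopology (obj_topo G) (rng G ` W)) (rng G)"
      using continuous_map_from_subtopology[OF continuous_rng_src_G(1)]
      by (auto simp: continuous_map_in_subtopology)
    have "continuous_map (subtopology (obj_topo G) (rng G ` W)) (subtopology TX N) fst"
      using continuous_map_from_subtopology[OF cf] s(2) by (auto simp: continuous_map_in_subtopology rng)
    from continuous_map_compose[OF this W(4)]
    have "continuous_map (subtopology (obj_topo G) (rng G ` W)) (topo G) (\<lambda>u. \<sigma> (fst u))" by (simp add: o_def)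
    then show "continuous_map (subtopology (obj_topo G) (rng G ` W)) (subtopology (topo G) W) (\<lambda>u. \<sigma> (fst u))"
      using s by (auto simp: continuous_map_in_subtopology rng)
    show "\<sigma> (fst (rng G h)) = h" if "h \<in> topspace (subtopology (topo G) W)" for h
      using that s(2) by (simp add: rng)
    show "rng G (\<sigma> (fst u)) = u" if "u \<in> topspace (subtopology (obj_topo G) (rng G ` W))" for u
    proof -
      have "u \<in> rng G ` W" using that unfolding tW .
      then obtain h where "h \<in> W" "u = rng G h" by blast
      then show ?thesis using s(2) by (simp add: rng)
    qed
  qed
  then have "homeomorphic_map (subtopology (topo G) W) (subtopology (obj_topo G) (rng G ` W)) (rng G)"
    using homeomorphic_map_maps by blast
  then show "\<exists>U. openin (topo G) U \<and> g \<in> U \<and> openin (obj_topo G) (rng G ` U) \<and>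
      homeomorphic_map (subtopology (topo G) U) (subtopology (obj_topo G) (rng G ` U)) (rng G)"
    using W oW by blast
qed

end

section \<open>Counting measures on an etale groupoid\<close>

lemma Hausdorff_space_separate_finite:
  assumes "Hausdorff_space T" "finite S" "S \<subseteq> topspace T"
  obtains V where "\<And>x. x \<in> S \<Longrightarrow> openin T (V x) \<and> x \<in> V x"
    "\<And>x y. x \<in> S \<Longrightarrow> y \<in> S \<Longrightarrow> x \<noteq> y \<Longrightarrow> V x \<inter> V y = {}"
proof -
  have "\<forall>x\<in>S. \<forall>y\<in>S - {x}. \<exists>U W. openin T U \<and> openin T W \<and> x \<in> U \<and> y \<in> W \<and> U \<inter> W = {}"
  proof (intro ballI)
    fix x y assume "x \<in> S" "y \<in> S - {x}"
    then have "x \<in> topspace T" "y \<in> topspace T" "x \<noteq> y" using assms(3) by auto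
    then show "\<exists>U W. openin T U \<and> openin T W \<and> x \<in> U \<and> y \<in> W \<and> U \<inter> W = {}"
      using assms(1) unfolding Hausdorff_space_def disjnt_def by metis
  qed
  then obtain U W where UW: "\<And>x y. x \<in> S \<Longrightarrow> y \<in> S - {x} \<Longrightarrow>
      openin T (U x y) \<and> openin T (W x y) \<and> x \<in> U x y \<and> y \<in> W x y \<and> U x y \<inter> W x y = {}"
    by metis
  \<comment> \<open>The choices made for \<open>(x, y)\<close> and for \<open>(y, x)\<close> need
    not match, so each point takes its neighbourhoods from both. The factor
    \<open>topspace T\<close> covers the empty intersection.\<close>
  define V where "V x = (\<Inter>y\<in>S - {x}. U x y \<inter> W y x) \<inter> topspace T" for x
  show ?thesis
  proof
    fix x assume x: "x \<in> S"
    have "openin T (V x)"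
      unfolding V_def using UW[OF x] UW[of _ x] x assms(2) by (intro openin_INT) auto
    moreover have "x \<in> V x" using UW[OF x] UW[of _ x] x assms(3) by (auto simp: V_def)
    ultimately show "openin T (V x) \<and> x \<in> V x" by blast
  next
    fix x y assume "x \<in> S" "y \<in> S" "x \<noteq> y"
    then show "V x \<inter> V y = {}" using UW[of x y] by (auto simp: V_def)
  qed
qed

text \<open>The measure has to live on the Borel sets of the whole groupoid, so counting on the
  fibre is pushed forward along the inclusion.\<close>

definition fibre_counting :: "'a groupoid \<Rightarrow> 'a \<Rightarrow> 'a measure" where
  "fibre_counting G u =
    distr (count_space (rng_fibre G u)) (sigma (mor G) {U. openin (topo G) U}) (\<lambda>g. g)"

section \<open>Fibres of an etale groupoid\<close>

locale etale_groupoid =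
  fixes G :: "'a groupoid"
  assumes groupoid: "topological_groupoid G"
    and locally_compact: "locally_compact_space (topo G)"
    and Hausdorff: "Hausdorff_space (topo G)"
    and local_homeomorphism_rng: "local_homeomorphism (topo G) (obj_topo G) (rng G)"
begin

abbreviation borel_G :: "'a measure" where
  "borel_G \<equiv> sigma (mor G) {U. openin (topo G) U}"

lemma groupoidD:
  shows "is_category G"
    and "\<forall>x\<in>mor G. inverse_mor G x \<in> mor G \<and>
        rng G (inverse_mor G x) = src G x \<and> src G (inverse_mor G x) = rng G x \<and>
        cmp G x (inverse_mor G x) = rng G x \<and> cmp G (inverse_mor G x) x = src G x"
    and "continuous_map (topo G) (obj_topo G) (rng G)"
  using groupoid unfolding topological_groupoid_def by - (elim conjE, assumption)+

lemma categoryD: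
  shows "\<forall>x\<in>mor G. rng G x \<in> obj G \<and> src G x \<in> obj G"
    and "\<forall>(x, y)\<in>composable G. cmp G x y \<in> mor G \<and> rng G (cmp G x y) = rng G x \<and> src G (cmp G x y) = src G y"
    and "\<forall>x y z. (x, y) \<in> composable G \<and> (y, z) \<in> composable G \<longrightarrow> cmp G (cmp G x y) z = cmp G x (cmp G y z)"
    and "\<forall>x\<in>mor G. cmp G (rng G x) x = x \<and> cmp G x (src G x) = x"
  using groupoidD(1) unfolding is_category_def by - (elim conjE, assumption)+

text \<open>Translation by the inverse of \<open>x\<close> undoes translation by \<open>x\<close> on
  either side. Invariance of the counting measures is this re-indexing of fibres.\<close>

lemma bij_betw_translation:
  assumes x: "x \<in> mor G"
  shows "bij_betw (cmp G x) (rng_fibre G (src G x)) (rng_fibre G (rng G x))"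
proof -
  have inv: "inverse_mor G x \<in> mor G" "rng G (inverse_mor G x) = src G x" "src G (inverse_mor G x) = rng G x"
    "cmp G x (inverse_mor G x) = rng G x" "cmp G (inverse_mor G x) x = src G x"
    using groupoidD(2) x by blast+
  have maps: "cmp G a y \<in> rng_fibre G (rng G a)" if "a \<in> mor G" "y \<in> rng_fibre G (src G a)" for a y
  proof -
    have "(a, y) \<in> composable G" using that by (simp add: composable_def rng_fibre_def)
    then show ?thesis using categoryD(2) by (auto simp: rng_fibre_def)
  qed
  have cancel: "cmp G b (cmp G a y) = y"
    if "a \<in> mor G" "b \<in> mor G" "src G b = rng G a" "cmp G b a = src G a" "y \<in> rng_fibre G (src G a)" for a b y
  proof -
    have "(b, a) \<in> composable G" "(a, y) \<in> composable G"
      using that by (simp_all add: composable_def rng_fibre_def)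
    then have "cmp G b (cmp G a y) = cmp G (src G a) y" using categoryD(3) that(4) by metis
    then show ?thesis using categoryD(4) that(5) by (auto simp: rng_fibre_def)
  qed
  show ?thesis
  proof (rule bij_betw_byWitness[where f' = "cmp G (inverse_mor G x)"])
    show "\<forall>y\<in>rng_fibre G (src G x). cmp G (inverse_mor G x) (cmp G x y) = y"
      using cancel[of x "inverse_mor G x"] x inv by simp
    show "\<forall>y\<in>rng_fibre G (rng G x). cmp G x (cmp G (inverse_mor G x) y) = y"
      using cancel[of "inverse_mor G x" x] x inv by simp
    show "cmp G x ` rng_fibre G (src G x) \<subseteq> rng_fibre G (rng G x)"
      using maps[OF x] by blast
    show "cmp G (inverse_mor G x) ` rng_fibre G (rng G x) \<subseteq> rng_fibre G (src G x)"
      using maps[OF inv(1)] inv by auto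
  qed
qed

lemma bisection_nbhd:
  assumes g: "g \<in> mor G"
  obtains U where "openin (topo G) U" "g \<in> U" "inj_on (rng G) U"
    "\<And>Y. openin (topo G) Y \<Longrightarrow> Y \<subseteq> U \<Longrightarrow> openin (obj_topo G) (rng G ` Y)"
proof -
  obtain U where U: "openin (topo G) U" "g \<in> U" "openin (obj_topo G) (rng G ` U)"
    "homeomorphic_map (subtopology (topo G) U) (subtopology (obj_topo G) (rng G ` U)) (rng G)"
    using bspec[OF local_homeomorphism_rng[unfolded local_homeomorphism_def] g] by blast
  have sub: "U \<subseteq> mor G" using openin_subset[OF U(1)] .
  have "inj_on (rng G) U"
    using homeomorphic_imp_injective_map[OF U(4)] sub by (simp add: Int_absorb1)
  moreover have "openin (obj_topo G) (rng G ` Y)" if "openin (topo G) Y" "Y \<subseteq> U" for Y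
  proof -
    have "openin (subtopology (topo G) U) Y" using that U(1) by (simp add: openin_open_subtopology)
    then have "openin (subtopology (obj_topo G) (rng G ` U)) (rng G ` Y)"
      using homeomorphic_imp_open_map[OF U(4)] unfolding open_map_def by blast
    then show ?thesis using openin_trans_full U(3) by blast
  qed
  ultimately show ?thesis using that U by blast
qed

lemma topspace_obj: "topspace (obj_topo G) = obj G"
  by (auto simp: obj_def)

lemma Hausdorff_obj: "Hausdorff_space (obj_topo G)"
  using Hausdorff Hausdorff_space_subtopology by blast

lemma fibre_sub: "rng_fibre G u \<subseteq> mor G"
  by (auto simp: rng_fibre_def)

text \<open>A neighbourhood on which the range map is injective meets the fibre in at most one
  point. So the closed fibre is discrete, and none of its subsets accumulates anywhere.\<close>

lemma closedin_fibre_subset: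
  assumes u: "u \<in> obj G" and A: "A \<subseteq> rng_fibre G u"
  shows "closedin (topo G) A"
proof -
  have cl: "closedin (obj_topo G) {u}"
    using closedin_Hausdorff_singleton[OF Hausdorff_obj] u topspace_obj by blast
  have "closedin (topo G) {g \<in> mor G. rng G g \<in> {u}}"
    using closedin_continuous_map_preimage[OF groupoidD(3) cl] .
  then have oF: "openin (topo G) (mor G - rng_fibre G u)"
    unfolding rng_fibre_def by (auto simp: closedin_def)
  have "openin (topo G) (mor G - A)"
  proof (subst openin_subopen, rule ballI)
    fix g assume g: "g \<in> mor G - A"
    show "\<exists>T. openin (topo G) T \<and> g \<in> T \<and> T \<subseteq> mor G - A"
    proof (cases "g \<in> rng_fibre G u")
      case True
      obtain U where U: "openin (topo G) U" "g \<in> U" "inj_on (rng G) U"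
        using bisection_nbhd[of g] g by blast
      have "h \<notin> A" if "h \<in> U" for h
      proof
        assume h: "h \<in> A"
        then have "rng G h = rng G g" using A True by (auto simp: rng_fibre_def)
        then have "h = g" using inj_onD[OF U(3) _ that U(2)] by blast
        then show False using h g by blast
      qed
      then show ?thesis using U openin_subset[OF U(1)] by blast
    next
      case False
      then show ?thesis using oF g A by blast
    qed
  qed
  then show ?thesis using A fibre_sub by (auto simp: closedin_def)
qed

lemma finite_compact_Int_fibre:
  assumes K: "compactin (topo G) K" and u: "u \<in> obj G"
  shows "finite (K \<inter> rng_fibre G u)"
proof -
  let ?S = "K \<inter> rng_fibre G u"
  have S: "compactin (topo G) ?S"
    using compact_Int_closedin[OF K closedin_fibre_subset[OF u order_refl]] .
  \<comment> \<open>\<open>c g\<close> omits every point of the compact set except \<open>g\<close>,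
    so a finite subcover leaves room for finitely many points only.\<close>
  define c where "c g = mor G - (?S - {g})" for g
  have "openin (topo G) (c g)" for g
    using closedin_fibre_subset[OF u, of "?S - {g}"] unfolding c_def closedin_def by blast
  then have op: "openin (topo G) U" if "U \<in> c ` ?S" for U using that by blast
  have "g \<in> c g" if "g \<in> ?S" for g using that fibre_sub unfolding c_def by blast
  then have cov: "?S \<subseteq> \<Union> (c ` ?S)" by blast
  obtain \<F> where \<F>: "finite \<F>" "\<F> \<subseteq> c ` ?S" "?S \<subseteq> \<Union> \<F>"
    using compactinD[OF S op cov] by metis
  then obtain F where F: "finite F" "F \<subseteq> ?S" "\<F> = c ` F"
    using finite_subset_image[OF \<F>(1,2)] by metis
  have "?S \<subseteq> F" using \<F>(3) unfolding F(3) c_def by blast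
  then show ?thesis using F(1) finite_subset by blast
qed

lemma space_borel_G [simp]: "space borel_G = mor G"
  by (rule space_measure_of_conv)

lemma sets_borel_G: "sets borel_G = sigma_sets (mor G) {U. openin (topo G) U}"
  by (rule sets_measure_of) (use openin_subset in blast)

lemma openin_borel_G: "openin (topo G) U \<Longrightarrow> U \<in> sets borel_G"
  unfolding sets_borel_G by blast

lemma closedin_borel_G: assumes "closedin (topo G) C" shows "C \<in> sets borel_G"
proof -
  have "C = space borel_G - (mor G - C)" using closedin_subset[OF assms] by auto
  then show ?thesis using sets.compl_sets[OF openin_borel_G, of "mor G - C"] assms by (auto simp: closedin_def)
qed

lemma compactin_borel_G: "compactin (topo G) K \<Longrightarrow> K \<in> sets borel_G"
  using closedin_borel_G compactin_imp_closedin[OF Hausdorff] by blast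

lemma id_measurable: "(\<lambda>g. g) \<in> measurable (count_space (rng_fibre G u)) borel_G"
  using fibre_sub by auto

lemma sets_fibre_counting [simp]: "sets (fibre_counting G u) = sets borel_G"
  by (simp add: fibre_counting_def)

lemma space_fibre_counting [simp]: "space (fibre_counting G u) = mor G"
  by (simp add: fibre_counting_def)

lemma emeasure_fibre_counting:
  assumes "A \<in> sets borel_G"
  shows "emeasure (fibre_counting G u) A = emeasure (count_space (rng_fibre G u)) (A \<inter> rng_fibre G u)"
  unfolding fibre_counting_def by (simp add: emeasure_distr[OF id_measurable assms])

lemma continuous_borel_measurable:
  fixes f :: "'a \<Rightarrow> complex"
  assumes "continuous_map (topo G) euclidean f"
  shows "f \<in> borel_measurable borel_G"
proof (rule borel_measurableI)
  fix S :: "complex set" assume "open S"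
  then have "openin (topo G) {g \<in> mor G. f g \<in> S}"
    using openin_continuous_map_preimage[OF assms] by simp
  moreover have "f -` S \<inter> space borel_G = {g \<in> mor G. f g \<in> S}" by auto
  ultimately show "f -` S \<inter> space borel_G \<in> sets borel_G" using openin_borel_G by simp
qed

text \<open>Every subset of a fibre is closed, so such functions need not be continuous.\<close>

lemma fibre_supported_borel_measurable:
  fixes f :: "'a \<Rightarrow> complex"
  assumes u: "u \<in> obj G" and f: "\<And>g. g \<in> mor G \<Longrightarrow> g \<notin> rng_fibre G u \<Longrightarrow> f g = 0"
  shows "f \<in> borel_measurable borel_G"
proof (rule borel_measurableI)
  fix S :: "complex set"
  let ?P = "\<lambda>S. f -` S \<inter> space borel_G"
  have P: "?P S \<in> sets borel_G" if "0 \<notin> S" for S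
  proof (rule closedin_borel_G[OF closedin_fibre_subset[OF u]])
    show "?P S \<subseteq> rng_fibre G u"
    proof
      fix g assume "g \<in> ?P S"
      then have "g \<in> mor G" "f g \<noteq> 0" using that by auto
      then show "g \<in> rng_fibre G u" using f by blast
    qed
  qed
  show "?P S \<in> sets borel_G"
  proof (cases "0 \<in> S")
    case True
    have "?P S = space borel_G - ?P (- S)" by auto
    moreover have "space borel_G - ?P (- S) \<in> sets borel_G"
      by (rule sets.compl_sets[OF P]) (use True in simp)
    ultimately show ?thesis by (simp only:)
  qed (rule P)
qed

lemma integral_fibre_counting:
  fixes f :: "'a \<Rightarrow> complex"
  assumes "f \<in> borel_measurable borel_G"
  shows "(\<integral>g. f g \<partial>fibre_counting G u) = (\<integral>g. f g \<partial>count_space (rng_fibre G u))"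
  unfolding fibre_counting_def by (rule integral_distr[OF id_measurable assms])

section \<open>Radon property, support and invariance\<close>

lemma radon_fibre_counting:
  assumes u: "u \<in> obj G"
  shows "radon_measure (topo G) (fibre_counting G u)"
  unfolding radon_measure_def
proof (intro conjI allI impI ballI)
  let ?\<mu> = "fibre_counting G u" and ?F = "rng_fibre G u"
  note em = emeasure_fibre_counting[of _ u]
  show "space ?\<mu> = mor G" by simp
  show "sets ?\<mu> = sigma_sets (mor G) {U. openin (topo G) U}" by (simp add: sets_borel_G)
  show "emeasure ?\<mu> K < \<infinity>" if "compactin (topo G) K" for K
    using em[OF compactin_borel_G[OF that]] finite_compact_Int_fibre[OF that u] by (simp add: ennreal_of_nat_eq_real_of_nat)
  show "emeasure ?\<mu> A = (INF U\<in>{U. openin (topo G) U \<and> A \<subseteq> U}. emeasure ?\<mu> U)" if "A \<in> sets ?\<mu>" for A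
  proof (rule antisym)
    show "emeasure ?\<mu> A \<le> (INF U\<in>{U. openin (topo G) U \<and> A \<subseteq> U}. emeasure ?\<mu> U)"
      by (rule INF_greatest) (use openin_borel_G in \<open>auto intro!: emeasure_mono\<close>)
    \<comment> \<open>Adding everything outside the fibre does not change the measure, and the
      removed set is closed as a subset of the fibre; so the infimum is attained here.\<close>
    let ?U = "mor G - (?F - A)"
    have U: "openin (topo G) ?U"
      using closedin_fibre_subset[OF u, of "?F - A"] by (auto simp: closedin_def)
    have "A \<subseteq> mor G" using sets.sets_into_space[OF that] by simp
    then have "A \<subseteq> ?U" by blast
    moreover have "?U \<inter> ?F = A \<inter> ?F" using fibre_sub by blast
    then have "emeasure ?\<mu> ?U = emeasure ?\<mu> A" using em[OF openin_borel_G[OF U]] em[of A] that by simp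
    ultimately show "(INF U\<in>{U. openin (topo G) U \<and> A \<subseteq> U}. emeasure ?\<mu> U) \<le> emeasure ?\<mu> A"
      using U by (intro INF_lower2[of ?U]) auto
  qed
  show "emeasure ?\<mu> U = (SUP K\<in>{K. compactin (topo G) K \<and> K \<subseteq> U}. emeasure ?\<mu> K)" if U: "openin (topo G) U" for U
  proof (rule antisym)
    show "(SUP K\<in>{K. compactin (topo G) K \<and> K \<subseteq> U}. emeasure ?\<mu> K) \<le> emeasure ?\<mu> U"
      by (rule SUP_least) (use openin_borel_G[OF U] in \<open>auto intro!: emeasure_mono\<close>)
    \<comment> \<open>Finite sets are compact, so finite subsets of \<open>U \<inter> ?F\<close>
      exhaust the measure of \<open>U\<close>: by the set itself if it is finite, by arbitrarily
      large cardinalities otherwise.\<close>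
    have fin: "compactin (topo G) B" "emeasure ?\<mu> B = of_nat (card B)" if "finite B" "B \<subseteq> U \<inter> ?F" for B
    proof -
      show B: "compactin (topo G) B"
        using that fibre_sub by (intro finite_imp_compactin) auto
      have "B \<inter> ?F = B" using that by blast
      then show "emeasure ?\<mu> B = of_nat (card B)" using em[OF compactin_borel_G[OF B]] that by simp
    qed
    show "emeasure ?\<mu> U \<le> (SUP K\<in>{K. compactin (topo G) K \<and> K \<subseteq> U}. emeasure ?\<mu> K)"
    proof (cases "finite (U \<inter> ?F)")
      case True
      have "emeasure ?\<mu> U = emeasure ?\<mu> (U \<inter> ?F)"
        using em[OF openin_borel_G[OF U]] fin(2)[OF True order_refl] True by simp
      then show ?thesis using fin(1)[OF True order_refl] by (intro SUP_upper2[of "U \<inter> ?F"]) auto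
    next
      case False
      have "(SUP K\<in>{K. compactin (topo G) K \<and> K \<subseteq> U}. emeasure ?\<mu> K) = top"
      proof (rule ennreal_SUP_eq_top)
        fix n :: nat
        obtain B where B: "finite B" "card B = n" "B \<subseteq> U \<inter> ?F"
          using infinite_arbitrarily_large[OF False] by blast
        then show "\<exists>K\<in>{K. compactin (topo G) K \<and> K \<subseteq> U}. of_nat n \<le> emeasure ?\<mu> K"
          using fin[OF B(1,3)] by (intro bexI[of _ B]) auto
      qed
      then show ?thesis by (simp only: top_greatest)
    qed
  qed
qed

lemma support_fibre_counting:
  assumes u: "u \<in> obj G"
  shows "measure_support (topo G) (fibre_counting G u) = rng_fibre G u"
proof (rule set_eqI)
  fix g
  let ?F = "rng_fibre G u"
  show "g \<in> measure_support (topo G) (fibre_counting G u) \<longleftrightarrow> g \<in> ?F"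
  proof
    assume g: "g \<in> measure_support (topo G) (fibre_counting G u)"
    show "g \<in> ?F"
    proof (rule ccontr)
      assume "g \<notin> ?F"
      moreover have U: "openin (topo G) (mor G - ?F)"
        using closedin_fibre_subset[OF u order_refl] by (auto simp: closedin_def)
      moreover have "emeasure (fibre_counting G u) (mor G - ?F) = 0"
        using emeasure_fibre_counting[OF openin_borel_G[OF U], of u] by (simp add: Int_commute Diff_Int_distrib)
      ultimately show False using g by (auto simp: measure_support_def)
    qed
  next
    assume g: "g \<in> ?F"
    have "emeasure (fibre_counting G u) U > 0" if U: "openin (topo G) U" "g \<in> U" for U
    proof -
      have "U \<inter> ?F \<noteq> {}" using g U by blast
      then show ?thesis
        using emeasure_fibre_counting[OF openin_borel_G[OF U(1)], of u]
        by (simp add: emeasure_count_space card_gt_0_iff)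
    qed
    then show "g \<in> measure_support (topo G) (fibre_counting G u)"
      using g fibre_sub by (auto simp: measure_support_def)
  qed
qed

text \<open>Both sides are integrals for counting measures on fibres, and translation by
  \<open>x\<close> is a bijection between the fibres. The indicator makes the left integrand vanish
  off the fibre, so its measurability does not depend on unspecified values of
  \<open>cmp G x y\<close>.\<close>

lemma invariant_fibre_counting:
  assumes x: "x \<in> mor G" and f: "f \<in> Cc (topo G)"
  shows "set_lebesgue_integral (fibre_counting G (src G x)) (rng_fibre G (src G x)) (\<lambda>y. f (cmp G x y)) =
    (\<integral>y. f y \<partial>fibre_counting G (rng G x))"
proof -
  have s: "src G x \<in> obj G" using categoryD(1) x by blast
  let ?F = "rng_fibre G (src G x)" and ?h = "\<lambda>y. indicat_real (rng_fibre G (src G x)) y *\<^sub>R f (cmp G x y)"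
  have "?h \<in> borel_measurable borel_G" by (rule fibre_supported_borel_measurable[OF s]) simp
  then have "set_lebesgue_integral (fibre_counting G (src G x)) ?F (\<lambda>y. f (cmp G x y)) = (\<integral>y. ?h y \<partial>count_space ?F)"
    unfolding set_lebesgue_integral_def by (rule integral_fibre_counting)
  also have "\<dots> = (\<integral>y. f (cmp G x y) \<partial>count_space ?F)" by (rule Bochner_Integration.integral_cong) auto
  also have "\<dots> = (\<integral>y. f y \<partial>count_space (rng_fibre G (rng G x)))"
    by (rule integral_bij_count_space[OF bij_betw_translation[OF x]])
  also have "\<dots> = (\<integral>y. f y \<partial>fibre_counting G (rng G x))"
    using f by (intro integral_fibre_counting[symmetric] continuous_borel_measurable) (auto simp: Cc_def)
  finally show ?thesis .
qed

section \<open>Continuity of fibre sums\<close>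

lemma integral_fibre_counting_Cc:
  assumes f: "f \<in> Cc (topo G)" and u: "u \<in> obj G"
  shows "(\<integral>g. f g \<partial>fibre_counting G u) = (\<Sum>g | g \<in> rng_fibre G u \<and> f g \<noteq> 0. f g)"
    and "finite {g \<in> rng_fibre G u. f g \<noteq> 0}"
proof -
  let ?K = "topo G closure_of {g \<in> mor G. f g \<noteq> 0}"
  have K: "compactin (topo G) ?K" using f by (simp add: Cc_def)
  have "{g \<in> mor G. f g \<noteq> 0} \<subseteq> ?K" by (rule closure_of_subset) blast
  then have "{g \<in> rng_fibre G u. f g \<noteq> 0} \<subseteq> ?K \<inter> rng_fibre G u" using fibre_sub by blast
  then show fin: "finite {g \<in> rng_fibre G u. f g \<noteq> 0}"
    using finite_compact_Int_fibre[OF K u] finite_subset by blast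
  have "f \<in> borel_measurable borel_G" using f continuous_borel_measurable by (simp add: Cc_def)
  from integral_fibre_counting[OF this]
  show "(\<integral>g. f g \<partial>fibre_counting G u) = (\<Sum>g | g \<in> rng_fibre G u \<and> f g \<noteq> 0. f g)"
    using lebesgue_integral_count_space_finite_support[OF fin] by simp
qed

text \<open>Near \<open>u\<^sub>0\<close> the support of \<open>f\<close> meets the fibres only in disjoint bisections through the
  finitely many points of the support over \<open>u\<^sub>0\<close>.\<close>

lemma continuous_fibre_counting:
  assumes f: "f \<in> Cc (topo G)"
  shows "continuous_map (obj_topo G) euclidean (\<lambda>u. \<integral>g. f g \<partial>fibre_counting G u)"
proof (rule continuous_map_locally)
  fix u0 assume "u0 \<in> topspace (obj_topo G)"
  then have u0: "u0 \<in> obj G" using topspace_obj by blast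
  define K where "K = topo G closure_of {g \<in> mor G. f g \<noteq> 0}"
  have K: "compactin (topo G) K" and cf: "continuous_map (topo G) euclidean f"
    using f by (auto simp: Cc_def K_def)
  have fK: "g \<in> K" if "g \<in> mor G" "f g \<noteq> 0" for g
    using that closure_of_subset[of "{g \<in> mor G. f g \<noteq> 0}" "topo G"] unfolding K_def by blast
  define S where "S = K \<inter> rng_fibre G u0"
  have S: "finite S" "S \<subseteq> mor G" unfolding S_def using finite_compact_Int_fibre[OF K u0] fibre_sub by auto
  obtain V where V: "\<And>g. g \<in> S \<Longrightarrow> openin (topo G) (V g) \<and> g \<in> V g"
    "\<And>g h. g \<in> S \<Longrightarrow> h \<in> S \<Longrightarrow> g \<noteq> h \<Longrightarrow> V g \<inter> V h = {}"
    using Hausdorff_space_separate_finite[OF Hausdorff S] by metis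
  have "\<exists>U. openin (topo G) U \<and> g \<in> U \<and> U \<subseteq> V g \<and> inj_on (rng G) U \<and>
      (\<forall>Y. openin (topo G) Y \<longrightarrow> Y \<subseteq> U \<longrightarrow> openin (obj_topo G) (rng G ` Y))" if g: "g \<in> S" for g
  proof -
    obtain U where U: "openin (topo G) U" "g \<in> U" "inj_on (rng G) U"
      "\<And>Y. openin (topo G) Y \<Longrightarrow> Y \<subseteq> U \<Longrightarrow> openin (obj_topo G) (rng G ` Y)"
      using bisection_nbhd[of g] g S(2) by blast
    show ?thesis
    proof (intro exI[of _ "U \<inter> V g"] conjI allI impI)
      show "openin (topo G) (U \<inter> V g)" "g \<in> U \<inter> V g" "U \<inter> V g \<subseteq> V g"
        using U(1,2) V(1)[OF g] by blast+
      show "inj_on (rng G) (U \<inter> V g)" using inj_on_subset[OF U(3)] by blast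
      fix Y assume "openin (topo G) Y" "Y \<subseteq> U \<inter> V g"
      then show "openin (obj_topo G) (rng G ` Y)" using U(4)[of Y] by blast
    qed
  qed
  then have "\<forall>g\<in>S. \<exists>U. openin (topo G) U \<and> g \<in> U \<and> U \<subseteq> V g \<and> inj_on (rng G) U \<and>
      (\<forall>Y. openin (topo G) Y \<longrightarrow> Y \<subseteq> U \<longrightarrow> openin (obj_topo G) (rng G ` Y))" by blast
  from bchoice[OF this] obtain U where "\<forall>g\<in>S. openin (topo G) (U g) \<and> g \<in> U g \<and> U g \<subseteq> V g \<and>
      inj_on (rng G) (U g) \<and> (\<forall>Y. openin (topo G) Y \<longrightarrow> Y \<subseteq> U g \<longrightarrow> openin (obj_topo G) (rng G ` Y))"
    by blast
  then have U: "\<And>g. g \<in> S \<Longrightarrow> openin (topo G) (U g)" "\<And>g. g \<in> S \<Longrightarrow> g \<in> U g"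
    "\<And>g. g \<in> S \<Longrightarrow> U g \<subseteq> V g" "\<And>g. g \<in> S \<Longrightarrow> inj_on (rng G) (U g)"
    "\<And>g Y. g \<in> S \<Longrightarrow> openin (topo G) Y \<Longrightarrow> Y \<subseteq> U g \<Longrightarrow> openin (obj_topo G) (rng G ` Y)"
    by blast+
  \<comment> \<open>The section of the range map through \<open>g\<close>, defined on the image of
    the bisection \<open>U g\<close>.\<close>
  define s where "s g = inv_into (U g) (rng G)" for g
  have s: "s g u \<in> U g" "rng G (s g u) = u" if "u \<in> rng G ` U g" for g u
    unfolding s_def using inv_into_into[OF that] f_inv_into_f[OF that] .
  have s': "s g (rng G h) = h" if "g \<in> S" "h \<in> U g" for g h
    unfolding s_def using inv_into_f_f[OF U(4)] that by blast
  \<comment> \<open>Over \<open>N1\<close> all the sections are defined. Over \<open>N2\<close> the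
    part of \<open>K\<close> outside the bisections has no points: that part is compact, so its
    range image is closed and can be removed.\<close>
  define N1 where "N1 = (\<Inter>g\<in>S. rng G ` U g) \<inter> topspace (obj_topo G)"
  define N2 where "N2 = topspace (obj_topo G) - rng G ` (K - \<Union> (U ` S))"
  define N where "N = N1 \<inter> N2"
  have "openin (topo G) (\<Union> (U ` S))" using U(1) by blast
  then have "closedin (topo G) (mor G - \<Union> (U ` S))" by blast
  from compact_Int_closedin[OF K this] have "compactin (topo G) (K - \<Union> (U ` S))"
    using compactin_subset_topspace[OF K] by (simp add: Diff_eq Int_assoc[symmetric] Int_absorb2)
  from image_compactin[OF this groupoidD(3)] have "closedin (obj_topo G) (rng G ` (K - \<Union> (U ` S)))"
    using compactin_imp_closedin[OF Hausdorff_obj] by blast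
  then have "openin (obj_topo G) N2" unfolding N2_def by blast
  moreover have "openin (obj_topo G) N1"
    unfolding N1_def by (rule openin_INT[OF S(1)]) (rule U(5)[OF _ U(1) order_refl])
  ultimately have oN: "openin (obj_topo G) N" unfolding N_def by blast
  have "u0 \<in> N1"
  proof -
    have "u0 \<in> rng G ` U g" if "g \<in> S" for g
      using U(2)[OF that] that unfolding S_def rng_fibre_def by blast
    then show ?thesis unfolding N1_def topspace_obj using u0 by blast
  qed
  moreover have "u0 \<in> N2"
  proof -
    have "rng G h \<noteq> u0" if "h \<in> K - \<Union> (U ` S)" for h
    proof
      assume "rng G h = u0"
      then have "h \<in> S" using that compactin_subset_topspace[OF K] by (auto simp: S_def rng_fibre_def)
      then show False using U(2) that by blast
    qed
    then show ?thesis unfolding N2_def topspace_obj using u0 by blast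
  qed
  ultimately have u0N: "u0 \<in> N" unfolding N_def by blast
  let ?N = "subtopology (obj_topo G) N"
  have tN: "topspace ?N = N" using openin_subset[OF oN] by auto
  have cs: "continuous_map ?N euclidean (\<lambda>u. f (s g u))" if g: "g \<in> S" for g
    unfolding continuous_map_def
  proof (intro conjI allI impI)
    fix W :: "complex set" assume "openin euclidean W"
    then have oW: "openin (topo G) {h \<in> mor G. f h \<in> W}" using openin_continuous_map_preimage[OF cf] by simp
    \<comment> \<open>Continuity of \<open>f\<close> along the section is read off images: the
      preimage of \<open>W\<close> is, within \<open>N\<close>, the range image of an open subset of
      the bisection.\<close>
    have "openin (obj_topo G) (rng G ` (U g \<inter> {h \<in> mor G. f h \<in> W}))"
      by (rule U(5)[OF g]) (use U(1)[OF g] oW in blast)+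
    moreover have "{u \<in> topspace ?N. f (s g u) \<in> W} = N \<inter> rng G ` (U g \<inter> {h \<in> mor G. f h \<in> W})"
    proof (intro set_eqI iffI)
      fix u assume u: "u \<in> {u \<in> topspace ?N. f (s g u) \<in> W}"
      then have uN: "u \<in> N" and fu: "f (s g u) \<in> W" using tN by blast+
      have ur: "u \<in> rng G ` U g" using uN g unfolding N_def N1_def by blast
      have "s g u \<in> U g \<inter> {h \<in> mor G. f h \<in> W}"
        using s(1)[OF ur] openin_subset[OF U(1)[OF g]] fu by blast
      then have "rng G (s g u) \<in> rng G ` (U g \<inter> {h \<in> mor G. f h \<in> W})" by (rule imageI)
      then show "u \<in> N \<inter> rng G ` (U g \<inter> {h \<in> mor G. f h \<in> W})"
        using uN unfolding s(2)[OF ur] by blast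
    next
      fix u assume "u \<in> N \<inter> rng G ` (U g \<inter> {h \<in> mor G. f h \<in> W})"
      then show "u \<in> {u \<in> topspace ?N. f (s g u) \<in> W}" using s'[OF g] unfolding tN by auto
    qed
    ultimately show "openin ?N {u \<in> topspace ?N. f (s g u) \<in> W}"
      by (simp add: openin_subtopology_Int2)
  qed simp
  have eq: "(\<integral>g. f g \<partial>fibre_counting G u) = (\<Sum>g\<in>S. f (s g u))" if u: "u \<in> N" for u
  proof -
    have uo: "u \<in> obj G" and us: "\<And>g. g \<in> S \<Longrightarrow> u \<in> rng G ` U g"
      using u unfolding N_def N1_def topspace_obj by blast+
    \<comment> \<open>Disjointness of the sets \<open>V g\<close> keeps the sections from meeting,
      so each point of the support over \<open>u\<close> is counted once; sections on which
      \<open>f\<close> vanishes contribute 0.\<close>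
    have inj: "inj_on (\<lambda>g. s g u) S"
    proof (rule inj_onI)
      fix g h assume gh: "g \<in> S" "h \<in> S" "s g u = s h u"
      then have "s g u \<in> V g \<inter> V h" using s(1)[OF us] U(3) by (metis IntI subsetD)
      then show "g = h" using V(2) gh by blast
    qed
    have sub: "(\<lambda>g. s g u) ` S \<subseteq> rng_fibre G u"
      using s[OF us] openin_subset[OF U(1)] unfolding rng_fibre_def by blast
    have "{g \<in> rng_fibre G u. f g \<noteq> 0} \<subseteq> (\<lambda>g. s g u) ` S"
    proof
      fix h assume h: "h \<in> {g \<in> rng_fibre G u. f g \<noteq> 0}"
      then have h': "h \<in> mor G" "rng G h = u" by (auto simp: rng_fibre_def)
      then have "h \<in> K" using fK h by blast
      then obtain g where "g \<in> S" "h \<in> U g" using u h' unfolding N_def N2_def by blast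
      then show "h \<in> (\<lambda>g. s g u) ` S" using s' h' by (metis imageI)
    qed
    then have "(\<Sum>g | g \<in> rng_fibre G u \<and> f g \<noteq> 0. f g) = sum f ((\<lambda>g. s g u) ` S)"
      using S(1) sub by (intro sum.mono_neutral_left) auto
    also have "\<dots> = (\<Sum>g\<in>S. f (s g u))" by (simp add: sum.reindex[OF inj])
    finally show ?thesis using integral_fibre_counting_Cc(1)[OF f uo] by simp
  qed
  have "continuous_map ?N euclidean (\<lambda>u. \<Sum>g\<in>S. f (s g u))"
    by (rule continuous_map_sum[OF S(1) cs])
  then have "continuous_map ?N euclidean (\<lambda>u. \<integral>g. f g \<partial>fibre_counting G u)"
    by (rule continuous_map_eq) (use eq tN in auto)
  then show "\<exists>N. openin (obj_topo G) N \<and> u0 \<in> N \<and>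
      continuous_map (subtopology (obj_topo G) N) euclidean (\<lambda>u. \<integral>g. f g \<partial>fibre_counting G u)"
    using oN u0N by blast
qed

lemma haar_fibre_counting: "haar_system G (fibre_counting G)"
  unfolding haar_system_def
  using groupoid locally_compact Hausdorff radon_fibre_counting support_fibre_counting
    continuous_fibre_counting invariant_fibre_counting by blast

lemma counting_fibre_counting: "counting_measures G (fibre_counting G)"
  unfolding counting_measures_def using emeasure_fibre_counting by simp

end

theorem theorem3p16:
  fixes k :: nat and \<Lambda> :: "'a kgraph"
  assumes "topological_kgraph k \<Lambda>"
    and "compactly_aligned k \<Lambda>"
  shows "topological_groupoid (path_groupoid k \<Lambda>) \<and>
         locally_compact_space (topo (path_groupoid k \<Lambda>)) \<and>
         r_discrete (path_groupoid k \<Lambda>) \<and>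
         (\<exists>\<mu>. haar_system (path_groupoid k \<Lambda>) \<mu> \<and> counting_measures (path_groupoid k \<Lambda>) \<mu>)"
proof -
  interpret aligned_kgraph k \<Lambda> by unfold_locales (rule assms)+
  interpret E: etale_groupoid G
    by unfold_locales
      (rule topological_groupoid_G locally_compact_G Hausdorff_G local_homeomorphism_rng_G)+
  show ?thesis
    using topological_groupoid_G locally_compact_G r_discrete_G E.haar_fibre_counting
      E.counting_fibre_counting by blast
qed

end
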